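(* Let $n\geq 1$, $t>0$ and $r\ge n$ be integers. There is a closed subset $S\subset \operatorname{Hom}(\mathcal{O}_{\mathbb{P}^n}(-1)^t,\mathcal{O}_{\mathbb{P}^n}^{r+t})$ of codimension at least $t-r-2n+3$ such that, whenever $V$ is a vector bundle on $\mathbb{P}^n$ given by a presentation $$0\to\mathcal{O}_{\mathbb{P}^n}(-1)^t\xrightarrow{M}\mathcal{O}_{\mathbb{P}^n}^{r+t}\to V\to 0$$ with $M\notin S$, the bundle $V$ is ample. In particular, if $t-r>2n-3$, then the general $V$ given by such a presentation is ample.
   Context: $\mathbb{P}^n$ is projective space over $\mathbb{C}$. "General" means: for every $M$ in some nonempty Zariski open subset of $\operatorname{Hom}(\mathcal{O}_{\mathbb{P}^n}(-1)^t,\mathcal{O}_{\mathbb{P}^n}^{r+t})$. A vector bundle $V$ is ample if $\mathcal{O}_{\mathbb{P}(V)}(1)$ is an ample line bundle on the projective bundle $\mathbb{P}(V)$ of one-dimensional quotients of $V$. *)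

theory Defs
  imports
    "HOL-Analysis.Abstract_Topology"
    "HOL-Library.Extended_Nat"
    "Jordan_Normal_Form.Matrix_Kernel"
begin

section \<open>Varieties as spaces with functions\<close>

text \<open>A (classical, complex) variety is represented by its space of closed points together with
  the sheaf of regular functions. Only the values of a function on \<open>U\<close> are relevant for its
  membership in \<open>regular X U\<close>.\<close>

record 'a fspace =
  topol :: "'a topology"
  regular :: "'a set \<Rightarrow> ('a \<Rightarrow> complex) set"

definition morphism :: "'a fspace \<Rightarrow> 'b fspace \<Rightarrow> ('a \<Rightarrow> 'b) \<Rightarrow> bool" where
  "morphism X Y h \<longleftrightarrow> continuous_map (topol X) (topol Y) h \<and>
     (\<forall>W \<phi>. openin (topol Y) W \<longrightarrow> \<phi> \<in> regular Y W \<longrightarrow>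
        \<phi> \<circ> h \<in> regular X {p \<in> topspace (topol X). h p \<in> W})"

definition isomorphism :: "'a fspace \<Rightarrow> 'b fspace \<Rightarrow> ('a \<Rightarrow> 'b) \<Rightarrow> bool" where
  "isomorphism X Y h \<longleftrightarrow> morphism X Y h \<and>
     (\<exists>h'. morphism Y X h' \<and> (\<forall>p \<in> topspace (topol X). h' (h p) = p)
         \<and> (\<forall>y \<in> topspace (topol Y). h (h' y) = y))"

text \<open>The reduced induced structure on a subset: regular functions are those which locally extend
  to regular functions of the ambient space.\<close>

definition induced :: "'a fspace \<Rightarrow> 'a set \<Rightarrow> 'a fspace" where
  "induced Y Z = \<lparr>topol = subtopology (topol Y) Z,
     regular = (\<lambda>U. {\<phi>. \<forall>z \<in> U. \<exists>W \<psi>. openin (topol Y) W \<and> z \<in> W \<and> W \<inter> Z \<subseteq> U \<and>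
        \<psi> \<in> regular Y W \<and> (\<forall>w \<in> W \<inter> Z. \<phi> w = \<psi> w)})\<rparr>"

definition closed_immersion :: "'a fspace \<Rightarrow> 'b fspace \<Rightarrow> ('a \<Rightarrow> 'b) \<Rightarrow> bool" where
  "closed_immersion X Y h \<longleftrightarrow> closedin (topol Y) (h ` topspace (topol X)) \<and>
     isomorphism X (induced Y (h ` topspace (topol X))) h"

section \<open>Projective space\<close>

text \<open>\<open>form k d f\<close>: \<open>f\<close> is (the function given by) a homogeneous polynomial of degree \<open>d\<close> in the
  coordinates \<open>0, \<dots>, k - 1\<close> of a complex vector.\<close>

inductive form :: "nat \<Rightarrow> nat \<Rightarrow> (complex vec \<Rightarrow> complex) \<Rightarrow> bool" for k :: nat where
  form_const: "form k 0 (\<lambda>x. c)"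
| form_coord: "i < k \<Longrightarrow> form k 1 (\<lambda>x. x $ i)"
| form_add: "form k d f \<Longrightarrow> form k d g \<Longrightarrow> form k d (\<lambda>x. f x + g x)"
| form_mult: "form k d f \<Longrightarrow> form k e g \<Longrightarrow> form k (d + e) (\<lambda>x. f x * g x)"

text \<open>Points of projective \<open>n\<close>-space are punctured lines in the space of vectors of dimension
  \<open>n + 1\<close>.\<close>

type_synonym pt = "complex vec set"

definition ray :: "complex vec \<Rightarrow> pt" where
  "ray x = {c \<cdot>\<^sub>v x |c. c \<noteq> 0}"

definition nonzero_vecs :: "nat \<Rightarrow> complex vec set" where
  "nonzero_vecs k = carrier_vec k - {0\<^sub>v k}"

definition proj_basic :: "nat \<Rightarrow> (complex vec \<Rightarrow> complex) \<Rightarrow> pt set" where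
  "proj_basic n f = {ray x |x. x \<in> nonzero_vecs (Suc n) \<and> f x \<noteq> 0}"

text \<open>The Zariski topology has the sets \<open>proj_basic n f\<close> as a basis; regular functions are locally
  quotients of forms of equal degree. (A quotient \<open>f / g\<close> on a smaller basic open set given by
  \<open>h\<close> can be rewritten as \<open>f h / g h\<close>, so the neighbourhood may be taken to be the one given by
  the denominator.)\<close>

definition proj_space :: "nat \<Rightarrow> pt fspace" where
  "proj_space n = \<lparr>topol = topology_generated_by {proj_basic n f |f d. form (Suc n) d f},
     regular = (\<lambda>U. {\<phi>. \<forall>x \<in> nonzero_vecs (Suc n). ray x \<in> U \<longrightarrow>
        (\<exists>d f g. form (Suc n) d f \<and> form (Suc n) d g \<and> g x \<noteq> 0 \<and> proj_basic n g \<subseteq> U \<and>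
           (\<forall>y \<in> nonzero_vecs (Suc n). g y \<noteq> 0 \<longrightarrow> \<phi> (ray y) = f y / g y))})\<rparr>"

section \<open>Line bundles and ampleness\<close>

text \<open>A line bundle is given by an open cover \<open>U\<^sub>i\<close> and transition functions \<open>g\<^sub>i\<^sub>j\<close>; its sections
  are the families of functions \<open>s\<^sub>i\<close> on \<open>U\<^sub>i\<close> with \<open>s\<^sub>i = g\<^sub>i\<^sub>j s\<^sub>j\<close>. Vector bundles below follow the
  same convention.\<close>

record ('i, 'a) lbundle =
  lindex :: "'i set"
  lchart :: "'i \<Rightarrow> 'a set"
  ltrans :: "'i \<Rightarrow> 'i \<Rightarrow> 'a \<Rightarrow> complex"

definition line_bundle :: "'a fspace \<Rightarrow> ('i, 'a) lbundle \<Rightarrow> bool" where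
  "line_bundle X L \<longleftrightarrow>
     (\<forall>i \<in> lindex L. openin (topol X) (lchart L i)) \<and>
     (\<Union>i \<in> lindex L. lchart L i) = topspace (topol X) \<and>
     (\<forall>i \<in> lindex L. \<forall>j \<in> lindex L. ltrans L i j \<in> regular X (lchart L i \<inter> lchart L j)) \<and>
     (\<forall>i \<in> lindex L. \<forall>p \<in> lchart L i. ltrans L i i p = 1) \<and>
     (\<forall>i \<in> lindex L. \<forall>j \<in> lindex L. \<forall>k \<in> lindex L.
        \<forall>p \<in> lchart L i \<inter> lchart L j \<inter> lchart L k. ltrans L i j p * ltrans L j k p = ltrans L i k p)"

definition tensor_power :: "('i, 'a) lbundle \<Rightarrow> nat \<Rightarrow> ('i, 'a) lbundle" where
  "tensor_power L k = L\<lparr>ltrans := (\<lambda>i j p. ltrans L i j p ^ k)\<rparr>"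

definition pullback :: "'a fspace \<Rightarrow> ('a \<Rightarrow> 'b) \<Rightarrow> ('i, 'b) lbundle \<Rightarrow> ('i, 'a) lbundle" where
  "pullback X h L = \<lparr>lindex = lindex L,
     lchart = (\<lambda>i. {p \<in> topspace (topol X). h p \<in> lchart L i}),
     ltrans = (\<lambda>i j p. ltrans L i j (h p))\<rparr>"

text \<open>An isomorphism of line bundles is given by units \<open>c\<^sub>i\<^sub>a\<close> on \<open>U\<^sub>i \<inter> U'\<^sub>a\<close>, sending a section \<open>s'\<close>
  of the second bundle to the section \<open>s\<close> of the first one with \<open>s\<^sub>i = c\<^sub>i\<^sub>a s'\<^sub>a\<close>.\<close>

definition line_bundle_iso ::
    "'a fspace \<Rightarrow> ('i, 'a) lbundle \<Rightarrow> ('j, 'a) lbundle \<Rightarrow> bool" where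
  "line_bundle_iso X L L' \<longleftrightarrow> (\<exists>c.
     (\<forall>i \<in> lindex L. \<forall>a \<in> lindex L'. c i a \<in> regular X (lchart L i \<inter> lchart L' a) \<and>
        (\<forall>p \<in> lchart L i \<inter> lchart L' a. c i a p \<noteq> 0)) \<and>
     (\<forall>i \<in> lindex L. \<forall>j \<in> lindex L. \<forall>a \<in> lindex L'. \<forall>b \<in> lindex L'.
        \<forall>p \<in> lchart L i \<inter> lchart L j \<inter> lchart L' a \<inter> lchart L' b.
          c i a p * ltrans L' a b p = ltrans L i j p * c j b p))"

text \<open>\<open>\<O>(1)\<close> on projective \<open>m\<close>-space: a linear form \<open>z\<close> is the section \<open>(z / x\<^sub>a)\<^sub>a\<close>.\<close>

definition proj_O1 :: "nat \<Rightarrow> (nat, pt) lbundle" where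
  "proj_O1 m = \<lparr>lindex = {..m}, lchart = (\<lambda>a. proj_basic m (\<lambda>x. x $ a)),
     ltrans = (\<lambda>a b P. THE z. \<exists>x \<in> P. z = x $ b / x $ a)\<rparr>"

definition very_ample :: "'a fspace \<Rightarrow> ('i, 'a) lbundle \<Rightarrow> bool" where
  "very_ample X L \<longleftrightarrow> (\<exists>m h. closed_immersion X (proj_space m) h \<and>
     line_bundle_iso X L (pullback X h (proj_O1 m)))"

definition ample_line_bundle :: "'a fspace \<Rightarrow> ('i, 'a) lbundle \<Rightarrow> bool" where
  "ample_line_bundle X L \<longleftrightarrow> line_bundle X L \<and> (\<exists>k>0. very_ample X (tensor_power L k))"

section \<open>Vector bundles and their projective bundles\<close>

record ('i, 'a) vbundle =
  rank :: nat
  index :: "'i set"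
  chart :: "'i \<Rightarrow> 'a set"
  trans :: "'i \<Rightarrow> 'i \<Rightarrow> 'a \<Rightarrow> complex mat"

definition regular_mat :: "'a fspace \<Rightarrow> 'a set \<Rightarrow> nat \<Rightarrow> nat \<Rightarrow> ('a \<Rightarrow> complex mat) \<Rightarrow> bool" where
  "regular_mat X U a b F \<longleftrightarrow> (\<forall>p \<in> U. F p \<in> carrier_mat a b) \<and>
     (\<forall>i<a. \<forall>j<b. (\<lambda>p. F p $$ (i, j)) \<in> regular X U)"

definition vector_bundle :: "'a fspace \<Rightarrow> ('i, 'a) vbundle \<Rightarrow> bool" where
  "vector_bundle X V \<longleftrightarrow>
     (\<forall>i \<in> index V. openin (topol X) (chart V i)) \<and>
     (\<Union>i \<in> index V. chart V i) = topspace (topol X) \<and>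
     (\<forall>i \<in> index V. \<forall>j \<in> index V.
        regular_mat X (chart V i \<inter> chart V j) (rank V) (rank V) (trans V i j)) \<and>
     (\<forall>i \<in> index V. \<forall>p \<in> chart V i. trans V i i p = 1\<^sub>m (rank V)) \<and>
     (\<forall>i \<in> index V. \<forall>j \<in> index V. \<forall>k \<in> index V.
        \<forall>p \<in> chart V i \<inter> chart V j \<inter> chart V k. trans V i j p * trans V j k p = trans V i k p)"

text \<open>A one-dimensional quotient of the fibre \<open>V\<^sub>p\<close> is the same as a nonzero linear functional on
  \<open>V\<^sub>p\<close> up to scaling. In the trivialisation \<open>i\<close> a functional is a (row) vector \<open>\<xi>\<close>; since
  \<open>v\<^sub>i = g\<^sub>i\<^sub>j v\<^sub>j\<close>, in the trivialisation \<open>j\<close> it becomes \<open>\<xi> g\<^sub>i\<^sub>j\<close>, that is, \<open>g\<^sub>i\<^sub>j\<^sup>T \<xi>\<close> as a column.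
  A point of the projective bundle is the set of all triples \<open>(j, p, \<xi>)\<close> describing the same
  quotient of \<open>V\<^sub>p\<close>.\<close>

definition pb_pt :: "('i, 'a) vbundle \<Rightarrow> 'i \<Rightarrow> 'a \<Rightarrow> complex vec \<Rightarrow> ('i \<times> 'a \<times> complex vec) set" where
  "pb_pt V i p \<xi> = {(j, p, c \<cdot>\<^sub>v (transpose_mat (trans V i j p) *\<^sub>v \<xi>)) |j c.
     j \<in> index V \<and> p \<in> chart V j \<and> c \<noteq> 0}"

text \<open>Homogeneous polynomials of degree \<open>d\<close> in \<open>\<xi>\<close> with coefficients in a ring \<open>R\<close> of functions of
  \<open>p\<close>.\<close>

definition form_over ::
    "('a \<Rightarrow> complex) set \<Rightarrow> nat \<Rightarrow> nat \<Rightarrow> ('a \<Rightarrow> complex vec \<Rightarrow> complex) set" where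
  "form_over R k d = {A. \<exists>(m::nat) a f. (\<forall>l<m. a l \<in> R \<and> form k d (f l)) \<and>
     A = (\<lambda>p \<xi>. \<Sum>l<m. a l p * f l \<xi>)}"

definition pb_basic :: "('i, 'a) vbundle \<Rightarrow> 'i \<Rightarrow> 'a set \<Rightarrow> ('a \<Rightarrow> complex vec \<Rightarrow> complex) \<Rightarrow>
    ('i \<times> 'a \<times> complex vec) set set" where
  "pb_basic V i U B = {pb_pt V i p \<xi> |p \<xi>. p \<in> U \<and> \<xi> \<in> nonzero_vecs (rank V) \<and> B p \<xi> \<noteq> 0}"

text \<open>The variety \<open>\<P>(V)\<close>; over a trivialising open set \<open>U\<close> this is the structure of
  \<open>Proj\<close> of the polynomial ring over the functions on \<open>U\<close>, i.e. of \<open>U\<close> times a projective space.\<close>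

definition proj_bundle ::
    "'a fspace \<Rightarrow> ('i, 'a) vbundle \<Rightarrow> ('i \<times> 'a \<times> complex vec) set fspace" where
  "proj_bundle X V = \<lparr>
     topol = topology_generated_by {pb_basic V i U B |i U d B. i \<in> index V \<and>
        openin (topol X) U \<and> U \<subseteq> chart V i \<and> B \<in> form_over (regular X U) (rank V) d},
     regular = (\<lambda>W. {\<phi>. \<forall>i \<in> index V. \<forall>p \<in> chart V i. \<forall>\<xi> \<in> nonzero_vecs (rank V).
        pb_pt V i p \<xi> \<in> W \<longrightarrow>
        (\<exists>U d A B. openin (topol X) U \<and> p \<in> U \<and> U \<subseteq> chart V i \<and>
           A \<in> form_over (regular X U) (rank V) d \<and> B \<in> form_over (regular X U) (rank V) d \<and>
           B p \<xi> \<noteq> 0 \<and> pb_basic V i U B \<subseteq> W \<and>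
           (\<forall>q \<in> U. \<forall>\<eta> \<in> nonzero_vecs (rank V). B q \<eta> \<noteq> 0 \<longrightarrow>
              \<phi> (pb_pt V i q \<eta>) = A q \<eta> / B q \<eta>))})\<rparr>"

text \<open>The universal quotient line bundle \<open>\<O>\<^bsub>\<P>(V)\<^esub>(1)\<close>: a section \<open>v\<close> of \<open>V\<close> gives the section
  \<open>\<xi> v\<^sub>i / \<xi>\<^sub>l\<close> on the chart \<open>(i, l)\<close>, where the \<open>l\<close>-th coordinate of \<open>\<xi>\<close> in the trivialisation \<open>i\<close>
  is nonzero. Hence the transition functions \<open>(\<xi> g\<^sub>i\<^sub>j)\<^sub>m / \<xi>\<^sub>l\<close>.\<close>

definition pb_O1 :: "('i, 'a) vbundle \<Rightarrow> ('i \<times> nat, ('i \<times> 'a \<times> complex vec) set) lbundle" where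
  "pb_O1 V = \<lparr>lindex = index V \<times> {..<rank V},
     lchart = (\<lambda>(i, l). pb_basic V i (chart V i) (\<lambda>p \<xi>. \<xi> $ l)),
     ltrans = (\<lambda>(i, l) (j, m) P. THE z. \<exists>p \<xi>. (i, p, \<xi>) \<in> P \<and>
        z = (transpose_mat (trans V i j p) *\<^sub>v \<xi>) $ m / \<xi> $ l)\<rparr>"

definition ample :: "'a fspace \<Rightarrow> ('i, 'a) vbundle \<Rightarrow> bool" where
  "ample X V \<longleftrightarrow> vector_bundle X V \<and> ample_line_bundle (proj_bundle X V) (pb_O1 V)"

section \<open>Presentations\<close>

text \<open>A homomorphism from \<open>\<O>(-1)\<^sup>t\<close> to \<open>\<O>\<^sup>N\<close> on projective \<open>n\<close>-space is an \<open>N \<times> t\<close> matrix of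
  linear forms \<open>x\<^sub>0 M\<^sub>0 + \<dots> + x\<^sub>n M\<^sub>n\<close>; it is represented by the tuple \<open>(M\<^sub>0, \<dots>, M\<^sub>n)\<close>.\<close>

definition hom_space :: "nat \<Rightarrow> nat \<Rightarrow> nat \<Rightarrow> (nat \<Rightarrow> complex mat) set" where
  "hom_space n t N = {..n} \<rightarrow>\<^sub>E carrier_mat N t"

definition hom_at :: "nat \<Rightarrow> nat \<Rightarrow> nat \<Rightarrow> (nat \<Rightarrow> complex mat) \<Rightarrow> complex vec \<Rightarrow> complex mat" where
  "hom_at n t N M x = mat N t (\<lambda>(i, j). \<Sum>l\<le>n. x $ l * M l $$ (i, j))"

text \<open>\<open>presentation n t N M V q\<close>: \<open>V\<close> is a vector bundle on projective \<open>n\<close>-space and \<open>q\<close> is a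
  homomorphism from \<open>\<O>\<^sup>N\<close> to \<open>V\<close> (the matrix of \<open>q\<close> in the trivialisation \<open>i\<close> being \<open>q i\<close>) making
  \<open>0 \<rightarrow> \<O>(-1)\<^sup>t \<rightarrow> \<O>\<^sup>N \<rightarrow> V \<rightarrow> 0\<close>, with first map \<open>M\<close>, an exact sequence of vector bundles, i.e.
  exact on fibres (the fibre of \<open>\<O>(-1)\<^sup>t\<close> at the point spanned by \<open>x\<close> being identified with
  the \<open>t\<close>-dimensional coordinate space by means of \<open>x\<close>).\<close>

definition presentation :: "nat \<Rightarrow> nat \<Rightarrow> nat \<Rightarrow> (nat \<Rightarrow> complex mat) \<Rightarrow>
    ('i, pt) vbundle \<Rightarrow> ('i \<Rightarrow> pt \<Rightarrow> complex mat) \<Rightarrow> bool" where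
  "presentation n t N M V q \<longleftrightarrow>
     M \<in> hom_space n t N \<and> vector_bundle (proj_space n) V \<and>
     (\<forall>i \<in> index V. regular_mat (proj_space n) (chart V i) (rank V) N (q i)) \<and>
     (\<forall>i \<in> index V. \<forall>j \<in> index V. \<forall>p \<in> chart V i \<inter> chart V j. q i p = trans V i j p * q j p) \<and>
     (\<forall>i \<in> index V. \<forall>x \<in> nonzero_vecs (Suc n). ray x \<in> chart V i \<longrightarrow>
        inj_on (\<lambda>c. hom_at n t N M x *\<^sub>v c) (carrier_vec t) \<and>
        (\<lambda>c. hom_at n t N M x *\<^sub>v c) ` carrier_vec t = mat_kernel (q i (ray x)) \<and>
        (\<lambda>v. q i (ray x) *\<^sub>v v) ` carrier_vec N = carrier_vec (rank V))"

section \<open>Affine Zariski topology and codimension\<close>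

inductive_set polynomials :: "('a \<Rightarrow> complex) set \<Rightarrow> ('a \<Rightarrow> complex) set"
  for C :: "('a \<Rightarrow> complex) set" where
  poly_const: "(\<lambda>x. c) \<in> polynomials C"
| poly_var: "f \<in> C \<Longrightarrow> f \<in> polynomials C"
| poly_add: "f \<in> polynomials C \<Longrightarrow> g \<in> polynomials C \<Longrightarrow> (\<lambda>x. f x + g x) \<in> polynomials C"
| poly_mult: "f \<in> polynomials C \<Longrightarrow> g \<in> polynomials C \<Longrightarrow> (\<lambda>x. f x * g x) \<in> polynomials C"

definition hom_coords :: "nat \<Rightarrow> nat \<Rightarrow> nat \<Rightarrow> ((nat \<Rightarrow> complex mat) \<Rightarrow> complex) set" where
  "hom_coords n t N = {(\<lambda>M. M l $$ (i, j)) |l i j. l \<le> n \<and> i < N \<and> j < t}"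

definition hom_zariski :: "nat \<Rightarrow> nat \<Rightarrow> nat \<Rightarrow> (nat \<Rightarrow> complex mat) topology" where
  "hom_zariski n t N =
     topology_generated_by {{M \<in> hom_space n t N. f M \<noteq> 0} |f. f \<in> polynomials (hom_coords n t N)}"

definition irreducible_closed :: "'a topology \<Rightarrow> 'a set \<Rightarrow> bool" where
  "irreducible_closed T Z \<longleftrightarrow> closedin T Z \<and> Z \<noteq> {} \<and>
     (\<forall>A B. closedin T A \<longrightarrow> closedin T B \<longrightarrow> Z \<subseteq> A \<union> B \<longrightarrow> Z \<subseteq> A \<or> Z \<subseteq> B)"

text \<open>The codimension of an irreducible closed \<open>Z\<close> is the supremum of the lengths of chains of
  irreducible closed sets starting at \<open>Z\<close>; the codimension of a closed set is the infimum over its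
  irreducible closed subsets (so the empty set has codimension \<open>\<infinity>\<close>).\<close>

definition codim_irred :: "'a topology \<Rightarrow> 'a set \<Rightarrow> enat" where
  "codim_irred T Z = Sup {enat c |c. \<exists>C. C 0 = Z \<and> (\<forall>i\<le>c. irreducible_closed T (C i)) \<and>
     (\<forall>i<c. C i \<subset> C (Suc i))}"

definition codim :: "'a topology \<Rightarrow> 'a set \<Rightarrow> enat" where
  "codim T S = (INF Z \<in> {Z. irreducible_closed T Z \<and> Z \<subseteq> S}. codim_irred T Z)"

end

(*
  The bundle V is globally generated, so P(V) is the set of pairs (x, xi) of a point x of P^n and a
  functional xi on C^(r+t) with xi M(x) = 0, and O(1) is pulled back along (x, xi) -> xi. The fibres of
  this projection are linear subspaces of P^n. If all of them have at most one point, the projection is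
  even a closed immersion: its image is cut out by determinants in the pencil x -> xi M(x), and on the
  image x is recovered from xi by maximal minors of the pencil. So O(1) is very ample.

  A matrix M is bad if xi M(x) = 0 for some xi and all x in some plane. Normalising xi and the plane
  exhibits the bad matrices as finitely many images of polynomial maps from affine spaces of dimension
  dim Hom - (t - r - 2n + 3), and S is the closure of their union. No dimension theory is needed for the
  codimension: an irreducible closed Z in the closure of such an image P is enlarged to the closure of
  Z + C v for a direction v that does not preserve Z, which lies in the closure of P + C v. As long as the
  number of parameters is less than dim Hom, counting monomials yields a nonzero polynomial vanishing
  on the image, so the chain can be continued.
*)
theory Submission
  imports Defs "HOL-Library.Nat_Bijection"
begin

text \<open>The constant of the codimension counts \<open>N - 1\<close> parameters for a normalised
  functional and \<open>2 * (n - 1)\<close> for a normalised plane against \<open>2 * t\<close>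
  equations, each solvable for an entry of \<open>M\<close> of its own; with
  \<open>N = r + t\<close> the surplus of equations is t - r - 2n + 3. Taking closures makes S
  closed without elimination theory; chains only need a parametrised dense subset. Separating points
  is enough for an immersion because a one-point fibre is the kernel of the matrix of x -> xi M(x):
  its rank is then exactly n, so tangent directions need no condition of their own. The main labour
  is the inverse of the immersion. Regular functions are local quotients of forms, so the passage
  from a functional back to its point and its fibre coordinates has to be made by determinants and
  adjugates whose degrees are tracked. The last claim involves a second family of bad matrices,
  those not injective at some x; there the surplus is r - n + 1, positive by
  \<open>r \<ge> n\<close>. For all other matrices the cokernel is written down as a bundle, so that
  the claim on general V is not vacuous.\<close>

text \<open>Gaussian elimination: an unknown \<open>a0\<close> with \<open>M a0 b \<noteq> 0\<close>
  is eliminated together with the equation \<open>b\<close>. With monomials as unknowns this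
  produces polynomial relations; with vectors as unknowns it bounds the size of an independent
  family.\<close>

lemma homogeneous_system:
  fixes M :: "'a \<Rightarrow> 'b \<Rightarrow> 'c::field"
  assumes "finite B" "finite A" "card B < card A"
  shows "\<exists>c. (\<exists>a\<in>A. c a \<noteq> 0) \<and> (\<forall>b\<in>B. (\<Sum>a\<in>A. c a * M a b) = 0)"
  using assms
proof (induction B arbitrary: A M rule: finite_induct)
  case empty
  then have "A \<noteq> {}" by auto
  then show ?case by (intro exI[of _ "\<lambda>_. 1"]) auto
next
  case (insert b B)
  show ?case
  proof (cases "\<forall>a\<in>A. M a b = 0")
    case True
    have "card B < card A" using insert by auto
    from insert.IH[OF insert.prems(1) this, of M] True show ?thesis
      by (auto intro!: sum.neutral)
  next
    case False
    then obtain a0 where a0: "a0 \<in> A" "M a0 b \<noteq> 0" by auto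
    define A' where "A' = A - {a0}"
    have A': "finite A'" "a0 \<notin> A'" "A = insert a0 A'" using a0 insert by (auto simp: A'_def)
    have "card B < card A'" using insert A' by auto
    from insert.IH[OF A'(1) this, of "\<lambda>a b'. M a b' - M a b / M a0 b * M a0 b'"]
    obtain c where c: "\<exists>a\<in>A'. c a \<noteq> 0"
      "\<And>b'. b' \<in> B \<Longrightarrow> (\<Sum>a\<in>A'. c a * (M a b' - M a b / M a0 b * M a0 b')) = 0" by auto
    define s where "s = (\<Sum>a\<in>A'. c a * M a b)"
    define c' where "c' = c(a0 := - s / M a0 b)"
    have sm: "(\<Sum>a\<in>A. c' a * M a b') = - s / M a0 b * M a0 b' + (\<Sum>a\<in>A'. c a * M a b')" for b'
    proof -
      have "(\<Sum>a\<in>A'. c' a * M a b') = (\<Sum>a\<in>A'. c a * M a b')"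
        by (intro sum.cong) (use A' in \<open>auto simp: c'_def\<close>)
      then show ?thesis using A' by (simp add: c'_def)
    qed
    have "(\<Sum>a\<in>A. c' a * M a b') = 0" if "b' \<in> insert b B" for b'
    proof (cases "b' = b")
      case True
      then show ?thesis using a0 unfolding sm by (simp add: s_def)
    next
      case F: False
      then have "b' \<in> B" using that by auto
      from c(2)[OF this] have "(\<Sum>a\<in>A'. c a * M a b') = (\<Sum>a\<in>A'. c a * M a b * (M a0 b' / M a0 b))"
        by (simp add: algebra_simps sum_subtractf)
      also have "\<dots> = s * (M a0 b' / M a0 b)" unfolding s_def by (simp add: sum_distrib_right sum_divide_distrib)
      finally show ?thesis unfolding sm by simp
    qed
    moreover have "\<exists>a\<in>A. c' a \<noteq> 0" using c(1) A' by (auto simp: c'_def)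
    ultimately show ?thesis by blast
  qed
qed

text \<open>\<open>topology_generated_by\<close> starts from a subbasis. The hypothesis
  \<open>basis\<close> makes the generators a basis, so that one generator suffices as a
  neighbourhood. The affine space, projective space and the projective bundle all need this.\<close>

lemma openin_generated_basisD:
  assumes "openin (topology_generated_by \<S>) U" "x \<in> U"
    and basis: "\<And>A B x. A \<in> \<S> \<Longrightarrow> B \<in> \<S> \<Longrightarrow> x \<in> A \<Longrightarrow> x \<in> B \<Longrightarrow> \<exists>C\<in>\<S>. x \<in> C \<and> C \<subseteq> A \<inter> B"
  shows "\<exists>B\<in>\<S>. x \<in> B \<and> B \<subseteq> U"
proof -
  have "generate_topology_on \<S> U" using assms(1) by (rule openin_topology_generated_by)
  then have "\<forall>x\<in>U. \<exists>B\<in>\<S>. x \<in> B \<and> B \<subseteq> U"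
  proof induction
    case (Int a b)
    show ?case
    proof
      fix x assume "x \<in> a \<inter> b"
      then obtain A B where "A \<in> \<S>" "B \<in> \<S>" "x \<in> A" "x \<in> B" "A \<subseteq> a" "B \<subseteq> b"
        using Int by blast
      with basis[of A B x] show "\<exists>B\<in>\<S>. x \<in> B \<and> B \<subseteq> a \<inter> b" by blast
    qed
  next
    case (UN K)
    then show ?case by (meson UnionE Union_upper subset_trans)
  qed auto
  then show ?thesis using assms(2) by blast
qed

section \<open>Polynomial functions\<close>

lemma polynomials_sum:
  assumes "\<And>i. i \<in> A \<Longrightarrow> f i \<in> polynomials C"
  shows "(\<lambda>x. \<Sum>i\<in>A. f i x) \<in> polynomials C"
  using assms
proof (induction A rule: infinite_finite_induct)
  case (insert a A)
  then show ?case by (simp add: polynomials.poly_add)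
qed (auto intro: poly_const)

lemma polynomials_prod:
  assumes "\<And>i. i \<in> A \<Longrightarrow> f i \<in> polynomials C"
  shows "(\<lambda>x. \<Prod>i\<in>A. f i x) \<in> polynomials C"
  using assms
proof (induction A rule: infinite_finite_induct)
  case (insert a A)
  then show ?case by (simp add: polynomials.poly_mult)
qed (auto intro: poly_const)

lemma polynomials_power: "f \<in> polynomials C \<Longrightarrow> (\<lambda>x. f x ^ k) \<in> polynomials C"
  by (induction k) (auto intro: poly_const polynomials.poly_mult)

lemma polynomials_uminus: "f \<in> polynomials C \<Longrightarrow> (\<lambda>x. - f x) \<in> polynomials C"
  using polynomials.poly_mult[OF poly_const[of "-1" C], of f] by simp

lemma polynomials_compose:
  assumes "f \<in> polynomials C" "\<And>g. g \<in> C \<Longrightarrow> (\<lambda>v. g (\<phi> v)) \<in> polynomials C'"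
  shows "(\<lambda>v. f (\<phi> v)) \<in> polynomials C'"
  using assms(1) by induction (auto intro: polynomials.intros assms(2))

lemma polynomials_mono: "f \<in> polynomials C \<Longrightarrow> C \<subseteq> C' \<Longrightarrow> f \<in> polynomials C'"
  by (induction rule: polynomials.induct) (auto intro: polynomials.intros)

abbreviation vars :: "'j set \<Rightarrow> (('j \<Rightarrow> complex) \<Rightarrow> complex) set" where
  "vars J \<equiv> {\<lambda>v. v j |j. j \<in> J}"

lemma polynomials_vars_cong:
  assumes "f \<in> polynomials (vars J)" "\<And>j. j \<in> J \<Longrightarrow> v j = w j"
  shows "f v = f w"
  using assms(1) by induction (auto simp: assms(2))

text \<open>Bounding the degree in each variable separately, rather than the total degree, makes the
  set of exponents a product of intervals with \<open>(d + 1) ^ card J\<close> members; the count in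
  \<open>param_vanish\<close> rests on this.\<close>

definition box_span :: "'j set \<Rightarrow> nat \<Rightarrow> (('j \<Rightarrow> complex) \<Rightarrow> complex) \<Rightarrow> bool" where
  "box_span J d f \<longleftrightarrow> (\<exists>a. \<forall>v. f v = (\<Sum>e\<in>J \<rightarrow>\<^sub>E {..d}. a e * (\<Prod>j\<in>J. v j ^ e j)))"

lemma box_span_monomial:
  assumes "finite J" "\<And>j. j \<in> J \<Longrightarrow> e j \<le> d"
  shows "box_span J d (\<lambda>v. c * (\<Prod>j\<in>J. v j ^ e j))"
  unfolding box_span_def
proof (intro exI allI)
  fix v
  let ?e = "restrict e J"
  have mem: "?e \<in> J \<rightarrow>\<^sub>E {..d}" using assms by auto
  have fin: "finite (J \<rightarrow>\<^sub>E {..d})" using assms by (auto intro: finite_PiE)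
  have "(\<Sum>e'\<in>J \<rightarrow>\<^sub>E {..d}. (if e' = ?e then c else 0) * (\<Prod>j\<in>J. v j ^ e' j))
     = (\<Sum>e'\<in>J \<rightarrow>\<^sub>E {..d}. (if e' = ?e then c * (\<Prod>j\<in>J. v j ^ e' j) else 0))"
    by (intro sum.cong) auto
  also have "\<dots> = c * (\<Prod>j\<in>J. v j ^ ?e j)" using mem fin by (simp add: sum.delta)
  also have "\<dots> = c * (\<Prod>j\<in>J. v j ^ e j)" by simp
  finally show "c * (\<Prod>j\<in>J. v j ^ e j) =
    (\<Sum>e'\<in>J \<rightarrow>\<^sub>E {..d}. (if e' = ?e then c else 0) * (\<Prod>j\<in>J. v j ^ e' j))" by simp
qed

lemma box_span_add: "box_span J d f \<Longrightarrow> box_span J d g \<Longrightarrow> box_span J d (\<lambda>v. f v + g v)"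
  unfolding box_span_def
proof (elim exE)
  fix a b
  assume "\<forall>v. f v = (\<Sum>e\<in>J \<rightarrow>\<^sub>E {..d}. a e * (\<Prod>j\<in>J. v j ^ e j))"
    "\<forall>v. g v = (\<Sum>e\<in>J \<rightarrow>\<^sub>E {..d}. b e * (\<Prod>j\<in>J. v j ^ e j))"
  then show "\<exists>a. \<forall>v. f v + g v = (\<Sum>e\<in>J \<rightarrow>\<^sub>E {..d}. a e * (\<Prod>j\<in>J. v j ^ e j))"
    by (intro exI[of _ "\<lambda>e. a e + b e"]) (simp add: algebra_simps sum.distrib)
qed

lemma box_span_sum:
  assumes "\<And>s. s \<in> S \<Longrightarrow> box_span J d (f s)"
  shows "box_span J d (\<lambda>v. \<Sum>s\<in>S. f s v)"
  using assms
proof (induction S rule: infinite_finite_induct)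
  case (insert s S)
  then show ?case by (simp add: box_span_add)
qed (auto simp: box_span_def intro!: exI[of _ "\<lambda>_. 0"])

lemma box_span_mono:
  assumes "finite J" "box_span J d f" "d \<le> d'"
  shows "box_span J d' f"
proof -
  obtain a where a: "\<And>v. f v = (\<Sum>e\<in>J \<rightarrow>\<^sub>E {..d}. a e * (\<Prod>j\<in>J. v j ^ e j))"
    using assms(2) by (auto simp: box_span_def)
  have "box_span J d' (\<lambda>v. \<Sum>e\<in>J \<rightarrow>\<^sub>E {..d}. a e * (\<Prod>j\<in>J. v j ^ e j))"
    by (intro box_span_sum box_span_monomial) (use assms in \<open>force simp: PiE_iff\<close>)+
  then show ?thesis using a by (simp add: box_span_def)
qed

lemma box_span_mult:
  assumes "finite J" "box_span J d f" "box_span J d' g"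
  shows "box_span J (d + d') (\<lambda>v. f v * g v)"
proof -
  obtain a where a: "\<And>v. f v = (\<Sum>e\<in>J \<rightarrow>\<^sub>E {..d}. a e * (\<Prod>j\<in>J. v j ^ e j))"
    using assms(2) by (auto simp: box_span_def)
  obtain b where b: "\<And>v. g v = (\<Sum>e\<in>J \<rightarrow>\<^sub>E {..d'}. b e * (\<Prod>j\<in>J. v j ^ e j))"
    using assms(3) by (auto simp: box_span_def)
  have "box_span J (d + d') (\<lambda>v. \<Sum>e\<in>J \<rightarrow>\<^sub>E {..d}. \<Sum>e'\<in>J \<rightarrow>\<^sub>E {..d'}. (a e * b e') * (\<Prod>j\<in>J. v j ^ (e j + e' j)))"
    by (intro box_span_sum box_span_monomial) (use assms in \<open>force simp: PiE_iff intro: add_mono\<close>)+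
  moreover have "(\<lambda>v. f v * g v) = (\<lambda>v. \<Sum>e\<in>J \<rightarrow>\<^sub>E {..d}. \<Sum>e'\<in>J \<rightarrow>\<^sub>E {..d'}. (a e * b e') * (\<Prod>j\<in>J. v j ^ (e j + e' j)))"
    unfolding a b sum_product by (intro ext sum.cong refl) (simp add: power_add prod.distrib)
  ultimately show ?thesis by simp
qed

lemma box_span_const: "finite J \<Longrightarrow> box_span J d (\<lambda>v. c)"
  using box_span_monomial[of J "\<lambda>_. 0" d c] by simp

lemma box_span_power:
  assumes "finite J" "box_span J d f"
  shows "box_span J (k * d) (\<lambda>v. f v ^ k)"
  by (induction k) (use box_span_mult[OF assms(1) assms(2)] box_span_const[OF assms(1)] in auto)

lemma box_span_prod:
  assumes "finite J" "\<And>s. s \<in> S \<Longrightarrow> box_span J (d s) (f s)"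
  shows "box_span J (\<Sum>s\<in>S. d s) (\<lambda>v. \<Prod>s\<in>S. f s v)"
  using assms(2)
proof (induction S rule: infinite_finite_induct)
  case (insert s S)
  then show ?case by (simp add: box_span_mult assms(1))
qed (use assms(1) box_span_const in auto)

lemma polynomials_box_span:
  assumes "finite J" "f \<in> polynomials (vars J)"
  shows "\<exists>d. box_span J d f"
  using assms(2)
proof induction
  case (poly_const c)
  then show ?case using box_span_const[OF assms(1)] by blast
next
  case (poly_var f)
  then obtain j where j: "j \<in> J" "f = (\<lambda>v. v j)" by auto
  have "(\<Prod>i\<in>J. v i ^ (if i = j then 1 else 0)) = v j" for v :: "'a \<Rightarrow> complex"
  proof -
    have "(\<Prod>i\<in>J. v i ^ (if i = j then 1 else 0)) = (\<Prod>i\<in>J. if i = j then v i else 1)"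
      by (intro prod.cong) auto
    then show ?thesis using j assms(1) by (simp add: prod.delta)
  qed
  moreover have "box_span J 1 (\<lambda>v. 1 * (\<Prod>i\<in>J. v i ^ (if i = j then 1 else 0)))"
    by (intro box_span_monomial[OF assms(1)]) simp
  ultimately show ?case using j by auto
next
  case (poly_add f g)
  then obtain d d' where "box_span J d f" "box_span J d' g" by auto
  then have "box_span J (d + d') f" "box_span J (d + d') g"
    using box_span_mono[OF assms(1)] by auto
  then show ?case using box_span_add by blast
next
  case (poly_mult f g)
  then show ?case using box_span_mult[OF assms(1)] by blast
qed

text \<open>Over an infinite field a polynomial with a nonzero coefficient is not the zero function.
  Some power \<open>k0\<close> of the new variable \<open>x\<close> has a nonzero polynomial in the
  old variables as coefficient; once these are fixed by the induction hypothesis, a nonzero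
  polynomial in one variable remains.\<close>

lemma box_combination_nonzero:
  fixes c :: "('i \<Rightarrow> nat) \<Rightarrow> complex"
  assumes "finite I" "\<exists>e\<in>I \<rightarrow>\<^sub>E {..D}. c e \<noteq> 0"
  shows "\<exists>v. (\<Sum>e\<in>I \<rightarrow>\<^sub>E {..D}. c e * (\<Prod>i\<in>I. v i ^ e i)) \<noteq> 0"
  using assms
proof (induction I arbitrary: c rule: finite_induct)
  case empty
  then show ?case by auto
next
  case (insert x I)
  then obtain e where e: "e \<in> insert x I \<rightarrow>\<^sub>E {..D}" "c e \<noteq> 0" by auto
  define k0 where "k0 = e x"
  have k0: "k0 \<le> D" using e by (auto simp: k0_def)
  have "e(x := undefined) \<in> I \<rightarrow>\<^sub>E {..D}" using e insert.hyps by (auto simp: PiE_iff extensional_def)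
  moreover have "c ((e(x := undefined))(x := k0)) \<noteq> 0" using e by (simp add: k0_def)
  ultimately have "\<exists>g\<in>I \<rightarrow>\<^sub>E {..D}. c (g(x := k0)) \<noteq> 0" by blast
  from insert.IH[OF this] obtain v where
    v: "(\<Sum>g\<in>I \<rightarrow>\<^sub>E {..D}. c (g(x := k0)) * (\<Prod>i\<in>I. v i ^ g i)) \<noteq> 0" by blast
  define q where "q k = (\<Sum>g\<in>I \<rightarrow>\<^sub>E {..D}. c (g(x := k)) * (\<Prod>i\<in>I. v i ^ g i))" for k
  define p where "p = (\<Sum>k\<le>D. monom (q k) k)"
  have "coeff p k0 = q k0" using k0 by (simp add: p_def coeff_sum)
  then have "p \<noteq> 0" using v by (auto simp: q_def)
  then obtain T where T: "poly p T \<noteq> 0" using poly_all_0_iff_0 by blast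
  have inj: "inj_on (\<lambda>(y, g). g(x := y)) ({..D} \<times> (I \<rightarrow>\<^sub>E {..D}))"
    using inj_combinator[of x I "\<lambda>_. {..D}"] insert.hyps by simp
  have "(\<Sum>e\<in>insert x I \<rightarrow>\<^sub>E {..D}. c e * (\<Prod>i\<in>insert x I. (v(x := T)) i ^ e i))
     = (\<Sum>(k, g)\<in>{..D} \<times> (I \<rightarrow>\<^sub>E {..D}). c (g(x := k)) * (\<Prod>i\<in>insert x I. (v(x := T)) i ^ (g(x := k)) i))"
    unfolding PiE_insert_eq by (subst sum.reindex[OF inj]) (simp add: case_prod_unfold)
  also have "\<dots> = (\<Sum>(k, g)\<in>{..D} \<times> (I \<rightarrow>\<^sub>E {..D}). c (g(x := k)) * (T ^ k * (\<Prod>i\<in>I. v i ^ g i)))"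
  proof (intro sum.cong refl, clarify)
    fix k g
    have "(\<Prod>i\<in>I. (v(x := T)) i ^ (g(x := k)) i) = (\<Prod>i\<in>I. v i ^ g i)"
      by (intro prod.cong) (use insert.hyps in auto)
    then show "c (g(x := k)) * (\<Prod>i\<in>insert x I. (v(x := T)) i ^ (g(x := k)) i) =
       c (g(x := k)) * (T ^ k * (\<Prod>i\<in>I. v i ^ g i))" using insert.hyps by simp
  qed
  also have "\<dots> = (\<Sum>k\<le>D. q k * T ^ k)"
    unfolding sum.cartesian_product[symmetric] q_def sum_distrib_right
    by (intro sum.cong refl) (simp add: algebra_simps)
  also have "\<dots> = poly p T" by (simp add: p_def poly_sum poly_monom)
  finally show ?case using T by (intro exI[of _ "v(x := T)"]) simp
qed

section \<open>Affine spaces with coordinates\<close>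

text \<open>The codimension argument sees a space only through coordinates and a constructor
  \<open>mk\<close>, so that the points may have any type, here tuples of matrices. What
  \<open>v\<close> does outside \<open>I\<close> does not affect \<open>mk v\<close>, by
  \<open>coord_eqI\<close>.\<close>

locale coord_space =
  fixes X :: "'a set" and I :: "'i set" and coord :: "'i \<Rightarrow> 'a \<Rightarrow> complex"
    and mk :: "('i \<Rightarrow> complex) \<Rightarrow> 'a"
  assumes finite_I: "finite I"
    and mk_in: "mk v \<in> X"
    and coord_mk: "i \<in> I \<Longrightarrow> coord i (mk v) = v i"
    and coord_eqI: "x \<in> X \<Longrightarrow> y \<in> X \<Longrightarrow> (\<And>i. i \<in> I \<Longrightarrow> coord i x = coord i y) \<Longrightarrow> x = y"
begin

abbreviation Poly :: "('a \<Rightarrow> complex) set" where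
  "Poly \<equiv> polynomials {coord i |i. i \<in> I}"

section \<open>The Zariski topology of an affine space\<close>

definition zariski :: "'a topology" where
  "zariski = topology_generated_by {{x \<in> X. f x \<noteq> 0} |f. f \<in> Poly}"

lemma coord_Poly: "i \<in> I \<Longrightarrow> coord i \<in> Poly"
  by (auto intro: poly_var)

lemma openin_basic: "f \<in> Poly \<Longrightarrow> openin zariski {x \<in> X. f x \<noteq> 0}"
  unfolding zariski_def by (intro topology_generated_by_Basis) auto

lemma topspace_zariski: "topspace zariski = X"
proof -
  have "X = {x \<in> X. (\<lambda>_. 1) x \<noteq> (0::complex)}" by auto
  then show ?thesis unfolding zariski_def topology_generated_by_topspace
    using poly_const[of 1] by blast
qed

lemma openin_basicD:
  assumes "openin zariski U" "x \<in> U"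
  shows "\<exists>f\<in>Poly. f x \<noteq> 0 \<and> {y \<in> X. f y \<noteq> 0} \<subseteq> U"
proof -
  have "\<exists>B\<in>{{x \<in> X. f x \<noteq> 0} |f. f \<in> Poly}. x \<in> B \<and> B \<subseteq> U"
  proof (rule openin_generated_basisD[OF assms[unfolded zariski_def]])
    fix A B x
    assume "A \<in> {{x \<in> X. f x \<noteq> 0} |f. f \<in> Poly}" "B \<in> {{x \<in> X. f x \<noteq> 0} |f. f \<in> Poly}" "x \<in> A" "x \<in> B"
    then obtain f g where "f \<in> Poly" "g \<in> Poly" "A = {x \<in> X. f x \<noteq> 0}" "B = {x \<in> X. g x \<noteq> 0}" "x \<in> A" "x \<in> B"
      by auto
    then show "\<exists>C\<in>{{x \<in> X. f x \<noteq> 0} |f. f \<in> Poly}. x \<in> C \<and> C \<subseteq> A \<inter> B"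
      by (intro bexI[of _ "{x \<in> X. f x * g x \<noteq> 0}"] CollectI exI[of _ "\<lambda>x. f x * g x"])
        (auto intro: polynomials.poly_mult)
  qed
  then show ?thesis by auto
qed

lemma closedin_separate:
  assumes "closedin zariski A" "x \<in> X" "x \<notin> A"
  shows "\<exists>f\<in>Poly. f x \<noteq> 0 \<and> (\<forall>a\<in>A. f a = 0)"
proof -
  have "openin zariski (X - A)" "A \<subseteq> X" using assms(1) by (auto simp: closedin_def topspace_zariski)
  with openin_basicD[of "X - A" x] assms show ?thesis by blast
qed

lemma closedin_zeros: "f \<in> Poly \<Longrightarrow> closedin zariski {x \<in> X. f x = 0}"
  using openin_basic[of f]
  by (auto simp: closedin_def topspace_zariski Diff_eq intro: back_subst[of "openin zariski"])

abbreviation cl :: "'a set \<Rightarrow> 'a set" where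
  "cl P \<equiv> zariski closure_of P"

lemma closure_vanish:
  assumes "f \<in> Poly" "P \<subseteq> X" "\<And>x. x \<in> P \<Longrightarrow> f x = 0" "x \<in> cl P"
  shows "f x = 0"
  using closure_of_minimal[of P "{x \<in> X. f x = 0}" zariski] closedin_zeros[OF assms(1)] assms by auto

section \<open>Lines and the irreducibility of swept sets\<close>

text \<open>The type of points carries no vector space structure, so the affine line through
  \<open>x\<close> in direction \<open>w\<close> is formed on coordinates.\<close>

definition line :: "'a \<Rightarrow> ('i \<Rightarrow> complex) \<Rightarrow> complex \<Rightarrow> 'a" where
  "line x w t = mk (\<lambda>i. coord i x + t * w i)"

lemma line_in: "line x w t \<in> X" by (simp add: line_def mk_in)

lemma line_0: "x \<in> X \<Longrightarrow> line x w 0 = x"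
  by (rule coord_eqI) (auto simp: line_def mk_in coord_mk)

lemma line_poly:
  assumes "f \<in> Poly"
  shows "\<exists>p. \<forall>t. f (line x w t) = poly p t"
  using assms
proof induction
  case (poly_const c)
  show ?case by (intro exI[of _ "[:c:]"]) simp
next
  case (poly_var f)
  then obtain i where "i \<in> I" "f = coord i" by auto
  then show ?case by (intro exI[of _ "[:coord i x, w i:]"]) (simp add: line_def coord_mk)
next
  case (poly_add f g)
  then obtain p q where "\<forall>t. f (line x w t) = poly p t" "\<forall>t. g (line x w t) = poly q t" by auto
  then show ?case by (intro exI[of _ "p + q"]) simp
next
  case (poly_mult f g)
  then obtain p q where "\<forall>t. f (line x w t) = poly p t" "\<forall>t. g (line x w t) = poly q t" by auto
  then show ?case by (intro exI[of _ "p * q"]) simp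
qed

text \<open>If one point of the line avoids \<open>A\<close> and another avoids \<open>B\<close>,
  separating polynomials restrict to nonzero polynomials in \<open>t\<close>; a non-root of their
  product is a point of the line outside \<open>A \<union> B\<close>.\<close>

lemma line_irreducible:
  assumes "closedin zariski A" "closedin zariski B" "\<And>t. line x w t \<in> A \<union> B"
  shows "(\<forall>t. line x w t \<in> A) \<or> (\<forall>t. line x w t \<in> B)"
proof (rule ccontr)
  assume "\<not> ?thesis"
  then obtain s t where st: "line x w s \<notin> A" "line x w t \<notin> B" by auto
  obtain f where f: "f \<in> Poly" "f (line x w s) \<noteq> 0" "\<forall>a\<in>A. f a = 0"
    using closedin_separate[OF assms(1) line_in st(1)] by auto
  obtain g where g: "g \<in> Poly" "g (line x w t) \<noteq> 0" "\<forall>a\<in>B. g a = 0"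
    using closedin_separate[OF assms(2) line_in st(2)] by auto
  obtain p where p: "\<And>t. f (line x w t) = poly p t" using line_poly[OF f(1)] by blast
  obtain q where q: "\<And>t. g (line x w t) = poly q t" using line_poly[OF g(1)] by blast
  have "p \<noteq> 0" "q \<noteq> 0" using f(2) g(2) by (auto simp: p q)
  then have "p * q \<noteq> 0" by simp
  then obtain u where "poly (p * q) u \<noteq> 0" using poly_all_0_iff_0 by blast
  then have "f (line x w u) \<noteq> 0" "g (line x w u) \<noteq> 0" by (auto simp: p q)
  then show False using assms(3)[of u] f g by auto
qed

text \<open>Any two points are joined by a line, and lines are irreducible.\<close>

lemma irreducible_space: "irreducible_closed zariski X"
  unfolding irreducible_closed_def
proof (intro conjI allI impI)
  show "closedin zariski X" using closedin_topspace[of zariski] by (simp add: topspace_zariski)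
  show "X \<noteq> {}" using mk_in by auto
  fix A B assume A: "closedin zariski A" and B: "closedin zariski B" and AB: "X \<subseteq> A \<union> B"
  show "X \<subseteq> A \<or> X \<subseteq> B"
  proof (rule ccontr)
    assume "\<not> ?thesis"
    then obtain x y where xy: "x \<in> X" "y \<in> X" "x \<notin> A" "y \<notin> B" by auto
    let ?w = "\<lambda>i. coord i y - coord i x"
    have "line x ?w 0 = x" using xy by (simp add: line_0)
    then have "\<not> (\<forall>t. line x ?w t \<in> A)" using xy by metis
    moreover have "line x ?w 1 = y" using xy by (intro coord_eqI) (auto simp: line_def mk_in coord_mk)
    then have "\<not> (\<forall>t. line x ?w t \<in> B)" using xy by metis
    moreover have "line x ?w t \<in> A \<union> B" for t using AB line_in by blast
    ultimately show False using line_irreducible[OF A B, of x ?w] by blast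
  qed
qed

text \<open>For fixed \<open>t\<close> the map \<open>x \<mapsto> line x w t\<close> is polynomial,
  and the set is an intersection of preimages of \<open>A\<close> over all \<open>t\<close>. This is
  how irreducibility passes from \<open>Z\<close> to the union of the lines through its
  points.\<close>

lemma closedin_lines:
  assumes "closedin zariski A"
  shows "closedin zariski {x \<in> X. \<forall>t. line x w t \<in> A}"
proof -
  have "openin zariski (X - {x \<in> X. \<forall>t. line x w t \<in> A})"
  proof (subst openin_subopen, intro ballI)
    fix x assume "x \<in> X - {x \<in> X. \<forall>t. line x w t \<in> A}"
    then obtain t where t: "x \<in> X" "line x w t \<notin> A" by auto
    obtain f where f: "f \<in> Poly" "f (line x w t) \<noteq> 0" "\<forall>a\<in>A. f a = 0"
      using closedin_separate[OF assms line_in t(2)] by auto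
    have "(\<lambda>x. f (line x w t)) \<in> Poly"
    proof (rule polynomials_compose[OF f(1)])
      fix g assume "g \<in> {coord i |i. i \<in> I}"
      then obtain i where i: "i \<in> I" "g = coord i" by auto
      have "(\<lambda>x. coord i x + t * w i) \<in> Poly" by (intro polynomials.poly_add coord_Poly i poly_const)
      then show "(\<lambda>x. g (line x w t)) \<in> Poly" using i by (simp add: line_def coord_mk)
    qed
    then have "openin zariski {x \<in> X. f (line x w t) \<noteq> 0}" by (rule openin_basic)
    then show "\<exists>T. openin zariski T \<and> x \<in> T \<and> T \<subseteq> X - {x \<in> X. \<forall>t. line x w t \<in> A}"
      by (intro exI[of _ "{x \<in> X. f (line x w t) \<noteq> 0}"]) (use f t in auto)
  qed
  then show ?thesis by (auto simp: closedin_def topspace_zariski)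
qed

definition sweep :: "'a set \<Rightarrow> ('i \<Rightarrow> complex) \<Rightarrow> 'a set" where
  "sweep Z w = {line z w t |z t. z \<in> Z}"

lemma sweep_subset: "sweep Z w \<subseteq> X" by (auto simp: sweep_def line_in)

lemma subset_sweep: "Z \<subseteq> X \<Longrightarrow> Z \<subseteq> sweep Z w"
  unfolding sweep_def by clarsimp (metis line_0 subsetD)

text \<open>If \<open>A\<close> and \<open>B\<close> cover the sweep, each single line lies in one
  of them. The points whose line lies in \<open>A\<close>, and those whose line lies in
  \<open>B\<close>, form closed sets that cover \<open>Z\<close>, so that irreducibility of
  \<open>Z\<close> selects one of the two for all lines at once.\<close>

lemma irreducible_sweep:
  assumes "irreducible_closed zariski Z"
  shows "irreducible_closed zariski (cl (sweep Z w))"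
  unfolding irreducible_closed_def
proof (intro conjI allI impI)
  have Z: "Z \<subseteq> X" "Z \<noteq> {}" using assms closedin_subset topspace_zariski
    by (auto simp: irreducible_closed_def)
  have sub: "sweep Z w \<subseteq> cl (sweep Z w)"
    by (intro closure_of_subset) (simp add: topspace_zariski sweep_subset)
  show "cl (sweep Z w) \<noteq> {}" using Z sub subset_sweep[OF Z(1)] by blast
  fix A B assume A: "closedin zariski A" and B: "closedin zariski B"
    and AB: "cl (sweep Z w) \<subseteq> A \<union> B"
  have "Z \<subseteq> {x \<in> X. \<forall>t. line x w t \<in> A} \<union> {x \<in> X. \<forall>t. line x w t \<in> B}"
  proof
    fix z assume z: "z \<in> Z"
    then have "line z w t \<in> A \<union> B" for t using sub AB by (auto simp: sweep_def)
    from line_irreducible[OF A B this] z Z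
    show "z \<in> {x \<in> X. \<forall>t. line x w t \<in> A} \<union> {x \<in> X. \<forall>t. line x w t \<in> B}" by auto
  qed
  with assms closedin_lines[OF A, of w] closedin_lines[OF B, of w]
  consider "Z \<subseteq> {x \<in> X. \<forall>t. line x w t \<in> A}" | "Z \<subseteq> {x \<in> X. \<forall>t. line x w t \<in> B}"
    unfolding irreducible_closed_def by meson
  then show "cl (sweep Z w) \<subseteq> A \<or> cl (sweep Z w) \<subseteq> B"
  proof cases
    case 1
    then have "sweep Z w \<subseteq> A" by (auto simp: sweep_def)
    then show ?thesis by (intro disjI1 closure_of_minimal A)
  next
    case 2
    then have "sweep Z w \<subseteq> B" by (auto simp: sweep_def)
    then show ?thesis by (intro disjI2 closure_of_minimal B)
  qed
qed auto

text \<open>The coordinates of a point of \<open>Z\<close> are exchanged one at a time for those of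
  an arbitrary \<open>y\<close>, each exchange being a move in a coordinate direction. Read
  backwards, it supplies a direction that moves a proper subset.\<close>

lemma invariant_imp_all:
  assumes Z: "Z \<subseteq> X" "Z \<noteq> {}"
    and inv: "\<And>i. i \<in> I \<Longrightarrow> sweep Z (\<lambda>k. if k = i then 1 else 0) \<subseteq> Z"
  shows "Z = X"
proof
  show "X \<subseteq> Z"
  proof
    fix y assume y: "y \<in> X"
    obtain z where z: "z \<in> Z" using Z by auto
    have "mk (\<lambda>i. if i \<in> F then coord i y else coord i z) \<in> Z" if "finite F" "F \<subseteq> I" for F
      using that
    proof (induction F rule: finite_induct)
      case empty
      have "mk (\<lambda>i. coord i z) = z" using z Z by (intro coord_eqI) (auto simp: mk_in coord_mk)
      then show ?case using z by simp
    next
      case (insert i F)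
      let ?m = "mk (\<lambda>i. if i \<in> F then coord i y else coord i z)"
      have "?m \<in> Z" using insert by auto
      then have "line ?m (\<lambda>k. if k = i then 1 else 0) (coord i y - coord i z) \<in> Z"
        using inv[of i] insert.prems by (auto simp: sweep_def)
      moreover have "line ?m (\<lambda>k. if k = i then 1 else 0) (coord i y - coord i z)
         = mk (\<lambda>k. if k \<in> insert i F then coord k y else coord k z)"
        using insert by (intro coord_eqI) (auto simp: line_def mk_in coord_mk)
      ultimately show ?case by simp
    qed
    from this[OF finite_I subset_refl]
    have "mk (\<lambda>i. if i \<in> I then coord i y else coord i z) \<in> Z" .
    moreover have "mk (\<lambda>i. if i \<in> I then coord i y else coord i z) = y"
      using y by (intro coord_eqI) (auto simp: mk_in coord_mk)
    ultimately show "y \<in> Z" by simp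
  qed
qed (use Z in auto)

section \<open>Parametrised sets and lower bounds for the codimension\<close>

text \<open>A substitute for "of dimension at most \<open>m\<close>". Only an inclusion into a
  polynomial image is demanded, so that the property is inherited by subsets and no image has to be
  computed.\<close>

definition param :: "nat \<Rightarrow> 'a set \<Rightarrow> bool" where
  "param m P \<longleftrightarrow> (\<exists>\<psi>. (\<forall>i\<in>I. \<psi> i \<in> polynomials (vars {..<m})) \<and>
     P \<subseteq> range (\<lambda>v. mk (\<lambda>i. \<psi> i v)))"

lemma param_subset: "param m P \<Longrightarrow> P \<subseteq> X"
  by (auto simp: param_def mk_in)

text \<open>Dimension count: polynomials of degree at most \<open>D\<close> in each of
  \<open>card I\<close> coordinates have \<open>(D + 1) ^ card I\<close> coefficients, and
  substituting the parametrisation makes them polynomials of degree at most \<open>Q * D\<close> in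
  each of \<open>m\<close> parameters. For large \<open>D\<close> the substitution has a
  kernel.\<close>

lemma param_vanish:
  assumes "param m P" "m < card I"
  shows "\<exists>f\<in>Poly. (\<forall>x\<in>P. f x = 0) \<and> (\<exists>x\<in>X. f x \<noteq> 0)"
proof -
  obtain \<psi> where \<psi>: "\<And>i. i \<in> I \<Longrightarrow> \<psi> i \<in> polynomials (vars {..<m})"
    and P: "P \<subseteq> range (\<lambda>v. mk (\<lambda>i. \<psi> i v))" using assms(1) by (auto simp: param_def)
  have "\<forall>i\<in>I. \<exists>d. box_span {..<m} d (\<psi> i)" using polynomials_box_span \<psi> by blast
  from bchoice[OF this] obtain d where d: "\<And>i. i \<in> I \<Longrightarrow> box_span {..<m} (d i) (\<psi> i)" by blast
  define Q where "Q = Suc (\<Sum>i\<in>I. d i)"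
  \<comment> \<open>Just large enough: as \<open>Q \<ge> 1\<close>,
    \<open>(Q * D + 1) ^ m \<le> Q ^ m * (D + 1) ^ m = D * (D + 1) ^ m\<close>, which is below
    \<open>(D + 1) ^ Suc m\<close>.\<close>
  define D where "D = Q ^ m"
  let ?E = "I \<rightarrow>\<^sub>E {..D}" and ?F = "{..<m} \<rightarrow>\<^sub>E {..Q * D}"
  have "\<forall>e\<in>?E. box_span {..<m} (Q * D) (\<lambda>v. \<Prod>i\<in>I. \<psi> i v ^ e i)"
  proof
    fix e assume e: "e \<in> ?E"
    have "box_span {..<m} (\<Sum>i\<in>I. e i * d i) (\<lambda>v. \<Prod>i\<in>I. \<psi> i v ^ e i)"
      by (intro box_span_prod box_span_power d) auto
    moreover have "(\<Sum>i\<in>I. e i * d i) \<le> (\<Sum>i\<in>I. D * d i)"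
      using e by (intro sum_mono mult_right_mono) (auto simp: PiE_iff)
    then have "(\<Sum>i\<in>I. e i * d i) \<le> Q * D" by (simp add: Q_def sum_distrib_left[symmetric] mult.commute)
    ultimately show "box_span {..<m} (Q * D) (\<lambda>v. \<Prod>i\<in>I. \<psi> i v ^ e i)"
      using box_span_mono by blast
  qed
  then have "\<exists>a. \<forall>e\<in>?E. \<forall>v. (\<Prod>i\<in>I. \<psi> i v ^ e i) = (\<Sum>u\<in>?F. a e u * (\<Prod>j<m. v j ^ u j))"
    unfolding box_span_def by (rule bchoice)
  then obtain a where a: "\<And>e v. e \<in> ?E \<Longrightarrow>
      (\<Prod>i\<in>I. \<psi> i v ^ e i) = (\<Sum>u\<in>?F. a e u * (\<Prod>j<m. v j ^ u j))"
    by blast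
  have "(Q * D + 1) ^ m \<le> (Q * (D + 1)) ^ m" by (intro power_mono) (auto simp: Q_def)
  also have "\<dots> = D * (D + 1) ^ m" by (subst power_mult_distrib) (simp only: D_def)
  also have "\<dots> < (D + 1) * (D + 1) ^ m" by simp
  also have "\<dots> \<le> (D + 1) ^ card I"
    using power_increasing[of "Suc m" "card I" "D + 1"] assms(2) by simp
  finally have "card ?F < card ?E" using finite_I by (simp add: card_PiE)
  moreover have "finite ?E" "finite ?F" using finite_I by (auto intro: finite_PiE)
  \<comment> \<open>The unknowns are the coefficients of the relation; there is one equation for
    each monomial in the parameters.\<close>
  ultimately obtain c where c: "\<exists>e\<in>?E. c e \<noteq> 0" "\<And>u. u \<in> ?F \<Longrightarrow> (\<Sum>e\<in>?E. c e * a e u) = 0"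
    using homogeneous_system[of ?F ?E a] by blast
  define f where "f x = (\<Sum>e\<in>?E. c e * (\<Prod>i\<in>I. coord i x ^ e i))" for x
  have "f \<in> Poly" unfolding f_def[abs_def]
    by (intro polynomials_sum polynomials_prod polynomials_power polynomials.poly_mult poly_const coord_Poly)
  moreover have "f x = 0" if "x \<in> P" for x
  proof -
    obtain v where v: "x = mk (\<lambda>i. \<psi> i v)" using \<open>x \<in> P\<close> P by auto
    have "f x = (\<Sum>e\<in>?E. c e * (\<Prod>i\<in>I. \<psi> i v ^ e i))"
      unfolding f_def v by (simp add: coord_mk)
    also have "\<dots> = (\<Sum>e\<in>?E. \<Sum>u\<in>?F. c e * a e u * (\<Prod>j<m. v j ^ u j))"
      by (intro sum.cong refl) (simp add: a sum_distrib_left algebra_simps)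
    also have "\<dots> = (\<Sum>u\<in>?F. (\<Sum>e\<in>?E. c e * a e u) * (\<Prod>j<m. v j ^ u j))"
      unfolding sum_distrib_right by (rule sum.swap)
    also have "\<dots> = 0" using c(2) by simp
    finally show ?thesis .
  qed
  moreover obtain v where v: "(\<Sum>e\<in>?E. c e * (\<Prod>i\<in>I. v i ^ e i)) \<noteq> 0"
    using box_combination_nonzero[OF finite_I c(1)] by blast
  then have "f (mk v) \<noteq> 0" by (simp add: f_def coord_mk)
  then have "\<exists>x\<in>X. f x \<noteq> 0" using mk_in by blast
  ultimately show ?thesis by blast
qed

lemma param_not_dense: "param m P \<Longrightarrow> m < card I \<Longrightarrow> cl P \<noteq> X"
  using param_vanish[of m P] closure_vanish[OF _ param_subset, of _ m P] by blast

text \<open>The position on the line becomes an additional parameter, stored in the variable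
  \<open>m\<close>, on which the old \<open>\<psi>\<close> does not depend.\<close>

lemma param_sweep:
  assumes "param m P"
  shows "param (Suc m) (sweep P w)"
proof -
  obtain \<psi> where \<psi>: "\<And>i. i \<in> I \<Longrightarrow> \<psi> i \<in> polynomials (vars {..<m})"
    and P: "P \<subseteq> range (\<lambda>v. mk (\<lambda>i. \<psi> i v))" using assms by (auto simp: param_def)
  define \<psi>' where "\<psi>' i = (\<lambda>v. \<psi> i v + v m * w i)" for i
  have "\<psi>' i \<in> polynomials (vars {..<Suc m})" if "i \<in> I" for i
    unfolding \<psi>'_def
    by (intro polynomials.poly_add polynomials.poly_mult poly_const poly_var
        polynomials_mono[OF \<psi>[OF that]]) force+
  moreover have "sweep P w \<subseteq> range (\<lambda>v. mk (\<lambda>i. \<psi>' i v))"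
  proof
    fix y assume "y \<in> sweep P w"
    then obtain v t where y: "y = line (mk (\<lambda>i. \<psi> i v)) w t" using P by (auto simp: sweep_def)
    have "\<psi> i (v(m := t)) = \<psi> i v" if "i \<in> I" for i
      by (rule polynomials_vars_cong[OF \<psi>[OF that]]) auto
    then have "y = mk (\<lambda>i. \<psi>' i (v(m := t)))"
      unfolding y by (intro coord_eqI) (auto simp: line_def mk_in coord_mk \<psi>'_def)
    then show "y \<in> range (\<lambda>v. mk (\<lambda>i. \<psi>' i v))" by blast
  qed
  ultimately show ?thesis unfolding param_def by blast
qed

text \<open>\<open>Z\<close> and \<open>P\<close> are swept in the same direction, which uses up one
  unit of the slack \<open>m + c \<le> card I\<close>. Irreducibility and the containment in
  \<open>cl P\<close> are all that the induction carries along for \<open>Z\<close>.\<close>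

lemma irreducible_chain:
  assumes "irreducible_closed zariski Z" "Z \<subseteq> cl P" "param m P" "m + c \<le> card I"
  shows "\<exists>C. C 0 = Z \<and> (\<forall>i\<le>c. irreducible_closed zariski (C i)) \<and> (\<forall>i<c. C i \<subset> C (Suc i))"
  using assms
proof (induction c arbitrary: Z P m)
  case 0
  then show ?case by (intro exI[of _ "\<lambda>_. Z"]) auto
next
  case (Suc c)
  have Z: "Z \<subseteq> X" "Z \<noteq> {}" "closedin zariski Z" using Suc.prems(1) closedin_subset topspace_zariski
    by (auto simp: irreducible_closed_def)
  have "cl P \<noteq> X" using param_not_dense Suc.prems by auto
  moreover have "cl P \<subseteq> X" using closure_of_subset_topspace topspace_zariski by metis
  ultimately have "Z \<noteq> X" using Suc.prems(2) by auto
  then obtain w where w: "\<not> sweep Z w \<subseteq> Z" using invariant_imp_all Z by blast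
  let ?Z = "cl (sweep Z w)"
  have sub: "sweep Z w \<subseteq> ?Z" by (intro closure_of_subset) (simp add: topspace_zariski sweep_subset)
  have "Z \<subset> ?Z" using sub w subset_sweep[OF Z(1), of w] by blast
  \<comment> \<open>The points whose whole line lies in \<open>cl (sweep P w)\<close> form a closed
    set containing \<open>P\<close>, hence also \<open>cl P\<close> and \<open>Z\<close>.\<close>
  have "closedin zariski (cl (sweep P w))" by simp
  from closedin_lines[OF this, of w]
  have "cl P \<subseteq> {x \<in> X. \<forall>t. line x w t \<in> cl (sweep P w)}"
    using param_subset[OF Suc.prems(3)]
      closure_of_subset[of "sweep P w" zariski] sweep_subset[of P w] topspace_zariski
    by (intro closure_of_minimal) (auto simp: sweep_def)
  then have "sweep Z w \<subseteq> cl (sweep P w)"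
    using Suc.prems(2) by (auto simp: sweep_def)
  then have "?Z \<subseteq> cl (sweep P w)" by (simp add: closure_of_minimal)
  from Suc.IH[OF irreducible_sweep[OF Suc.prems(1)] this param_sweep[OF Suc.prems(3)]] Suc.prems(4)
  obtain C where C: "C 0 = ?Z" "\<forall>i\<le>c. irreducible_closed zariski (C i)" "\<forall>i<c. C i \<subset> C (Suc i)"
    by auto
  show ?case
    \<comment> \<open>\<open>case_nat\<close> puts \<open>Z\<close> in front of the chain that
      starts at its swept closure.\<close>
    by (rule exI[of _ "case_nat Z C"])
      (use C \<open>Z \<subset> ?Z\<close> Suc.prems(1) in \<open>auto split: nat.splits simp: less_Suc_eq_0_disj\<close>)
qed

lemma irreducible_finite_union:
  assumes "finite \<A>" "\<And>A. A \<in> \<A> \<Longrightarrow> closedin zariski A" "irreducible_closed zariski Z" "Z \<subseteq> \<Union>\<A>"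
  shows "\<exists>A\<in>\<A>. Z \<subseteq> A"
  using assms
proof (induction \<A> rule: finite_induct)
  case empty
  then show ?case by (auto simp: irreducible_closed_def)
next
  case (insert A \<A>)
  have "closedin zariski A" "closedin zariski (\<Union>\<A>)" using insert by (auto intro!: closedin_Union)
  with insert.prems(2,3) have "Z \<subseteq> A \<or> Z \<subseteq> \<Union>\<A>" by (auto simp: irreducible_closed_def)
  then show ?case using insert by auto
qed

text \<open>As the union is finite, an irreducible closed subset lies in a single
  \<open>cl P\<close>, where \<open>irreducible_chain\<close> applies.\<close>

lemma codim_param:
  assumes "finite \<P>" "\<And>P. P \<in> \<P> \<Longrightarrow> param m P" "m + c \<le> card I"
  shows "enat c \<le> codim zariski (\<Union>P\<in>\<P>. cl P)"
  unfolding codim_def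
proof (rule INF_greatest)
  fix Z assume Z: "Z \<in> {Z. irreducible_closed zariski Z \<and> Z \<subseteq> (\<Union>P\<in>\<P>. cl P)}"
  then have "\<exists>A\<in>(\<lambda>P. cl P) ` \<P>. Z \<subseteq> A"
    using assms(1) by (intro irreducible_finite_union) auto
  then obtain P where "P \<in> \<P>" "Z \<subseteq> cl P" by auto
  with irreducible_chain[of Z P m c] assms Z
  show "enat c \<le> codim_irred zariski Z" unfolding codim_irred_def
    by (intro Sup_upper) auto
qed

lemma param_union_proper:
  assumes "finite \<P>" "\<And>P. P \<in> \<P> \<Longrightarrow> \<exists>m<card I. param m P"
  shows "(\<Union>P\<in>\<P>. cl P) \<noteq> X"
proof
  assume "(\<Union>P\<in>\<P>. cl P) = X"
  then have "\<exists>A\<in>(\<lambda>P. cl P) ` \<P>. X \<subseteq> A"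
    using assms(1) by (intro irreducible_finite_union irreducible_space) auto
  then obtain P where P: "P \<in> \<P>" "X \<subseteq> cl P" by auto
  moreover have "cl P \<subseteq> X" using closure_of_subset_topspace topspace_zariski by metis
  ultimately show False using param_not_dense assms(2) by (metis subset_antisym)
qed

text \<open>Renumbering: \<open>param\<close> wants the variables below \<open>m\<close>, whereas
  concrete parametrisations come with structured names for their variables.\<close>

lemma param_finite:
  assumes "finite J" "card J \<le> m" "\<And>i. i \<in> I \<Longrightarrow> \<psi> i \<in> polynomials (vars J)"
    and "P \<subseteq> range (\<lambda>v. mk (\<lambda>i. \<psi> i v))"
  shows "param m P"
proof -
  obtain h where h: "bij_betw h {0..<card J} J" using ex_bij_betw_nat_finite[OF assms(1)] by auto
  define g where "g = the_inv_into {0..<card J} h"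
  have g: "h (g j) = j" "g j < m" if "j \<in> J" for j
    using that h assms(2) f_the_inv_into_f_bij_betw[OF h] bij_betwE[OF bij_betw_the_inv_into[OF h]]
    by (auto simp: g_def)
  have "(\<lambda>v. \<psi> i (\<lambda>j. v (g j))) \<in> polynomials (vars {..<m})" if "i \<in> I" for i
    by (rule polynomials_compose[OF assms(3)[OF that]]) (use g in \<open>auto intro!: poly_var\<close>)
  moreover have "P \<subseteq> range (\<lambda>v. mk (\<lambda>i. \<psi> i (\<lambda>j. v (g j))))"
  proof
    fix x assume "x \<in> P"
    then obtain v where v: "x = mk (\<lambda>i. \<psi> i v)" using assms(4) by auto
    have "\<psi> i (\<lambda>j. v (h (g j))) = \<psi> i v" if "i \<in> I" for i
      by (rule polynomials_vars_cong[OF assms(3)[OF that]]) (use g in auto)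
    then have "x = mk (\<lambda>i. \<psi> i (\<lambda>j. v (h (g j))))"
      unfolding v by (intro coord_eqI) (auto simp: mk_in coord_mk)
    then show "x \<in> range (\<lambda>v. mk (\<lambda>i. \<psi> i (\<lambda>j. v (g j))))"
      by (intro image_eqI[of _ _ "\<lambda>j. v (h j)"]) auto
  qed
  ultimately show ?thesis unfolding param_def by (intro exI[of _ "\<lambda>i v. \<psi> i (\<lambda>j. v (g j))"]) auto
qed

text \<open>A parametrisation given implicitly. The coordinates in \<open>I0\<close> are solved for
  in terms of the other coordinates (\<open>Inl\<close>) and of auxiliary parameters
  (\<open>Inr\<close>), so that each solved equation saves one parameter and each auxiliary quantity
  costs one.\<close>

lemma param_solved:
  assumes "finite J" "I0 \<subseteq> I" "card I - card I0 + card J \<le> m"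
    and "\<And>i. i \<in> I0 \<Longrightarrow> g i \<in> polynomials (vars (Inl ` (I - I0) \<union> Inr ` J))"
    and "\<And>x. x \<in> P \<Longrightarrow> x \<in> X \<and> (\<exists>w. \<forall>i\<in>I0. coord i x = g i (case_sum (\<lambda>i. coord i x) w))"
  shows "param m P"
proof (rule param_finite)
  let ?J = "Inl ` (I - I0) \<union> Inr ` J"
  show "finite ?J" using assms finite_I by auto
  have "card ?J = card (I - I0) + card J"
    using assms finite_I by (subst card_Un_disjoint) (auto simp: card_image)
  then show "card ?J \<le> m" using assms finite_I by (simp add: card_Diff_subset finite_subset)
  let ?\<psi> = "\<lambda>i v. if i \<in> I0 then g i v else v (Inl i)"
  show "?\<psi> i \<in> polynomials (vars ?J)" if "i \<in> I" for i
    using that assms(4) by (cases "i \<in> I0") (auto intro!: poly_var)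
  show "P \<subseteq> range (\<lambda>v. mk (\<lambda>i. ?\<psi> i v))"
  proof
    fix x assume "x \<in> P"
    then obtain w where w: "x \<in> X" "\<forall>i\<in>I0. coord i x = g i (case_sum (\<lambda>i. coord i x) w)"
      using assms(5) by blast
    then have "x = mk (\<lambda>i. ?\<psi> i (case_sum (\<lambda>i. coord i x) w))"
      by (intro coord_eqI) (auto simp: mk_in coord_mk)
    then show "x \<in> range (\<lambda>v. mk (\<lambda>i. ?\<psi> i v))" by blast
  qed
qed

end

section \<open>The degeneracy loci\<close>

definition hom_index :: "nat \<Rightarrow> nat \<Rightarrow> nat \<Rightarrow> (nat \<times> nat \<times> nat) set" where
  "hom_index n t N = {..n} \<times> {..<N} \<times> {..<t}"

definition hom_coord :: "nat \<times> nat \<times> nat \<Rightarrow> (nat \<Rightarrow> complex mat) \<Rightarrow> complex" where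
  "hom_coord = (\<lambda>(l, i, j) M. M l $$ (i, j))"

definition hom_mk :: "nat \<Rightarrow> nat \<Rightarrow> nat \<Rightarrow> (nat \<times> nat \<times> nat \<Rightarrow> complex) \<Rightarrow> nat \<Rightarrow> complex mat" where
  "hom_mk n t N v = (\<lambda>l\<in>{..n}. mat N t (\<lambda>(i, j). v (l, i, j)))"

lemma coord_space_hom: "coord_space (hom_space n t N) (hom_index n t N) hom_coord (hom_mk n t N)"
proof
  fix M M' assume M: "M \<in> hom_space n t N" "M' \<in> hom_space n t N"
    and eq: "\<And>i. i \<in> hom_index n t N \<Longrightarrow> hom_coord i M = hom_coord i M'"
  show "M = M'"
  proof (rule PiE_ext[OF M[unfolded hom_space_def]])
    fix l assume l: "l \<in> {..n}"
    then have "M l \<in> carrier_mat N t" "M' l \<in> carrier_mat N t" using M by (auto simp: hom_space_def)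
    then show "M l = M' l"
      using eq[of "(l, _, _)"] l by (intro eq_matI) (auto simp: hom_index_def hom_coord_def)
  qed
qed (auto simp: hom_index_def hom_space_def hom_coord_def hom_mk_def)

lemma hom_zariski_eq:
  "hom_zariski n t N = coord_space.zariski (hom_space n t N) (hom_index n t N) hom_coord"
proof -
  have "hom_coords n t N = {hom_coord i |i. i \<in> hom_index n t N}"
    by (force simp: hom_coords_def hom_coord_def hom_index_def)
  then show ?thesis unfolding hom_zariski_def coord_space.zariski_def[OF coord_space_hom] by simp
qed

text \<open>With \<open>\<xi>\<close> normalised at \<open>k\<close> and a two-dimensional space of points in reduced echelon form
  with pivots \<open>i\<close> and \<open>j\<close>, the equations \<open>\<xi> M(x) = 0\<close> can be solved for the \<open>k\<close>-th rows of
  \<open>M\<^sub>i\<close> and \<open>M\<^sub>j\<close>.\<close>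

definition pencil_locus :: "nat \<Rightarrow> nat \<Rightarrow> nat \<Rightarrow> nat \<Rightarrow> nat \<Rightarrow> nat \<Rightarrow> (nat \<Rightarrow> complex mat) set" where
  "pencil_locus n t N i j k = {M \<in> hom_space n t N. \<exists>\<xi> a b :: nat \<Rightarrow> complex.
     \<xi> k = 1 \<and> a i = 1 \<and> a j = 0 \<and> b i = 0 \<and> b j = 1 \<and>
     (\<forall>u<t. (\<Sum>l\<le>n. a l * (\<Sum>s<N. \<xi> s * M l $$ (s, u))) = 0) \<and>
     (\<forall>u<t. (\<Sum>l\<le>n. b l * (\<Sum>s<N. \<xi> s * M l $$ (s, u))) = 0)}"

text \<open>Here \<open>a\<close> is a point of projective space normalised at \<open>i\<close>, and
  \<open>c\<close> a kernel vector of M(a) normalised at \<open>j\<close>. The \<open>N\<close>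
  equations can be solved for column \<open>j\<close> of \<open>M i\<close>.\<close>

definition kernel_locus :: "nat \<Rightarrow> nat \<Rightarrow> nat \<Rightarrow> nat \<Rightarrow> nat \<Rightarrow> (nat \<Rightarrow> complex mat) set" where
  "kernel_locus n t N i j = {M \<in> hom_space n t N. \<exists>a c :: nat \<Rightarrow> complex. a i = 1 \<and> c j = 1 \<and>
     (\<forall>s<N. (\<Sum>l\<le>n. a l * (\<Sum>u<t. M l $$ (s, u) * c u)) = 0)}"

lemma card_hom_index: "card (hom_index n t N) = Suc n * (N * t)"
  by (simp add: hom_index_def card_cartesian_product)

text \<open>The echelon form decouples the equations: as \<open>a j = 0\<close> and
  \<open>b i = 0\<close>, those for \<open>a\<close> contain only row \<open>k\<close> of
  \<open>M i\<close> among the solved entries, those for \<open>b\<close> only row \<open>k\<close>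
  of \<open>M j\<close>, in both cases with coefficient 1. So \<open>g\<close> is polynomial,
  without denominators.\<close>

lemma param_pencil_locus:
  assumes "i \<le> n" "j \<le> n" "i \<noteq> j" "k < N"
  shows "coord_space.param (hom_index n t N) (hom_mk n t N)
    (card (hom_index n t N) - 2 * t + (N - 1 + 2 * (n - 1))) (pencil_locus n t N i j k)"
proof -
  interpret coord_space "hom_space n t N" "hom_index n t N" hom_coord "hom_mk n t N"
    by (rule coord_space_hom)
  \<comment> \<open>Tag 0 stands for the entries of \<open>\<xi>\<close> other than the normalised
    one, tags 1 and 2 for the entries of \<open>a\<close> and \<open>b\<close> away from the
    pivots.\<close>
  define J :: "(nat \<times> nat) set" where "J = {0} \<times> ({..<N} - {k}) \<union> {1, 2} \<times> ({..n} - {i, j})"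
  define I0 where "I0 = {i, j} \<times> {k} \<times> {..<t}"
  define g :: "nat \<times> nat \<times> nat \<Rightarrow> ((nat \<times> nat \<times> nat) + (nat \<times> nat) \<Rightarrow> complex) \<Rightarrow> complex" where
    "g = (\<lambda>(l, k', u) v. - (\<Sum>s\<in>{..<N} - {k}. v (Inr (0, s)) * v (Inl (l, s, u))) +
        - (\<Sum>l'\<in>{..n} - {i, j}. v (Inr (if l = i then 1 else 2, l')) *
            ((\<Sum>s\<in>{..<N} - {k}. v (Inr (0, s)) * v (Inl (l', s, u))) + v (Inl (l', k, u)))))"
  show ?thesis
  proof (rule param_solved)
    show "finite J" by (simp add: J_def)
    show "I0 \<subseteq> hom_index n t N" using assms by (auto simp: I0_def hom_index_def)
    have "card ({..n} - {i, j}) = n - 1" using assms by (subst card_Diff_subset) auto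
    moreover have "card J = card ({0::nat} \<times> ({..<N} - {k})) + card ({1::nat, 2} \<times> ({..n} - {i, j}))"
      unfolding J_def by (intro card_Un_disjoint) auto
    ultimately have "card J = N - 1 + 2 * (n - 1)" using assms by (simp add: card_cartesian_product)
    moreover have "card I0 = 2 * t" using assms by (simp add: I0_def card_cartesian_product)
    ultimately show "card (hom_index n t N) - card I0 + card J
        \<le> card (hom_index n t N) - 2 * t + (N - 1 + 2 * (n - 1))" by simp
    show "g q \<in> polynomials (vars (Inl ` (hom_index n t N - I0) \<union> Inr ` J))" if "q \<in> I0" for q
    proof -
      obtain l u where q: "q = (l, k, u)" "l \<in> {i, j}" "u < t" using \<open>q \<in> I0\<close> by (auto simp: I0_def)
      have 1: "(\<lambda>v. v (Inl (l', s, u))) \<in> polynomials (vars (Inl ` (hom_index n t N - I0) \<union> Inr ` J))"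
        if "l' \<le> n" "s < N" "l' \<notin> {i, j} \<or> s \<noteq> k" for l' s
        using that q by (intro poly_var CollectI exI[of _ "Inl (l', s, u)"]) (auto simp: I0_def hom_index_def)
      have 2: "(\<lambda>v. v (Inr (0, s))) \<in> polynomials (vars (Inl ` (hom_index n t N - I0) \<union> Inr ` J))"
        if "s < N" "s \<noteq> k" for s
        using that by (intro poly_var CollectI exI[of _ "Inr (0, s)"]) (auto simp: J_def)
      have 3: "(\<lambda>v. v (Inr (if l = i then 1 else 2, l'))) \<in>
          polynomials (vars (Inl ` (hom_index n t N - I0) \<union> Inr ` J))"
        if "l' \<le> n" "l' \<notin> {i, j}" for l'
        using that by (intro poly_var CollectI exI[of _ "Inr (if l = i then 1 else 2, l')"]) (auto simp: J_def)
      show ?thesis unfolding q(1) g_def prod.case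
        by (intro polynomials.poly_add polynomials_uminus polynomials_sum polynomials.poly_mult 1 2 3)
          (use q assms in auto)
    qed
    fix M assume M: "M \<in> pencil_locus n t N i j k"
    then obtain \<xi> a b where *: "\<xi> k = 1" "a i = 1" "a j = 0" "b i = 0" "b j = 1"
      "\<And>u. u < t \<Longrightarrow> (\<Sum>l\<le>n. a l * (\<Sum>s<N. \<xi> s * M l $$ (s, u))) = 0"
      "\<And>u. u < t \<Longrightarrow> (\<Sum>l\<le>n. b l * (\<Sum>s<N. \<xi> s * M l $$ (s, u))) = 0"
      by (auto simp: pencil_locus_def)
    define w :: "nat \<times> nat \<Rightarrow> complex" where
      "w = (\<lambda>(z, l). if z = 0 then \<xi> l else if z = 1 then a l else b l)"
    define R where "R l u = (\<Sum>s\<in>{..<N} - {k}. \<xi> s * M l $$ (s, u))" for l u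
    have R: "(\<Sum>s<N. \<xi> s * M l $$ (s, u)) = R l u + M l $$ (k, u)" for l u
      unfolding R_def using * assms by (subst sum.remove[of _ k]) (auto simp: add.commute)
    have split: "(\<Sum>l\<le>n. f l) = f i + f j + (\<Sum>l\<in>{..n} - {i, j}. f l)" for f :: "nat \<Rightarrow> complex"
    proof -
      have "{..n} = insert i (insert j ({..n} - {i, j}))" using assms by auto
      then have "(\<Sum>l\<le>n. f l) = (\<Sum>l\<in>insert i (insert j ({..n} - {i, j})). f l)" by simp
      then show ?thesis using assms by (simp add: add.assoc)
    qed
    have "hom_coord q M = g q (case_sum (\<lambda>i. hom_coord i M) w)" if "q \<in> I0" for q
    proof -
      obtain l u where q: "q = (l, k, u)" "l \<in> {i, j}" "u < t" using \<open>q \<in> I0\<close> by (auto simp: I0_def)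
      have gq: "g q (case_sum (\<lambda>i. hom_coord i M) w) = - R l u +
         - (\<Sum>l'\<in>{..n} - {i, j}. (if l = i then a l' else b l') * (R l' u + M l' $$ (k, u)))"
        unfolding q(1) g_def R_def by (simp add: w_def hom_coord_def)
      show ?thesis
      proof (cases "l = i")
        case True
        have "R i u + M i $$ (k, u) + (\<Sum>l\<in>{..n} - {i, j}. a l * (R l u + M l $$ (k, u))) = 0"
          using *(6)[OF q(3)] unfolding R split using * by simp
        then show ?thesis unfolding gq using True
          by (simp add: q(1) hom_coord_def algebra_simps eq_neg_iff_add_eq_0)
      next
        case False
        have "R j u + M j $$ (k, u) + (\<Sum>l\<in>{..n} - {i, j}. b l * (R l u + M l $$ (k, u))) = 0"
          using *(7)[OF q(3)] unfolding R split using * by simp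
        then show ?thesis unfolding gq using False q(2)
          by (simp add: q(1) hom_coord_def algebra_simps eq_neg_iff_add_eq_0)
      qed
    qed
    then show "M \<in> hom_space n t N \<and> (\<exists>w. \<forall>q\<in>I0. hom_coord q M = g q (case_sum (\<lambda>i. hom_coord i M) w))"
      using M by (auto simp: pencil_locus_def)
  qed
qed

text \<open>The same elimination, now for column \<open>j\<close> of \<open>M i\<close>:
  \<open>N\<close> equations against \<open>n\<close> parameters for the point and
  \<open>t - 1\<close> for the kernel vector, each normalised at one entry.\<close>

lemma param_kernel_locus:
  assumes "i \<le> n" "j < t"
  shows "coord_space.param (hom_index n t N) (hom_mk n t N)
    (card (hom_index n t N) - N + (n + (t - 1))) (kernel_locus n t N i j)"
proof -
  interpret coord_space "hom_space n t N" "hom_index n t N" hom_coord "hom_mk n t N"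
    by (rule coord_space_hom)
  define J :: "(nat \<times> nat) set" where "J = {0} \<times> ({..n} - {i}) \<union> {1} \<times> ({..<t} - {j})"
  define I0 where "I0 = {i} \<times> {..<N} \<times> {j}"
  define g :: "nat \<times> nat \<times> nat \<Rightarrow> ((nat \<times> nat \<times> nat) + (nat \<times> nat) \<Rightarrow> complex) \<Rightarrow> complex" where
    "g = (\<lambda>(l, s, u) v. - (\<Sum>u\<in>{..<t} - {j}. v (Inl (i, s, u)) * v (Inr (1, u))) +
        - (\<Sum>l\<in>{..n} - {i}. v (Inr (0, l)) *
            ((\<Sum>u\<in>{..<t} - {j}. v (Inl (l, s, u)) * v (Inr (1, u))) + v (Inl (l, s, j)))))"
  show ?thesis
  proof (rule param_solved)
    show "finite J" by (simp add: J_def)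
    show "I0 \<subseteq> hom_index n t N" using assms by (auto simp: I0_def hom_index_def)
    have "card J = card ({0::nat} \<times> ({..n} - {i})) + card ({1::nat} \<times> ({..<t} - {j}))"
      unfolding J_def by (intro card_Un_disjoint) auto
    then have "card J = n + (t - 1)" using assms by (simp add: card_cartesian_product)
    moreover have "card I0 = N" using assms by (simp add: I0_def card_cartesian_product)
    ultimately show "card (hom_index n t N) - card I0 + card J
        \<le> card (hom_index n t N) - N + (n + (t - 1))" by simp
    show "g q \<in> polynomials (vars (Inl ` (hom_index n t N - I0) \<union> Inr ` J))" if "q \<in> I0" for q
    proof -
      obtain s where q: "q = (i, s, j)" "s < N" using \<open>q \<in> I0\<close> by (auto simp: I0_def)
      have 1: "(\<lambda>v. v (Inl (l', s, u))) \<in> polynomials (vars (Inl ` (hom_index n t N - I0) \<union> Inr ` J))"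
        if "l' \<le> n" "u < t" "l' \<noteq> i \<or> u \<noteq> j" for l' u
        using that q by (intro poly_var CollectI exI[of _ "Inl (l', s, u)"]) (auto simp: I0_def hom_index_def)
      have 2: "(\<lambda>v. v (Inr (0, l))) \<in> polynomials (vars (Inl ` (hom_index n t N - I0) \<union> Inr ` J))"
        if "l \<le> n" "l \<noteq> i" for l
        using that by (intro poly_var CollectI exI[of _ "Inr (0, l)"]) (auto simp: J_def)
      have 3: "(\<lambda>v. v (Inr (1, u))) \<in> polynomials (vars (Inl ` (hom_index n t N - I0) \<union> Inr ` J))"
        if "u < t" "u \<noteq> j" for u
        using that by (intro poly_var CollectI exI[of _ "Inr (1, u)"]) (auto simp: J_def)
      show ?thesis unfolding q(1) g_def prod.case
        by (intro polynomials.poly_add polynomials_uminus polynomials_sum polynomials.poly_mult 1 2 3)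
          (use q assms in auto)
    qed
    fix M assume M: "M \<in> kernel_locus n t N i j"
    then obtain a c where *: "a i = 1" "c j = 1"
      "\<And>s. s < N \<Longrightarrow> (\<Sum>l\<le>n. a l * (\<Sum>u<t. M l $$ (s, u) * c u)) = 0"
      by (auto simp: kernel_locus_def)
    define w :: "nat \<times> nat \<Rightarrow> complex" where
      "w = (\<lambda>(z, l). if z = 0 then a l else c l)"
    define R where "R l s = (\<Sum>u\<in>{..<t} - {j}. M l $$ (s, u) * c u)" for l s
    have R: "(\<Sum>u<t. M l $$ (s, u) * c u) = R l s + M l $$ (s, j)" for l s
      unfolding R_def using * assms by (subst sum.remove[of _ j]) (auto simp: add.commute)
    have "hom_coord q M = g q (case_sum (\<lambda>i. hom_coord i M) w)" if "q \<in> I0" for q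
    proof -
      obtain s where q: "q = (i, s, j)" "s < N" using \<open>q \<in> I0\<close> by (auto simp: I0_def)
      have gq: "g q (case_sum (\<lambda>i. hom_coord i M) w) = - R i s +
         - (\<Sum>l\<in>{..n} - {i}. a l * (R l s + M l $$ (s, j)))"
        unfolding q(1) g_def R_def by (simp add: w_def hom_coord_def)
      have "R i s + M i $$ (s, j) + (\<Sum>l\<in>{..n} - {i}. a l * (R l s + M l $$ (s, j))) = 0"
        using *(3)[OF q(2)] unfolding R using * assms by (subst (asm) sum.remove[of _ i]) auto
      then show ?thesis unfolding gq
        by (simp add: q(1) hom_coord_def algebra_simps eq_neg_iff_add_eq_0)
    qed
    then show "M \<in> hom_space n t N \<and> (\<exists>w. \<forall>q\<in>I0. hom_coord q M = g q (case_sum (\<lambda>i. hom_coord i M) w))"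
      using M by (auto simp: kernel_locus_def)
  qed
qed

section \<open>Bad matrices lie in the loci\<close>

text \<open>The condition xi M(x) = 0. It is linear in \<open>\<eta>\<close> and in
  \<open>x\<close>, and is read below as a linear system in either of them: see
  \<open>kills_iff_pencil\<close> and \<open>kills_iff_hom_at\<close>.\<close>

definition kills :: "nat \<Rightarrow> nat \<Rightarrow> nat \<Rightarrow> (nat \<Rightarrow> complex mat) \<Rightarrow> complex vec \<Rightarrow> complex vec \<Rightarrow> bool" where
  "kills n t N M \<eta> x \<longleftrightarrow> (\<forall>u<t. (\<Sum>l\<le>n. x $ l * (\<Sum>s<N. \<eta> $ s * M l $$ (s, u))) = 0)"

text \<open>Injectivity of the projection from the projective bundle to the space of functionals,
  expressed by \<open>M\<close> alone, so that it makes sense before any bundle is given.\<close>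

definition separating :: "nat \<Rightarrow> nat \<Rightarrow> nat \<Rightarrow> (nat \<Rightarrow> complex mat) \<Rightarrow> bool" where
  "separating n t N M \<longleftrightarrow> (\<forall>\<eta>\<in>nonzero_vecs N. \<forall>x\<in>nonzero_vecs (Suc n). \<forall>y\<in>nonzero_vecs (Suc n).
     kills n t N M \<eta> x \<longrightarrow> kills n t N M \<eta> y \<longrightarrow> ray x = ray y)"

lemma nonzero_vecs_coord: "x \<in> nonzero_vecs k \<Longrightarrow> \<exists>i<k. x $ i \<noteq> 0"
  unfolding nonzero_vecs_def by (auto intro: eq_vecI)

lemma ray_smult: "c \<noteq> 0 \<Longrightarrow> ray (c \<cdot>\<^sub>v x) = ray x"
proof -
  assume c: "c \<noteq> 0"
  have "d \<cdot>\<^sub>v x = (d / c) \<cdot>\<^sub>v (c \<cdot>\<^sub>v x)" for d using c by (simp add: smult_smult_assoc)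
  then show ?thesis using c unfolding ray_def by (fastforce simp: smult_smult_assoc)
qed

text \<open>Row reduction of the basis \<open>x\<close>, \<open>y\<close> of a plane:
  \<open>i\<close> is a pivot of \<open>x\<close>, then \<open>j\<close> a pivot of what remains of
  \<open>y\<close>. The conditions survive because they are linear in the point.\<close>

lemma pencil_locus_if_kills:
  assumes M: "M \<in> hom_space n t N" and \<eta>: "\<eta> \<in> nonzero_vecs N"
    and x: "x \<in> nonzero_vecs (Suc n)" and y: "y \<in> nonzero_vecs (Suc n)" and ne: "ray x \<noteq> ray y"
    and kx: "kills n t N M \<eta> x" and ky: "kills n t N M \<eta> y"
  shows "\<exists>i\<le>n. \<exists>j\<le>n. \<exists>k<N. i \<noteq> j \<and> M \<in> pencil_locus n t N i j k"
proof -
  obtain k where k: "k < N" "\<eta> $ k \<noteq> 0" using nonzero_vecs_coord[OF \<eta>] by auto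
  obtain i where i: "i \<le> n" "x $ i \<noteq> 0" using nonzero_vecs_coord[OF x] by (auto simp: less_Suc_eq_le)
  \<comment> \<open>Clears the entry \<open>i\<close> of \<open>y\<close>; the result is nonzero
    because the rays differ.\<close>
  define y' where "y' l = y $ l - y $ i / x $ i * x $ l" for l
  have "\<exists>j\<le>n. y' j \<noteq> 0"
  proof (rule ccontr)
    assume "\<not> ?thesis"
    then have "y = (y $ i / x $ i) \<cdot>\<^sub>v x" using x y
      by (intro eq_vecI) (auto simp: nonzero_vecs_def y'_def less_Suc_eq_le)
    moreover have "y $ i \<noteq> 0"
    proof
      assume "y $ i = 0"
      then have "y = 0 \<cdot>\<^sub>v x" using \<open>y = _\<close> by simp
      then show False using x y by (auto simp: nonzero_vecs_def)
    qed
    ultimately have "ray y = ray x" using i by (metis ray_smult divide_eq_0_iff)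
    then show False using ne by simp
  qed
  then obtain j where j: "j \<le> n" "y' j \<noteq> 0" by auto
  have "i \<noteq> j" using j i by (auto simp: y'_def)
  define b where "b l = y' l / y' j" for l
  \<comment> \<open>Clears the entry \<open>j\<close> of the scaled \<open>x\<close>; the entry
    \<open>i\<close> stays 1 because \<open>b i = 0\<close>.\<close>
  define a where "a l = x $ l / x $ i - x $ j / x $ i * b l" for l
  define \<xi> where "\<xi> s = \<eta> $ s / \<eta> $ k" for s
  define F where "F l u = (\<Sum>s<N. \<eta> $ s * M l $$ (s, u))" for l u
  have F: "(\<Sum>s<N. \<xi> s * M l $$ (s, u)) = F l u / \<eta> $ k" for l u
    by (simp add: \<xi>_def F_def sum_divide_distrib)
  have x0: "(\<Sum>l\<le>n. x $ l * F l u) = 0" and y0: "(\<Sum>l\<le>n. y $ l * F l u) = 0" if "u < t" for u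
    using kx ky that by (auto simp: kills_def F_def)
  have b0: "(\<Sum>l\<le>n. b l * F l u) = 0" if "u < t" for u
  proof -
    have "(\<Sum>l\<le>n. b l * F l u)
        = ((\<Sum>l\<le>n. y $ l * F l u) - y $ i / x $ i * (\<Sum>l\<le>n. x $ l * F l u)) / y' j"
      unfolding b_def y'_def sum_distrib_left sum_subtractf[symmetric] sum_divide_distrib
      by (intro sum.cong refl) (simp add: left_diff_distrib)
    then show ?thesis using x0 y0 that by simp
  qed
  have a0: "(\<Sum>l\<le>n. a l * F l u) = 0" if "u < t" for u
  proof -
    have "(\<Sum>l\<le>n. a l * F l u)
        = (\<Sum>l\<le>n. x $ l * F l u) / x $ i - x $ j / x $ i * (\<Sum>l\<le>n. b l * F l u)"
      unfolding a_def sum_distrib_left sum_divide_distrib sum_subtractf[symmetric]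
      by (intro sum.cong refl) (simp add: left_diff_distrib)
    then show ?thesis using x0 b0 that by simp
  qed
  have "M \<in> pencil_locus n t N i j k" unfolding pencil_locus_def
  proof (rule CollectI, rule conjI[OF M], rule exI[of _ \<xi>], rule exI[of _ a], rule exI[of _ b],
      intro conjI)
    show "\<xi> k = 1" using k by (simp add: \<xi>_def)
    show bi: "b i = 0" using i by (simp add: b_def y'_def)
    show bj: "b j = 1" using j by (simp add: b_def)
    show "a i = 1" using i bi by (simp add: a_def)
    show "a j = 0" using bj by (simp add: a_def)
    show "\<forall>u<t. (\<Sum>l\<le>n. a l * (\<Sum>s<N. \<xi> s * M l $$ (s, u))) = 0"
      using a0 unfolding F by (simp add: sum_divide_distrib[symmetric])
    show "\<forall>u<t. (\<Sum>l\<le>n. b l * (\<Sum>s<N. \<xi> s * M l $$ (s, u))) = 0"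
      using b0 unfolding F by (simp add: sum_divide_distrib[symmetric])
  qed
  then show ?thesis using i j k \<open>i \<noteq> j\<close> by blast
qed

lemma hom_at_carrier: "hom_at n t N M x \<in> carrier_mat N t"
  by (simp add: hom_at_def)

text \<open>The difference of two vectors with equal image is a kernel vector, to be scaled to 1 at
  an entry \<open>j\<close> where the two differ.\<close>

lemma kernel_locus_if_not_inj:
  assumes M: "M \<in> hom_space n t N" and x: "x \<in> nonzero_vecs (Suc n)"
    and ni: "\<not> inj_on (\<lambda>c. hom_at n t N M x *\<^sub>v c) (carrier_vec t)"
  shows "\<exists>i\<le>n. \<exists>j<t. M \<in> kernel_locus n t N i j"
proof -
  obtain i where i: "i \<le> n" "x $ i \<noteq> 0" using nonzero_vecs_coord[OF x] by (auto simp: less_Suc_eq_le)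
  obtain c d where cd: "c \<in> carrier_vec t" "d \<in> carrier_vec t" "c \<noteq> d"
    "hom_at n t N M x *\<^sub>v c = hom_at n t N M x *\<^sub>v d" using ni by (auto simp: inj_on_def)
  obtain j where j: "j < t" "c $ j \<noteq> d $ j" using cd by (metis carrier_vecD eq_vecI)
  have ev: "(hom_at n t N M x *\<^sub>v c) $ s = (\<Sum>l\<le>n. x $ l * (\<Sum>u<t. M l $$ (s, u) * c $ u))"
    if "s < N" "c \<in> carrier_vec t" for s c
  proof -
    have "(hom_at n t N M x *\<^sub>v c) $ s = (\<Sum>u<t. (\<Sum>l\<le>n. x $ l * M l $$ (s, u)) * c $ u)"
      using that by (simp add: hom_at_def scalar_prod_def lessThan_atLeast0)
    also have "\<dots> = (\<Sum>l\<le>n. \<Sum>u<t. x $ l * M l $$ (s, u) * c $ u)"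
      unfolding sum_distrib_right by (rule sum.swap)
    finally show ?thesis by (simp add: sum_distrib_left mult.assoc)
  qed
  define e where "e u = (c $ u - d $ u) / (c $ j - d $ j)" for u
  define a where "a l = x $ l / x $ i" for l
  have alg: "p / X * (m * ((c - d) / D)) = (p * (m * c) - p * (m * d)) / (X * D)"
    for p X m c d D :: complex
    by (simp add: right_diff_distrib diff_divide_distrib)
  have "(\<Sum>l\<le>n. a l * (\<Sum>u<t. M l $$ (s, u) * e u)) = 0" if "s < N" for s
  proof -
    have "(\<Sum>l\<le>n. a l * (\<Sum>u<t. M l $$ (s, u) * e u)) =
      ((\<Sum>l\<le>n. x $ l * (\<Sum>u<t. M l $$ (s, u) * c $ u)) - (\<Sum>l\<le>n. x $ l * (\<Sum>u<t. M l $$ (s, u) * d $ u)))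
        / (x $ i * (c $ j - d $ j))"
      unfolding sum_distrib_left sum_subtractf[symmetric] sum_divide_distrib a_def e_def
      by (intro sum.cong refl alg)
    also have "\<dots> = 0" using cd ev[OF that cd(1)] ev[OF that cd(2)] by simp
    finally show ?thesis .
  qed
  then have "M \<in> kernel_locus n t N i j" using M i j
    unfolding kernel_locus_def by (intro CollectI conjI exI[of _ a] exI[of _ e]) (auto simp: a_def e_def)
  then show ?thesis using i j by blast
qed

definition pencil_loci :: "nat \<Rightarrow> nat \<Rightarrow> nat \<Rightarrow> (nat \<Rightarrow> complex mat) set set" where
  "pencil_loci n t N = (\<lambda>(i, j, k). pencil_locus n t N i j k) `
     {(i, j, k). i \<le> n \<and> j \<le> n \<and> i \<noteq> j \<and> k < N}"

definition kernel_loci :: "nat \<Rightarrow> nat \<Rightarrow> nat \<Rightarrow> (nat \<Rightarrow> complex mat) set set" where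
  "kernel_loci n t N = (\<lambda>(i, j). kernel_locus n t N i j) ` ({..n} \<times> {..<t})"

lemma finite_pencil_loci: "finite (pencil_loci n t N)"
  unfolding pencil_loci_def
  by (rule finite_imageI, rule finite_subset[of _ "{..n} \<times> {..n} \<times> {..<N}"]) auto

lemma finite_kernel_loci: "finite (kernel_loci n t N)"
  by (simp add: kernel_loci_def)

lemma pencil_loci_if_not_separating:
  assumes "M \<in> hom_space n t N" "\<not> separating n t N M"
  shows "M \<in> \<Union>(pencil_loci n t N)"
proof -
  obtain \<eta> x y where "\<eta> \<in> nonzero_vecs N" "x \<in> nonzero_vecs (Suc n)" "y \<in> nonzero_vecs (Suc n)"
    "ray x \<noteq> ray y" "kills n t N M \<eta> x" "kills n t N M \<eta> y"
    using assms(2) unfolding separating_def by blast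
  from pencil_locus_if_kills[OF assms(1) this] obtain i j k where
    "i \<le> n" "j \<le> n" "k < N" "i \<noteq> j" "M \<in> pencil_locus n t N i j k" by blast
  then show ?thesis unfolding pencil_loci_def
    by (intro UnionI[of "pencil_locus n t N i j k"] image_eqI[of _ _ "(i, j, k)"]) auto
qed

lemma kernel_loci_if_not_inj:
  assumes "M \<in> hom_space n t N" "x \<in> nonzero_vecs (Suc n)"
    "\<not> inj_on (\<lambda>c. hom_at n t N M x *\<^sub>v c) (carrier_vec t)"
  shows "M \<in> \<Union>(kernel_loci n t N)"
proof -
  obtain i j where "i \<le> n" "j < t" "M \<in> kernel_locus n t N i j"
    using kernel_locus_if_not_inj[OF assms] by blast
  then show ?thesis unfolding kernel_loci_def
    by (intro UnionI[of "kernel_locus n t N i j"] image_eqI[of _ _ "(i, j)"]) auto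
qed

section \<open>The closed set of bad matrices and its codimension\<close>

context
  fixes n t r N :: nat
  assumes n: "n \<ge> 1" and t: "t > 0" and N: "N = r + t"
begin

interpretation coord_space "hom_space n t N" "hom_index n t N" hom_coord "hom_mk n t N"
  by (rule coord_space_hom)

text \<open>The parameter counts are natural numbers, so the subtraction of \<open>2 * t\<close>
  must be shown not to be truncated; \<open>N_le\<close> does this for the other family.\<close>

lemma two_t_le: "2 * t \<le> card (hom_index n t N)"
proof -
  have "2 * 1 \<le> Suc n * N" using n t N by (intro mult_mono) auto
  then have "2 * 1 * t \<le> Suc n * N * t" by (rule mult_right_mono) simp
  then show ?thesis unfolding card_hom_index mult.assoc by linarith
qed

lemma N_le: "N \<le> card (hom_index n t N)"
proof -
  have "1 * 1 \<le> Suc n * t" using t by (intro mult_mono) auto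
  then have "1 * 1 * N \<le> Suc n * t * N" by (rule mult_right_mono) simp
  then show ?thesis by (simp add: card_hom_index algebra_simps)
qed

lemma param_pencil_loci:
  "P \<in> pencil_loci n t N \<Longrightarrow> param (card (hom_index n t N) - 2 * t + (N - 1 + 2 * (n - 1))) P"
  by (auto simp only: pencil_loci_def intro: param_pencil_locus)

lemma param_kernel_loci:
  "P \<in> kernel_loci n t N \<Longrightarrow> param (card (hom_index n t N) - N + (n + (t - 1))) P"
  unfolding kernel_loci_def by (elim imageE) (auto simp only: mem_Times_iff atMost_iff lessThan_iff case_prod_unfold intro: param_kernel_locus)

lemma subset_closures:
  assumes "\<And>P. P \<in> \<P> \<Longrightarrow> \<exists>m. param m P"
  shows "\<Union>\<P> \<subseteq> (\<Union>P\<in>\<P>. cl P)"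
proof
  fix x assume "x \<in> \<Union>\<P>"
  then obtain P where P: "P \<in> \<P>" "x \<in> P" by blast
  then have "P \<subseteq> topspace zariski" using assms param_subset unfolding topspace_zariski by metis
  then have "P \<subseteq> cl P" by (rule closure_of_subset)
  then show "x \<in> (\<Union>P\<in>\<P>. cl P)" using P by blast
qed

lemma hom_codim:
  "\<exists>S. closedin (hom_zariski n t N) S \<and>
    codim (hom_zariski n t N) S \<ge> enat (nat (int t - int r - 2 * int n + 3)) \<and>
    (\<forall>M\<in>hom_space n t N - S. separating n t N M)"
proof -
  define S where "S = (\<Union>P\<in>pencil_loci n t N. cl P)"
  have "closedin zariski S" unfolding S_def using finite_pencil_loci by (intro closedin_Union) auto
  moreover have "codim zariski S \<ge> enat (nat (int t - int r - 2 * int n + 3))" (is "_ \<ge> enat ?c")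
  proof (cases "?c = 0")
    \<comment> \<open>For a positive bound nothing is truncated, and the inequality is an equality
      by \<open>N = r + t\<close>.\<close>
    case False
    then have le: "card (hom_index n t N) - 2 * t + (N - 1 + 2 * (n - 1)) + ?c \<le> card (hom_index n t N)"
      using two_t_le n t N by linarith
    show ?thesis unfolding S_def by (rule codim_param[OF finite_pencil_loci param_pencil_loci le])
  qed (simp add: zero_enat_def[symmetric])
  moreover have "\<Union>(pencil_loci n t N) \<subseteq> S" unfolding S_def using param_pencil_loci by (intro subset_closures) blast
  then have "separating n t N M" if "M \<in> hom_space n t N - S" for M
    using that pencil_loci_if_not_separating by blast
  ultimately show ?thesis unfolding hom_zariski_eq by blast
qed

lemma hom_generic:
  assumes "r \<ge> n" "int t - int r > 2 * int n - 3"
  shows "\<exists>U. openin (hom_zariski n t N) U \<and> U \<noteq> {} \<and>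
    (\<forall>M\<in>U. M \<in> hom_space n t N \<and> separating n t N M \<and>
      (\<forall>x\<in>nonzero_vecs (Suc n). inj_on (\<lambda>c. hom_at n t N M x *\<^sub>v c) (carrier_vec t)))"
proof -
  let ?\<P> = "pencil_loci n t N \<union> kernel_loci n t N"
  define S where "S = (\<Union>P\<in>?\<P>. cl P)"
  have fin: "finite ?\<P>" using finite_pencil_loci finite_kernel_loci by blast
  have "closedin zariski S" unfolding S_def using fin by (intro closedin_Union) auto
  then have op: "openin zariski (hom_space n t N - S)" "S \<subseteq> hom_space n t N"
    using closedin_subset[of zariski S] by (simp_all add: closedin_def topspace_zariski)
  have small: "\<exists>m<card (hom_index n t N). param m P" if "P \<in> ?\<P>" for P
  proof -
    \<comment> \<open>The deficits are t - r - 2n + 3 and r - n + 1, both positive by the two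
      assumptions.\<close>
    have "card (hom_index n t N) - 2 * t + (N - 1 + 2 * (n - 1)) < card (hom_index n t N)"
      "card (hom_index n t N) - N + (n + (t - 1)) < card (hom_index n t N)"
      using two_t_le N_le n t N assms by linarith+
    then show ?thesis using that param_pencil_loci param_kernel_loci by blast
  qed
  then have "S \<noteq> hom_space n t N" unfolding S_def by (intro param_union_proper[OF fin])
  then have "hom_space n t N - S \<noteq> {}" using op(2) by blast
  moreover have "\<Union>?\<P> \<subseteq> S" unfolding S_def using small by (intro subset_closures) blast
  then have "separating n t N M \<and>
      (\<forall>x\<in>nonzero_vecs (Suc n). inj_on (\<lambda>c. hom_at n t N M x *\<^sub>v c) (carrier_vec t))"
    if "M \<in> hom_space n t N - S" for M
    using that pencil_loci_if_not_separating kernel_loci_if_not_inj by blast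
  ultimately show ?thesis unfolding hom_zariski_eq using op(1) by blast
qed

end

section \<open>Linear algebra\<close>

lemma mult_mat_vec_index: "i < a \<Longrightarrow> A \<in> carrier_mat a b \<Longrightarrow> x \<in> carrier_vec b \<Longrightarrow>
    (A *\<^sub>v x) $ i = (\<Sum>j<b. A $$ (i, j) * x $ j)"
  by (simp add: scalar_prod_def lessThan_atLeast0)

lemma det_nonzero_left_inverse:
  fixes A :: "'a::field mat"
  assumes A: "A \<in> carrier_mat m m" and d: "det A \<noteq> 0"
  shows "\<exists>B\<in>carrier_mat m m. B * A = 1\<^sub>m m \<and> A * B = 1\<^sub>m m"
proof (intro bexI[of _ "(1 / det A) \<cdot>\<^sub>m adj_mat A"] conjI)
  show "(1 / det A) \<cdot>\<^sub>m adj_mat A \<in> carrier_mat m m" using adj_mat(1)[OF A] by simp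
  have one: "(1 / det A) \<cdot>\<^sub>m (det A \<cdot>\<^sub>m 1\<^sub>m m) = 1\<^sub>m m"
    using d by (intro eq_matI) auto
  have "(1 / det A) \<cdot>\<^sub>m adj_mat A * A = (1 / det A) \<cdot>\<^sub>m (adj_mat A * A)"
    using adj_mat(1)[OF A] A by (metis mult_smult_assoc_mat)
  then show "(1 / det A) \<cdot>\<^sub>m adj_mat A * A = 1\<^sub>m m" using adj_mat(3)[OF A] one by simp
  have "A * ((1 / det A) \<cdot>\<^sub>m adj_mat A) = (1 / det A) \<cdot>\<^sub>m (A * adj_mat A)"
    using adj_mat(1)[OF A] A by (metis mult_smult_distrib)
  then show "A * ((1 / det A) \<cdot>\<^sub>m adj_mat A) = 1\<^sub>m m" using adj_mat(2)[OF A] one by simp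
qed

text \<open>With \<open>H\<close> the conjugate transpose, \<open>H * A *\<^sub>v v = 0\<close>
  forces the squared norm of \<open>A *\<^sub>v v\<close> to vanish, so \<open>H * A\<close> is
  invertible. A left inverse \<open>B\<close> found at one parameter value turns injectivity nearby
  into the nonvanishing of one determinant, that of \<open>B\<close> times the matrix.\<close>

lemma injective_left_inverse:
  fixes A :: "complex mat"
  assumes A: "A \<in> carrier_mat a b"
    and inj: "\<And>x. x \<in> carrier_vec b \<Longrightarrow> A *\<^sub>v x = 0\<^sub>v a \<Longrightarrow> x = 0\<^sub>v b"
  shows "\<exists>B\<in>carrier_mat b a. B * A = 1\<^sub>m b"
proof -
  define H where "H = mat b a (\<lambda>(j, s). cnj (A $$ (s, j)))"
  have H: "H \<in> carrier_mat b a" by (simp add: H_def)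
  have G: "H * A \<in> carrier_mat b b" using H A by simp
  have "det (H * A) \<noteq> 0"
  proof
    assume "det (H * A) = 0"
    then obtain v where v: "v \<in> carrier_vec b" "v \<noteq> 0\<^sub>v b" "H * A *\<^sub>v v = 0\<^sub>v b"
      using det_0_iff_vec_prod_zero[OF G] by auto
    have H_entry: "H $$ (j, s) = cnj (A $$ (s, j))" if "j < b" "s < a" for j s
      using that by (simp add: H_def)
    define w where "w = A *\<^sub>v v"
    have w: "w \<in> carrier_vec a" using A v by (simp add: w_def)
    have Hw: "H *\<^sub>v w = 0\<^sub>v b" using v assoc_mult_mat_vec[OF H A v(1)] by (simp add: w_def)
    have wi: "w $ s = (\<Sum>j<b. A $$ (s, j) * v $ j)" if "s < a" for s
      unfolding w_def using that A v(1) by (rule mult_mat_vec_index)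
    have "(\<Sum>s<a. cnj (w $ s) * w $ s) = (\<Sum>s<a. \<Sum>j<b. cnj (v $ j) * (cnj (A $$ (s, j)) * w $ s))"
      by (intro sum.cong refl) (simp add: wi sum_distrib_left sum_distrib_right algebra_simps)
    also have "\<dots> = (\<Sum>j<b. cnj (v $ j) * (\<Sum>s<a. cnj (A $$ (s, j)) * w $ s))"
      unfolding sum_distrib_left by (rule sum.swap)
    also have "\<dots> = (\<Sum>j<b. cnj (v $ j) * (H *\<^sub>v w) $ j)"
      by (intro sum.cong refl) (simp add: mult_mat_vec_index[OF _ H w] H_entry del: index_mult_mat_vec)
    also have "\<dots> = 0" unfolding Hw by simp
    finally have "(\<Sum>s<a. cnj (w $ s) * w $ s) = 0" .
    then have "complex_of_real (\<Sum>s<a. (cmod (w $ s))\<^sup>2) = 0"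
      unfolding of_real_sum complex_norm_square by (simp only: mult.commute)
    then have "(\<Sum>s<a. (cmod (w $ s))\<^sup>2) = 0" using of_real_eq_0_iff by blast
    then have "\<forall>s\<in>{..<a}. (cmod (w $ s))\<^sup>2 = 0" by (subst (asm) sum_nonneg_eq_0_iff) auto
    then have "w = 0\<^sub>v a" using w by (intro eq_vecI) auto
    then show False using inj v by (simp add: w_def)
  qed
  then obtain G' where G': "G' \<in> carrier_mat b b" "G' * (H * A) = 1\<^sub>m b"
    using det_nonzero_left_inverse[OF G] by auto
  then show ?thesis using H A by (intro bexI[of _ "G' * H"]) (auto simp: assoc_mult_mat[of _ b b _ a _ b])
qed

lemma surjective_right_inverse:
  fixes Q :: "complex mat"
  assumes Q: "Q \<in> carrier_mat r N" and surj: "(\<lambda>v. Q *\<^sub>v v) ` carrier_vec N = carrier_vec r"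
  shows "\<exists>E\<in>carrier_mat N r. Q * E = 1\<^sub>m r"
proof -
  have "\<forall>k. \<exists>v. k < r \<longrightarrow> v \<in> carrier_vec N \<and> Q *\<^sub>v v = unit_vec r k"
    using surj by (metis imageE unit_vec_carrier)
  then obtain f where f: "\<And>k. k < r \<Longrightarrow> f k \<in> carrier_vec N \<and> Q *\<^sub>v f k = unit_vec r k" by metis
  define E where "E = mat N r (\<lambda>(s, k). f k $ s)"
  have "col E k = f k" if "k < r" for k
    using that f[OF that] by (intro eq_vecI) (auto simp: E_def)
  then have "(Q * E) $$ (i, k) = unit_vec r k $ i" if "i < r" "k < r" for i k
    using that f[OF that(2)] Q by (metis (no_types, lifting) E_def carrier_matD dim_col_mat(1) index_mult_mat(1) index_mult_mat_vec)
  then have "Q * E = 1\<^sub>m r" using Q by (intro eq_matI) (auto simp: E_def)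
  then show ?thesis by (intro bexI[of _ E]) (auto simp: E_def)
qed

text \<open>The columns are a function of their number, so that a column can be appended by a
  function update.\<close>

definition cols_indep :: "nat \<Rightarrow> nat \<Rightarrow> (nat \<Rightarrow> nat \<Rightarrow> complex) \<Rightarrow> bool" where
  "cols_indep N m b \<longleftrightarrow> (\<forall>c. (\<forall>s<N. (\<Sum>u<m. c u * b u s) = 0) \<longrightarrow> (\<forall>u<m. c u = 0))"

lemma cols_indep_cong:
  assumes "cols_indep N m b" "\<And>u s. u < m \<Longrightarrow> b u s = b' u s"
  shows "cols_indep N m b'"
  unfolding cols_indep_def
proof (rule allI, rule impI)
  fix c assume c: "\<forall>s<N. (\<Sum>u<m. c u * b' u s) = 0"
  have "(\<Sum>u<m. c u * b u s) = (\<Sum>u<m. c u * b' u s)" for s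
    by (intro sum.cong) (auto simp: assms(2))
  with c have "\<forall>s<N. (\<Sum>u<m. c u * b u s) = 0" by metis
  then show "\<forall>u<m. c u = 0" using assms(1) unfolding cols_indep_def by blast
qed

text \<open>Otherwise every unit vector is a combination of the \<open>m < N\<close> columns, with
  coefficients \<open>D i\<close>. The \<open>N\<close> coefficient vectors are linearly dependent,
  and a dependency \<open>e\<close> between them would be one between the unit vectors.\<close>

lemma cols_indep_extend:
  assumes ind: "cols_indep N m b" and "m < N"
  shows "\<exists>i<N. cols_indep N (Suc m) (b(m := \<lambda>s. if s = i then 1 else 0))"
proof (rule ccontr)
  assume "\<not> ?thesis"
  then have "\<forall>i. \<exists>c. i < N \<longrightarrow> (\<forall>s<N. (\<Sum>u<m. c u * b u s) + c m * (if s = i then 1 else 0) = 0) \<and> (\<exists>u<Suc m. c u \<noteq> 0)"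
    unfolding cols_indep_def by auto
  from choice[OF this] obtain c where c: "\<And>i s. i < N \<Longrightarrow> s < N \<Longrightarrow> (\<Sum>u<m. c i u * b u s) + c i m * (if s = i then 1 else 0) = 0"
    "\<And>i. i < N \<Longrightarrow> \<exists>u<Suc m. c i u \<noteq> 0" by blast
  have cm: "c i m \<noteq> 0" if "i < N" for i
  proof
    assume "c i m = 0"
    then have "\<forall>s<N. (\<Sum>u<m. c i u * b u s) = 0" using c(1)[OF that] by simp
    then have "\<forall>u<m. c i u = 0" using ind unfolding cols_indep_def by blast
    then show False using c(2)[OF that] \<open>c i m = 0\<close> by (auto simp: less_Suc_eq)
  qed
  define D where "D i u = - c i u / c i m" for i u
  have D: "(\<Sum>u<m. D i u * b u s) = (if s = i then 1 else 0)" if "i < N" "s < N" for i s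
  proof -
    have "(\<Sum>u<m. D i u * b u s) = - (\<Sum>u<m. c i u * b u s) / c i m"
      by (simp add: D_def sum_divide_distrib sum_negf[symmetric])
    also have "(\<Sum>u<m. c i u * b u s) = - (c i m * (if s = i then 1 else 0))"
      using c(1)[OF that] by (simp add: eq_neg_iff_add_eq_0)
    finally show ?thesis using cm[OF that(1)] by simp
  qed
  obtain e where e: "\<exists>i\<in>{..<N}. e i \<noteq> 0" "\<And>u. u < m \<Longrightarrow> (\<Sum>i<N. e i * D i u) = 0"
    using homogeneous_system[of "{..<m}" "{..<N}" D] \<open>m < N\<close> by auto
  have "e s = 0" if "s < N" for s
  proof -
    have "e s = (\<Sum>i<N. e i * (if s = i then 1 else 0))"
      using that by (simp add: if_distrib[of "\<lambda>z. e _ * z"] sum.delta cong: if_cong)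
    also have "\<dots> = (\<Sum>i<N. \<Sum>u<m. e i * D i u * b u s)"
      using that by (intro sum.cong refl) (simp add: D[symmetric] sum_distrib_left mult.assoc)
    also have "\<dots> = (\<Sum>u<m. (\<Sum>i<N. e i * D i u) * b u s)"
      unfolding sum_distrib_right by (rule sum.swap)
    finally show ?thesis using e(2) by simp
  qed
  then show False using e(1) by auto
qed

text \<open>Unit columns suffice to complete \<open>A\<close> to an invertible matrix. The
  completing columns are therefore constant and determined by their positions \<open>f\<close>, and
  these positions will index the charts of the cokernel.\<close>

lemma complement_by_unit_columns:
  fixes A :: "complex mat"
  assumes A: "A \<in> carrier_mat (r + t) t" and inj: "inj_on (\<lambda>c. A *\<^sub>v c) (carrier_vec t)"
  shows "\<exists>f. det (mat (r + t) (r + t) (\<lambda>(s, u). if u < t then A $$ (s, u)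
      else if s = f (u - t) then 1 else 0)) \<noteq> 0"
proof -
  let ?N = "r + t"
  define b where "b f u s = (if u < t then A $$ (s, u) else if s = f (u - t) then 1 else 0)" for f u s
  have "\<exists>f. cols_indep ?N (t + k) (b f)" if "k \<le> r" for k
    using that
  proof (induction k)
    \<comment> \<open>No unit column is present yet, so \<open>f\<close> is arbitrary.\<close>
    case 0
    have ind: "\<forall>u<t. c u = 0" if c: "\<forall>s<?N. (\<Sum>u<t. c u * b (\<lambda>_. 0) u s) = 0" for c
    proof -
      have "A *\<^sub>v vec t c = A *\<^sub>v 0\<^sub>v t"
        using A c by (intro eq_vecI)
          (auto simp: mult_mat_vec_index[OF _ A] b_def mult.commute simp del: index_mult_mat_vec)
      then have "vec t c = 0\<^sub>v t" using inj by (auto simp: inj_on_def)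
      then show ?thesis by (metis index_vec index_zero_vec(1))
    qed
    have "cols_indep ?N (t + 0) (b (\<lambda>_. 0))"
      unfolding cols_indep_def add_0_right by (rule allI, rule impI, rule ind)
    then show ?case by blast
  next
    case (Suc k)
    then obtain f where f: "cols_indep ?N (t + k) (b f)" by auto
    obtain i where i: "cols_indep ?N (Suc (t + k)) ((b f)(t + k := \<lambda>s. if s = i then 1 else 0))"
      using cols_indep_extend[OF f] Suc.prems by auto
    have "((b f)(t + k := \<lambda>s. if s = i then 1 else 0)) u s = b (f(k := i)) u s" if "u < Suc (t + k)" for u s
      using that by (auto simp: b_def)
    then have "cols_indep ?N (Suc (t + k)) (b (f(k := i)))" by (rule cols_indep_cong[OF i])
    then have "cols_indep ?N (t + Suc k) (b (f(k := i)))" by (simp only: add_Suc_right)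
    then show ?case by blast
  qed
  from this[OF order_refl] obtain f where f: "cols_indep ?N ?N (b f)" by (auto simp only: add.commute)
  let ?C = "mat ?N ?N (\<lambda>(s, u). if u < t then A $$ (s, u) else if s = f (u - t) then 1 else 0)"
  have C: "?C \<in> carrier_mat ?N ?N" by simp
  have "det ?C \<noteq> 0"
  proof
    assume "det ?C = 0"
    then obtain v where v: "v \<in> carrier_vec ?N" "v \<noteq> 0\<^sub>v ?N" "?C *\<^sub>v v = 0\<^sub>v ?N"
      using det_0_iff_vec_prod_zero[OF C] by auto
    have "(\<Sum>u<?N. v $ u * b f u s) = 0" if "s < ?N" for s
    proof -
      have "(?C *\<^sub>v v) $ s = (\<Sum>u<?N. ?C $$ (s, u) * v $ u)"
        using that C v(1) by (rule mult_mat_vec_index)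
      also have "\<dots> = (\<Sum>u<?N. v $ u * b f u s)"
        using that by (intro sum.cong refl) (simp add: b_def)
      finally show ?thesis using v(3) that by simp
    qed
    then have "\<forall>u<?N. v $ u = 0" using f unfolding cols_indep_def by blast
    then show False using v by (auto intro: eq_vecI)
  qed
  then show ?thesis by blast
qed

section \<open>Forms\<close>

lemma form_homogeneous: "form k d f \<Longrightarrow> x \<in> carrier_vec k \<Longrightarrow> f (c \<cdot>\<^sub>v x) = c ^ d * f x"
  by (induction rule: form.induct) (auto simp: power_add algebra_simps)

lemma form_smult: "form k d f \<Longrightarrow> form k d (\<lambda>x. c * f x)"
  using form_mult[OF form_const[of k c]] by simp

text \<open>The rules create positive degrees only from coordinates, so a zero of degree
  \<open>d\<close> is built as a product of \<open>d\<close> coordinates with 0; hence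
  \<open>0 < k\<close>.\<close>

lemma form_zero: "0 < k \<Longrightarrow> form k d (\<lambda>x. 0)"
proof (induction d)
  case 0
  show ?case by (rule form_const)
next
  case (Suc d)
  then show ?case using form_mult[OF form_coord[of 0 k], of d "\<lambda>x. 0"] by simp
qed

lemma form_sum:
  assumes "0 < k" "\<And>i. i \<in> A \<Longrightarrow> form k d (f i)"
  shows "form k d (\<lambda>x. \<Sum>i\<in>A. f i x)"
  using assms(2)
proof (induction A rule: infinite_finite_induct)
  case (insert a A)
  then show ?case by (simp add: form_add)
qed (simp_all add: form_zero assms(1))

lemma form_prod:
  assumes "finite A" "\<And>i. i \<in> A \<Longrightarrow> form k (d i) (f i)"
  shows "form k (\<Sum>i\<in>A. d i) (\<lambda>x. \<Prod>i\<in>A. f i x)"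
  using assms
proof (induction A rule: finite_induct)
  case (insert a A)
  then show ?case by (simp add: form_mult)
qed (simp add: form_const)

text \<open>Every term of the expansion takes one entry from each column, so degrees that depend
  only on the column add up. This freedom is needed for matrices that mix linear and constant
  columns.\<close>

lemma form_det:
  assumes "0 < k" "\<And>x. F x \<in> carrier_mat m m"
    and "\<And>i j. i < m \<Longrightarrow> j < m \<Longrightarrow> form k (e j) (\<lambda>x. F x $$ (i, j))"
  shows "form k (\<Sum>j<m. e j) (\<lambda>x. det (F x))"
proof -
  have "form k (\<Sum>j<m. e j) (\<lambda>x. \<Sum>p | p permutes {0..<m}. signof p * (\<Prod>i = 0..<m. F x $$ (i, p i)))"
  proof (intro form_sum form_smult assms(1))
    fix p assume "p \<in> {p. p permutes {0..<m}}"
    then have p: "p permutes {0..<m}" by simp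
    have "form k (\<Sum>i=0..<m. e (p i)) (\<lambda>x. \<Prod>i = 0..<m. F x $$ (i, p i))"
      using permutes_in_image[OF p] by (intro form_prod assms(3)) auto
    moreover have "(\<Sum>i=0..<m. e (p i)) = (\<Sum>j<m. e j)"
      using sum.permute[OF p, of e] by (simp add: lessThan_atLeast0 o_def)
    ultimately show "form k (\<Sum>j<m. e j) (\<lambda>x. \<Prod>i = 0..<m. F x $$ (i, p i))" by simp
  qed
  then show ?thesis using det_def'[OF assms(2)] by simp
qed

text \<open>The entry \<open>(i, j)\<close> of the adjugate is the cofactor with row
  \<open>j\<close> and column \<open>i\<close> deleted, so the degree of column \<open>i\<close>
  drops out.\<close>

lemma form_adj:
  assumes "0 < k" "\<And>x. F x \<in> carrier_mat m m"
    and "\<And>i j. i < m \<Longrightarrow> j < m \<Longrightarrow> form k (e j) (\<lambda>x. F x $$ (i, j))" and ij: "i < m" "j < m"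
  shows "form k (\<Sum>l\<in>{..<m} - {i}. e l) (\<lambda>x. adj_mat (F x) $$ (i, j))"
proof -
  define e' where "e' l = e (if l < i then l else Suc l)" for l
  have del: "mat_delete (F x) j i $$ (a, b) = F x $$ (if a < j then a else Suc a, if b < i then b else Suc b)"
    if "a < m - 1" "b < m - 1" for x a b
    using that assms(2)[of x] by (auto simp: mat_delete_def)
  have "form k (\<Sum>l<m - 1. e' l) (\<lambda>x. det (mat_delete (F x) j i))"
  proof (rule form_det[OF assms(1)])
    show "mat_delete (F x) j i \<in> carrier_mat (m - 1) (m - 1)" for x
      using assms(2) mat_delete_dim[of "F x" j i] by (metis carrier_matD carrier_matI)
    show "form k (e' b) (\<lambda>x. mat_delete (F x) j i $$ (a, b))" if "a < m - 1" "b < m - 1" for a b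
      unfolding del[OF that] e'_def using that by (intro assms(3)) auto
  qed
  moreover have "(\<Sum>l<m - 1. e' l) = (\<Sum>l\<in>{..<m} - {i}. e l)"
    unfolding e'_def
  proof (rule sum.reindex_bij_witness[of _ "\<lambda>l. if l < i then l else l - 1" "\<lambda>l. if l < i then l else Suc l"])
  qed (use ij in auto)
  ultimately have "form k (\<Sum>l\<in>{..<m} - {i}. e l) (\<lambda>x. (-1) ^ (j + i) * det (mat_delete (F x) j i))"
    by (simp add: form_smult)
  moreover have "adj_mat (F x) $$ (i, j) = (-1) ^ (j + i) * det (mat_delete (F x) j i)" for x
    using assms(2)[of x] ij by (simp add: adj_mat_def cofactor_def)
  ultimately show ?thesis by simp
qed

lemma form_subst:
  assumes "form m d f" "\<And>i. i < m \<Longrightarrow> form k e (\<lambda>x. G x $ i)"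
  shows "form k (d * e) (\<lambda>x. f (G x))"
  using assms(1)
proof induction
  case (form_const c)
  then show ?case by (simp add: form.form_const)
next
  case (form_coord i)
  then show ?case using assms(2) by simp
next
  case (form_add d f g)
  then show ?case by (simp add: form.form_add)
next
  case (form_mult d f e' g)
  then show ?case using form.form_mult by (simp add: distrib_right)
qed

section \<open>Rings of functions and forms with coefficients in them\<close>

text \<open>Exactly the closure properties that determinants, adjugates and products of forms over
  the ring call for.\<close>

definition fun_ring :: "('a \<Rightarrow> complex) set \<Rightarrow> bool" where
  "fun_ring R \<longleftrightarrow> (\<forall>c. (\<lambda>_. c) \<in> R) \<and> (\<forall>f\<in>R. \<forall>g\<in>R. (\<lambda>p. f p + g p) \<in> R \<and> (\<lambda>p. f p * g p) \<in> R)"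

lemma fun_ringD:
  assumes "fun_ring R"
  shows "(\<lambda>_. c) \<in> R" "f \<in> R \<Longrightarrow> g \<in> R \<Longrightarrow> (\<lambda>p. f p + g p) \<in> R"
    "f \<in> R \<Longrightarrow> g \<in> R \<Longrightarrow> (\<lambda>p. f p * g p) \<in> R"
  using assms by (auto simp: fun_ring_def)

lemma fun_ring_sum:
  assumes "fun_ring R" "\<And>i. i \<in> A \<Longrightarrow> f i \<in> R"
  shows "(\<lambda>x. \<Sum>i\<in>A. f i x) \<in> R"
  using assms(2)
proof (induction A rule: infinite_finite_induct)
  case (insert a A)
  then show ?case by (simp add: fun_ringD[OF assms(1)])
qed (simp_all add: fun_ringD[OF assms(1)])

lemma fun_ring_prod:
  assumes "fun_ring R" "\<And>i. i \<in> A \<Longrightarrow> f i \<in> R"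
  shows "(\<lambda>x. \<Prod>i\<in>A. f i x) \<in> R"
  using assms(2)
proof (induction A rule: infinite_finite_induct)
  case (insert a A)
  then show ?case by (simp add: fun_ringD[OF assms(1)])
qed (simp_all add: fun_ringD[OF assms(1)])

lemma fun_ring_det:
  assumes R: "fun_ring R" and "\<And>p. F p \<in> carrier_mat m m"
    and "\<And>i j. i < m \<Longrightarrow> j < m \<Longrightarrow> (\<lambda>p. F p $$ (i, j)) \<in> R"
  shows "(\<lambda>p. det (F p)) \<in> R"
proof -
  have "(\<lambda>x. \<Sum>p | p permutes {0..<m}. signof p * (\<Prod>i = 0..<m. F x $$ (i, p i))) \<in> R"
  proof (intro fun_ring_sum[OF R] fun_ringD(3)[OF R] fun_ringD(1)[OF R] fun_ring_prod[OF R])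
    fix p i assume "p \<in> {p. p permutes {0..<m}}" "i \<in> {0..<m}"
    then show "(\<lambda>x. F x $$ (i, p i)) \<in> R"
      using permutes_in_image[of p "{0..<m}"] by (intro assms(3)) auto
  qed
  then show ?thesis using det_def'[OF assms(2)] by simp
qed

lemma fun_ring_adj:
  assumes R: "fun_ring R" and "\<And>p. F p \<in> carrier_mat m m"
    and "\<And>i j. i < m \<Longrightarrow> j < m \<Longrightarrow> (\<lambda>p. F p $$ (i, j)) \<in> R" and ij: "i < m" "j < m"
  shows "(\<lambda>p. adj_mat (F p) $$ (i, j)) \<in> R"
proof -
  have del: "mat_delete (F x) j i $$ (a, b) = F x $$ (if a < j then a else Suc a, if b < i then b else Suc b)"
    if "a < m - 1" "b < m - 1" for x a b
    using that assms(2)[of x] by (auto simp: mat_delete_def)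
  have "(\<lambda>x. det (mat_delete (F x) j i)) \<in> R"
  proof (rule fun_ring_det[OF R])
    show "mat_delete (F x) j i \<in> carrier_mat (m - 1) (m - 1)" for x
      using assms(2) mat_delete_dim[of "F x" j i] by (metis carrier_matD carrier_matI)
    show "(\<lambda>x. mat_delete (F x) j i $$ (a, b)) \<in> R" if "a < m - 1" "b < m - 1" for a b
      unfolding del[OF that] using that by (intro assms(3)) auto
  qed
  then have "(\<lambda>x. (-1) ^ (j + i) * det (mat_delete (F x) j i)) \<in> R"
    by (intro fun_ringD(3)[OF R] fun_ringD(1)[OF R])
  moreover have "adj_mat (F x) $$ (i, j) = (-1) ^ (j + i) * det (mat_delete (F x) j i)" for x
    using assms(2)[of x] ij by (simp add: adj_mat_def cofactor_def)
  ultimately show ?thesis by simp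
qed

text \<open>\<open>form_over\<close> numbers its summands; sums and products of such forms are more
  naturally indexed by disjoint unions and products of index sets.\<close>

lemma form_over_finite:
  assumes "finite S" "\<And>s. s \<in> S \<Longrightarrow> a s \<in> R" "\<And>s. s \<in> S \<Longrightarrow> form k d (f s)"
  shows "(\<lambda>p \<xi>. \<Sum>s\<in>S. a s p * f s \<xi>) \<in> form_over R k d"
proof -
  obtain h where h: "bij_betw h {0..<card S} S" using ex_bij_betw_nat_finite[OF assms(1)] by auto
  have "(\<Sum>s\<in>S. a s p * f s \<xi>) = (\<Sum>l<card S. a (h l) p * f (h l) \<xi>)" for p \<xi>
    using sum.reindex_bij_betw[OF h, of "\<lambda>s. a s p * f s \<xi>"] by (simp add: lessThan_atLeast0)
  moreover have "a (h l) \<in> R \<and> form k d (f (h l))" if "l < card S" for l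
    using assms bij_betwE[OF h] that by auto
  ultimately show ?thesis unfolding form_over_def
    by (intro CollectI exI[of _ "card S"] exI[of _ "\<lambda>l. a (h l)"] exI[of _ "\<lambda>l. f (h l)"]) auto
qed

lemma form_overE:
  assumes "A \<in> form_over R k d"
  obtains m :: nat and a f where "\<forall>l<m. a l \<in> R \<and> form k d (f l)" "A = (\<lambda>p \<xi>. \<Sum>l<m. a l p * f l \<xi>)"
  using assms unfolding form_over_def mem_Collect_eq by (elim exE conjE) (rule that)

lemma form_over_const: "a \<in> R \<Longrightarrow> (\<lambda>p \<xi>. a p) \<in> form_over R k 0"
  using form_over_finite[of "{()}" "\<lambda>_. a" R k 0 "\<lambda>_ _. 1"] by (simp add: form_const)

lemma form_over_zero: "(\<lambda>p \<xi>. 0) \<in> form_over R k d"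
  using form_over_finite[of "{}" "\<lambda>_ :: nat. undefined" R k d] by simp

lemma form_over_form: "fun_ring R \<Longrightarrow> form k d f \<Longrightarrow> (\<lambda>p \<xi>. f \<xi>) \<in> form_over R k d"
  using form_over_finite[of "{()}" "\<lambda>_ _. 1" R k d "\<lambda>_. f"] by (simp add: fun_ringD)

lemma form_over_add:
  assumes "A \<in> form_over R k d" "B \<in> form_over R k d"
  shows "(\<lambda>p \<xi>. A p \<xi> + B p \<xi>) \<in> form_over R k d"
proof -
  obtain m :: nat and a f where A: "\<forall>l<m. a l \<in> R \<and> form k d (f l)" "A = (\<lambda>p \<xi>. \<Sum>l<m. a l p * f l \<xi>)"
    using assms(1) by (rule form_overE)
  obtain m' :: nat and b g where B: "\<forall>l<m'. b l \<in> R \<and> form k d (g l)" "B = (\<lambda>p \<xi>. \<Sum>l<m'. b l p * g l \<xi>)"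
    using assms(2) by (rule form_overE)
  have "(\<lambda>p \<xi>. \<Sum>s\<in>{..<m} <+> {..<m'}. case_sum a b s p * case_sum f g s \<xi>) \<in> form_over R k d"
    by (rule form_over_finite) (use A B in auto)
  then show ?thesis by (simp add: A B sum.Plus)
qed

lemma form_over_mult:
  assumes R: "fun_ring R" and "A \<in> form_over R k d" "B \<in> form_over R k d'"
  shows "(\<lambda>p \<xi>. A p \<xi> * B p \<xi>) \<in> form_over R k (d + d')"
proof -
  obtain m :: nat and a f where A: "\<forall>l<m. a l \<in> R \<and> form k d (f l)" "A = (\<lambda>p \<xi>. \<Sum>l<m. a l p * f l \<xi>)"
    using assms(2) by (rule form_overE)
  obtain m' :: nat and b g where B: "\<forall>l<m'. b l \<in> R \<and> form k d' (g l)" "B = (\<lambda>p \<xi>. \<Sum>l<m'. b l p * g l \<xi>)"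
    using assms(3) by (rule form_overE)
  have "(\<lambda>p \<xi>. \<Sum>s\<in>{..<m} \<times> {..<m'}. (a (fst s) p * b (snd s) p) * (f (fst s) \<xi> * g (snd s) \<xi>))
      \<in> form_over R k (d + d')"
    by (rule form_over_finite) (use A B in \<open>auto intro: fun_ringD[OF R] form_mult\<close>)
  moreover have "A p \<xi> * B p \<xi> = (\<Sum>s\<in>{..<m} \<times> {..<m'}. (a (fst s) p * b (snd s) p) * (f (fst s) \<xi> * g (snd s) \<xi>))" for p \<xi>
    by (simp add: A B sum_product sum.cartesian_product case_prod_unfold algebra_simps)
  ultimately show ?thesis by simp
qed

lemma form_over_sum:
  assumes "\<And>s. s \<in> S \<Longrightarrow> A s \<in> form_over R k d"
  shows "(\<lambda>p \<xi>. \<Sum>s\<in>S. A s p \<xi>) \<in> form_over R k d"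
  using assms
proof (induction S rule: infinite_finite_induct)
  case (insert s S)
  then show ?case by (simp add: form_over_add)
qed (simp_all add: form_over_zero)

lemma form_over_subst:
  assumes R: "fun_ring R" and "form m d f" and G: "\<And>i. i < m \<Longrightarrow> (\<lambda>p \<xi>. G p \<xi> $ i) \<in> form_over R k 1"
  shows "(\<lambda>p \<xi>. f (G p \<xi>)) \<in> form_over R k d"
  using assms(2)
proof induction
  case (form_const c)
  show ?case by (rule form_over_const[OF fun_ringD(1)[OF R]])
next
  case (form_coord i)
  then show ?case using G by simp
next
  case (form_add d f g)
  then show ?case by (simp add: form_over_add)
next
  case (form_mult d f e g)
  then show ?case by (simp add: form_over_mult[OF R])
qed

lemma form_over_subst2:
  assumes R: "fun_ring R" and B: "B \<in> form_over R m d"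
    and G: "\<And>i. i < m \<Longrightarrow> (\<lambda>p \<xi>. G p \<xi> $ i) \<in> form_over R k 1"
  shows "(\<lambda>p \<xi>. B p (G p \<xi>)) \<in> form_over R k d"
proof -
  obtain n :: nat and a f where *: "\<forall>l<n. a l \<in> R \<and> form m d (f l)" "B = (\<lambda>p \<xi>. \<Sum>l<n. a l p * f l \<xi>)"
    using B by (rule form_overE)
  have "(\<lambda>p \<xi>. \<Sum>l<n. a l p * f l (G p \<xi>)) \<in> form_over R k d"
  proof (rule form_over_sum)
    fix l assume "l \<in> {..<n}"
    then have "(\<lambda>p \<xi>. a l p * f l (G p \<xi>)) \<in> form_over R k (0 + d)"
      using * by (intro form_over_mult R form_over_const form_over_subst[OF R _ G]) auto
    then show "(\<lambda>p \<xi>. a l p * f l (G p \<xi>)) \<in> form_over R k d" by simp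
  qed
  then show ?thesis using * by simp
qed

lemma form_over_homogeneous:
  assumes "B \<in> form_over R k d" "\<xi> \<in> carrier_vec k"
  shows "B p (c \<cdot>\<^sub>v \<xi>) = c ^ d * B p \<xi>"
proof -
  obtain m :: nat and a f where B: "\<forall>l<m. a l \<in> R \<and> form k d (f l)" "B = (\<lambda>p \<xi>. \<Sum>l<m. a l p * f l \<xi>)"
    using assms(1) by (rule form_overE)
  have "(\<Sum>l<m. a l p * f l (c \<cdot>\<^sub>v \<xi>)) = (\<Sum>l<m. c ^ d * (a l p * f l \<xi>))"
    using B assms(2) by (intro sum.cong refl) (simp add: form_homogeneous[of k d])
  then show ?thesis by (simp add: B sum_distrib_left)
qed

lemma form_over_mono: "B \<in> form_over R k d \<Longrightarrow> R \<subseteq> R' \<Longrightarrow> B \<in> form_over R' k d"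
  unfolding form_over_def by blast

section \<open>Projective space\<close>

lemma smult_nonzero_vecs: "c \<noteq> 0 \<Longrightarrow> x \<in> nonzero_vecs k \<Longrightarrow> c \<cdot>\<^sub>v x \<in> nonzero_vecs k"
proof -
  assume c: "c \<noteq> 0" and x: "x \<in> nonzero_vecs k"
  obtain i where "i < k" "x $ i \<noteq> 0" using nonzero_vecs_coord[OF x] by auto
  then have "(c \<cdot>\<^sub>v x) $ i \<noteq> 0\<^sub>v k $ i" using x c by (auto simp: nonzero_vecs_def)
  then show ?thesis using x by (auto simp: nonzero_vecs_def)
qed

lemma ray_self: "x \<in> ray x"
  unfolding ray_def by (intro CollectI exI[of _ 1]) simp

lemma ray_eqD: "ray x = ray y \<Longrightarrow> \<exists>c. c \<noteq> 0 \<and> x = c \<cdot>\<^sub>v y"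
  using ray_self[of x] by (auto simp: ray_def)

lemma proj_basic_iff:
  assumes "form (Suc n) d f" "x \<in> nonzero_vecs (Suc n)"
  shows "ray x \<in> proj_basic n f \<longleftrightarrow> f x \<noteq> 0"
proof
  assume "ray x \<in> proj_basic n f"
  then obtain y where y: "y \<in> nonzero_vecs (Suc n)" "f y \<noteq> 0" "ray x = ray y" by (auto simp: proj_basic_def)
  obtain c where "c \<noteq> 0" "x = c \<cdot>\<^sub>v y" using ray_eqD[OF y(3)] by auto
  then show "f x \<noteq> 0" using form_homogeneous[OF assms(1), of y c] y by (simp add: nonzero_vecs_def)
qed (use assms in \<open>auto simp: proj_basic_def\<close>)

lemma topspace_proj: "topspace (topol (proj_space n)) = {ray x |x. x \<in> nonzero_vecs (Suc n)}"
proof -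
  have "proj_basic n (\<lambda>_. 1) = {ray x |x. x \<in> nonzero_vecs (Suc n)}" by (auto simp: proj_basic_def)
  then have "{ray x |x. x \<in> nonzero_vecs (Suc n)} \<subseteq> \<Union>{proj_basic n f |f d. form (Suc n) d f}"
    using form_const[of "Suc n" 1] by blast
  moreover have "\<Union>{proj_basic n f |f d. form (Suc n) d f} \<subseteq> {ray x |x. x \<in> nonzero_vecs (Suc n)}"
    by (auto simp: proj_basic_def)
  ultimately show ?thesis by (auto simp: proj_space_def topology_generated_by_topspace)
qed

lemma openin_proj_basic: "form (Suc n) d f \<Longrightarrow> openin (topol (proj_space n)) (proj_basic n f)"
  by (auto simp: proj_space_def intro: topology_generated_by_Basis)

lemma proj_basic_mult: "proj_basic n (\<lambda>x. f x * g x) \<subseteq> proj_basic n f \<inter> proj_basic n g"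
  by (auto simp: proj_basic_def)

lemma openin_projD:
  assumes "openin (topol (proj_space n)) U" "ray x \<in> U" "x \<in> nonzero_vecs (Suc n)"
  shows "\<exists>d f. form (Suc n) d f \<and> f x \<noteq> 0 \<and> proj_basic n f \<subseteq> U"
proof -
  let ?S = "{proj_basic n f |f d. form (Suc n) d f}"
  have "\<exists>B\<in>?S. ray x \<in> B \<and> B \<subseteq> U"
  proof (rule openin_generated_basisD)
    show "openin (topology_generated_by ?S) U" using assms(1) by (simp add: proj_space_def)
    fix A B P assume "A \<in> ?S" "B \<in> ?S" "P \<in> A" "P \<in> B"
    then obtain f d g e where *: "A = proj_basic n f" "B = proj_basic n g" "form (Suc n) d f" "form (Suc n) e g"
      by auto
    obtain y where y: "P = ray y" "y \<in> nonzero_vecs (Suc n)" using \<open>P \<in> A\<close> * by (auto simp: proj_basic_def)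
    have "f y \<noteq> 0" "g y \<noteq> 0" using * y \<open>P \<in> A\<close> \<open>P \<in> B\<close> proj_basic_iff by auto
    moreover have fg: "form (Suc n) (d + e) (\<lambda>x. f x * g x)" using * by (intro form_mult)
    ultimately have "P \<in> proj_basic n (\<lambda>x. f x * g x)" using y proj_basic_iff[OF fg] by simp
    then show "\<exists>C\<in>?S. P \<in> C \<and> C \<subseteq> A \<inter> B" using fg * proj_basic_mult
      by (intro bexI[of _ "proj_basic n (\<lambda>x. f x * g x)"]) auto
  qed (use assms in auto)
  then show ?thesis using proj_basic_iff[OF _ assms(3)] by blast
qed

lemma regular_projI:
  assumes "\<And>x. x \<in> nonzero_vecs (Suc n) \<Longrightarrow> ray x \<in> U \<Longrightarrow>
     \<exists>d f g. form (Suc n) d f \<and> form (Suc n) d g \<and> g x \<noteq> 0 \<and> proj_basic n g \<subseteq> U \<and>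
           (\<forall>y \<in> nonzero_vecs (Suc n). g y \<noteq> 0 \<longrightarrow> \<phi> (ray y) = f y / g y)"
  shows "\<phi> \<in> regular (proj_space n) U"
  using assms by (simp add: proj_space_def)

lemma regular_projD:
  assumes "\<phi> \<in> regular (proj_space n) U" "x \<in> nonzero_vecs (Suc n)" "ray x \<in> U"
  shows "\<exists>d f g. form (Suc n) d f \<and> form (Suc n) d g \<and> g x \<noteq> 0 \<and> proj_basic n g \<subseteq> U \<and>
           (\<forall>y \<in> nonzero_vecs (Suc n). g y \<noteq> 0 \<longrightarrow> \<phi> (ray y) = f y / g y)"
  using assms by (simp add: proj_space_def)

text \<open>The nonvanishing set of the denominator must lie in the smaller domain too, so the
  fraction is expanded by a form \<open>h\<close> whose basic open set lies in
  \<open>U'\<close>.\<close>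

lemma regular_proj_restrict:
  assumes "\<phi> \<in> regular (proj_space n) U" "openin (topol (proj_space n)) U'" "U' \<subseteq> U"
  shows "\<phi> \<in> regular (proj_space n) U'"
proof (rule regular_projI)
  fix x assume x: "x \<in> nonzero_vecs (Suc n)" "ray x \<in> U'"
  obtain d f g where 1: "form (Suc n) d f" "form (Suc n) d g" "g x \<noteq> 0"
    "\<forall>y \<in> nonzero_vecs (Suc n). g y \<noteq> 0 \<longrightarrow> \<phi> (ray y) = f y / g y"
    using regular_projD[OF assms(1) x(1)] x assms(3) by blast
  obtain e h where 2: "form (Suc n) e h" "h x \<noteq> 0" "proj_basic n h \<subseteq> U'"
    using openin_projD[OF assms(2) x(2,1)] by auto
  show "\<exists>d f g. form (Suc n) d f \<and> form (Suc n) d g \<and> g x \<noteq> 0 \<and> proj_basic n g \<subseteq> U' \<and>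
           (\<forall>y \<in> nonzero_vecs (Suc n). g y \<noteq> 0 \<longrightarrow> \<phi> (ray y) = f y / g y)"
    using 1 2 proj_basic_mult[of n g h] form_mult[OF 1(1) 2(1)] form_mult[OF 1(2) 2(1)]
    by (intro exI[of _ "d + e"] exI[of _ "\<lambda>x. f x * h x"] exI[of _ "\<lambda>x. g x * h x"]) auto
qed

text \<open>Even a constant is to be written with a denominator whose basic open set lies in
  \<open>U\<close>; openness of \<open>U\<close> provides one. For sums and products the fractions
  are brought to a common denominator.\<close>

lemma fun_ring_regular_proj: "fun_ring (regular (proj_space n) U)"
  if U: "openin (topol (proj_space n)) U"
  unfolding fun_ring_def
proof (intro conjI allI ballI)
  show "(\<lambda>_. c) \<in> regular (proj_space n) U" for c
  proof (rule regular_projI)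
    fix x assume x: "x \<in> nonzero_vecs (Suc n)" "ray x \<in> U"
    obtain e h where 2: "form (Suc n) e h" "h x \<noteq> 0" "proj_basic n h \<subseteq> U"
      using openin_projD[OF U x(2,1)] by auto
    then show "\<exists>d f g. form (Suc n) d f \<and> form (Suc n) d g \<and> g x \<noteq> 0 \<and> proj_basic n g \<subseteq> U \<and>
           (\<forall>y \<in> nonzero_vecs (Suc n). g y \<noteq> 0 \<longrightarrow> c = f y / g y)"
      by (intro exI[of _ e] exI[of _ "\<lambda>x. c * h x"] exI[of _ h]) (auto intro: form_smult)
  qed
  fix \<phi> \<psi> assume \<phi>: "\<phi> \<in> regular (proj_space n) U" and \<psi>: "\<psi> \<in> regular (proj_space n) U"
  have *: "\<exists>d f f' g. form (Suc n) d f \<and> form (Suc n) d f' \<and> form (Suc n) d g \<and> g x \<noteq> 0 \<and> proj_basic n g \<subseteq> U \<and>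
           (\<forall>y \<in> nonzero_vecs (Suc n). g y \<noteq> 0 \<longrightarrow> \<phi> (ray y) = f y / g y \<and> \<psi> (ray y) = f' y / g y)"
    if x: "x \<in> nonzero_vecs (Suc n)" "ray x \<in> U" for x
  proof -
    obtain d f g where 1: "form (Suc n) d f" "form (Suc n) d g" "g x \<noteq> 0" "proj_basic n g \<subseteq> U"
      "\<forall>y \<in> nonzero_vecs (Suc n). g y \<noteq> 0 \<longrightarrow> \<phi> (ray y) = f y / g y"
      using regular_projD[OF \<phi> x] by blast
    obtain d' f' g' where 2: "form (Suc n) d' f'" "form (Suc n) d' g'" "g' x \<noteq> 0" "proj_basic n g' \<subseteq> U"
      "\<forall>y \<in> nonzero_vecs (Suc n). g' y \<noteq> 0 \<longrightarrow> \<psi> (ray y) = f' y / g' y"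
      using regular_projD[OF \<psi> x] by blast
    have "form (Suc n) (d + d') (\<lambda>y. g y * f' y)" using 1 2 by (intro form_mult)
    moreover have "form (Suc n) (d + d') (\<lambda>y. f y * g' y)" "form (Suc n) (d + d') (\<lambda>y. g y * g' y)"
      using 1 2 by (intro form_mult; simp)+
    ultimately show ?thesis using 1 2 proj_basic_mult[of n g g']
      by (intro exI[of _ "d + d'"] exI[of _ "\<lambda>y. f y * g' y"] exI[of _ "\<lambda>y. g y * f' y"] exI[of _ "\<lambda>y. g y * g' y"])
        auto
  qed
  show "(\<lambda>p. \<phi> p + \<psi> p) \<in> regular (proj_space n) U"
  proof (rule regular_projI)
    fix x assume x: "x \<in> nonzero_vecs (Suc n)" "ray x \<in> U"
    from *[OF x] obtain d f f' g where 1: "form (Suc n) d f" "form (Suc n) d f'" "form (Suc n) d g" "g x \<noteq> 0" "proj_basic n g \<subseteq> U"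
           "\<forall>y \<in> nonzero_vecs (Suc n). g y \<noteq> 0 \<longrightarrow> \<phi> (ray y) = f y / g y \<and> \<psi> (ray y) = f' y / g y"
      by (elim exE conjE) (rule that)
    then show "\<exists>d f g. form (Suc n) d f \<and> form (Suc n) d g \<and> g x \<noteq> 0 \<and> proj_basic n g \<subseteq> U \<and>
           (\<forall>y \<in> nonzero_vecs (Suc n). g y \<noteq> 0 \<longrightarrow> \<phi> (ray y) + \<psi> (ray y) = f y / g y)"
      by (intro exI[of _ d] exI[of _ "\<lambda>y. f y + f' y"] exI[of _ g])
        (auto simp: add_divide_distrib intro: form_add)
  qed
  show "(\<lambda>p. \<phi> p * \<psi> p) \<in> regular (proj_space n) U"
  proof (rule regular_projI)
    fix x assume x: "x \<in> nonzero_vecs (Suc n)" "ray x \<in> U"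
    from *[OF x] obtain d f f' g where 1: "form (Suc n) d f" "form (Suc n) d f'" "form (Suc n) d g" "g x \<noteq> 0" "proj_basic n g \<subseteq> U"
           "\<forall>y \<in> nonzero_vecs (Suc n). g y \<noteq> 0 \<longrightarrow> \<phi> (ray y) = f y / g y \<and> \<psi> (ray y) = f' y / g y"
      by (elim exE conjE) (rule that)
    moreover have "form (Suc n) (d + d) (\<lambda>y. f y * f' y)" "form (Suc n) (d + d) (\<lambda>y. g y * g y)"
      using 1 by (intro form_mult; simp)+
    ultimately show "\<exists>d f g. form (Suc n) d f \<and> form (Suc n) d g \<and> g x \<noteq> 0 \<and> proj_basic n g \<subseteq> U \<and>
           (\<forall>y \<in> nonzero_vecs (Suc n). g y \<noteq> 0 \<longrightarrow> \<phi> (ray y) * \<psi> (ray y) = f y / g y)"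
      using proj_basic_mult[of n g g]
      by (intro exI[of _ "d + d"] exI[of _ "\<lambda>y. f y * f' y"] exI[of _ "\<lambda>y. g y * g y"]) auto
  qed
qed

text \<open>A quotient of forms of equal degree as a function on rays. The representative is chosen
  arbitrarily, and homogeneity makes the choice irrelevant.\<close>

definition quot_fun :: "(complex vec \<Rightarrow> complex) \<Rightarrow> (complex vec \<Rightarrow> complex) \<Rightarrow> pt \<Rightarrow> complex" where
  "quot_fun f g P = (let y = (SOME y. y \<in> P) in f y / g y)"

lemma quot_fun_ray:
  assumes "form (Suc n) d f" "form (Suc n) d g" "x \<in> nonzero_vecs (Suc n)"
  shows "quot_fun f g (ray x) = f x / g x"
proof -
  have "(SOME y. y \<in> ray x) \<in> ray x" using ray_self by (rule someI)
  then obtain c where c: "c \<noteq> 0" "(SOME y. y \<in> ray x) = c \<cdot>\<^sub>v x" by (auto simp: ray_def)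
  then show ?thesis using assms
    by (simp add: quot_fun_def form_homogeneous nonzero_vecs_def)
qed

lemma quot_fun_regular:
  assumes "form (Suc n) d f" "form (Suc n) d g"
  shows "quot_fun f g \<in> regular (proj_space n) (proj_basic n g)"
proof (rule regular_projI)
  fix x assume "x \<in> nonzero_vecs (Suc n)" "ray x \<in> proj_basic n g"
  then show "\<exists>d f' g'. form (Suc n) d f' \<and> form (Suc n) d g' \<and> g' x \<noteq> 0 \<and> proj_basic n g' \<subseteq> proj_basic n g \<and>
           (\<forall>y \<in> nonzero_vecs (Suc n). g' y \<noteq> 0 \<longrightarrow> quot_fun f g (ray y) = f' y / g' y)"
    using assms proj_basic_iff quot_fun_ray by blast
qed

section \<open>The projective bundle of a vector bundle on projective space\<close>

locale vbundle_on_proj =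
  fixes n :: nat and V :: "('i, pt) vbundle"
  assumes vector_bundle: "vector_bundle (proj_space n) V"
begin

abbreviation Op :: "pt set \<Rightarrow> bool" where "Op U \<equiv> openin (topol (proj_space n)) U"
abbreviation R :: "pt set \<Rightarrow> (pt \<Rightarrow> complex) set" where "R U \<equiv> regular (proj_space n) U"
abbreviation r :: nat where "r \<equiv> rank V"

text \<open>A sum over indices, not a matrix-vector product: membership in \<open>form_over\<close> is an equality of
  functions on vectors of all dimensions.\<close>

definition tr :: "'i \<Rightarrow> 'i \<Rightarrow> pt \<Rightarrow> complex vec \<Rightarrow> complex vec" where
  "tr i j p \<xi> = vec r (\<lambda>l. \<Sum>k<r. trans V i j p $$ (k, l) * \<xi> $ k)"

lemma chart_open: "i \<in> index V \<Longrightarrow> Op (chart V i)"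
  using vector_bundle by (simp add: vector_bundle_def)

lemma trans_carrier: "i \<in> index V \<Longrightarrow> j \<in> index V \<Longrightarrow> p \<in> chart V i \<Longrightarrow> p \<in> chart V j \<Longrightarrow>
    trans V i j p \<in> carrier_mat r r"
  using vector_bundle by (simp add: vector_bundle_def regular_mat_def)

lemma trans_regular: "i \<in> index V \<Longrightarrow> j \<in> index V \<Longrightarrow> k < r \<Longrightarrow> l < r \<Longrightarrow>
    (\<lambda>p. trans V i j p $$ (k, l)) \<in> R (chart V i \<inter> chart V j)"
  using vector_bundle by (simp add: vector_bundle_def regular_mat_def)

lemma trans_comp: "i \<in> index V \<Longrightarrow> j \<in> index V \<Longrightarrow> k \<in> index V \<Longrightarrow>
    p \<in> chart V i \<Longrightarrow> p \<in> chart V j \<Longrightarrow> p \<in> chart V k \<Longrightarrow> trans V i j p * trans V j k p = trans V i k p"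
  using vector_bundle by (simp add: vector_bundle_def)

lemma trans_id: "i \<in> index V \<Longrightarrow> p \<in> chart V i \<Longrightarrow> trans V i i p = 1\<^sub>m r"
  using vector_bundle by (simp add: vector_bundle_def)

lemma chart_cover: "x \<in> nonzero_vecs (Suc n) \<Longrightarrow> \<exists>i\<in>index V. ray x \<in> chart V i"
  using vector_bundle topspace_proj[of n] by (auto simp: vector_bundle_def)

lemma chart_ray: "i \<in> index V \<Longrightarrow> p \<in> chart V i \<Longrightarrow> \<exists>x\<in>nonzero_vecs (Suc n). p = ray x"
  using openin_subset[OF chart_open[of i]] topspace_proj[of n] by auto

lemma tr_eq:
  assumes "i \<in> index V" "j \<in> index V" "p \<in> chart V i" "p \<in> chart V j" "\<xi> \<in> carrier_vec r"
  shows "transpose_mat (trans V i j p) *\<^sub>v \<xi> = tr i j p \<xi>"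
  using trans_carrier[OF assms(1-4)] assms(5)
  by (intro eq_vecI) (auto simp: tr_def scalar_prod_def lessThan_atLeast0)

lemma tr_carrier: "tr i j p \<xi> \<in> carrier_vec r"
  by (simp add: tr_def)

lemma tr_smult: "\<xi> \<in> carrier_vec r \<Longrightarrow> tr i j p (c \<cdot>\<^sub>v \<xi>) = c \<cdot>\<^sub>v tr i j p \<xi>"
  by (intro eq_vecI) (auto simp: tr_def sum_distrib_left algebra_simps)

lemma tr_id: "i \<in> index V \<Longrightarrow> p \<in> chart V i \<Longrightarrow> \<xi> \<in> carrier_vec r \<Longrightarrow> tr i i p \<xi> = \<xi>"
  using tr_eq[of i i p \<xi>] trans_id[of i p] by simp

lemma tr_comp:
  assumes "i \<in> index V" "j \<in> index V" "k \<in> index V" "p \<in> chart V i" "p \<in> chart V j" "p \<in> chart V k"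
    "\<xi> \<in> carrier_vec r"
  shows "tr j k p (tr i j p \<xi>) = tr i k p \<xi>"
proof -
  have c: "trans V i j p \<in> carrier_mat r r" "trans V j k p \<in> carrier_mat r r"
    using assms by (auto intro: trans_carrier)
  have "tr j k p (tr i j p \<xi>) = transpose_mat (trans V j k p) *\<^sub>v (transpose_mat (trans V i j p) *\<^sub>v \<xi>)"
    using assms tr_eq tr_carrier by metis
  also have "\<dots> = (transpose_mat (trans V j k p) * transpose_mat (trans V i j p)) *\<^sub>v \<xi>"
    using c assms(7) by (intro assoc_mult_mat_vec[symmetric]) auto
  also have "\<dots> = transpose_mat (trans V i k p) *\<^sub>v \<xi>"
    using transpose_mult[OF c] trans_comp assms by metis
  finally show ?thesis using tr_eq assms by metis
qed

text \<open>Invertibility of the transition matrices is not part of the definition of a bundle; it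
  follows from the cocycle condition, by which \<open>tr j i p\<close> undoes
  \<open>tr i j p\<close>.\<close>

lemma tr_nonzero:
  assumes "i \<in> index V" "j \<in> index V" "p \<in> chart V i" "p \<in> chart V j" "\<xi> \<in> nonzero_vecs r"
  shows "tr i j p \<xi> \<in> nonzero_vecs r"
proof -
  have "tr i j p \<xi> \<noteq> 0\<^sub>v r"
  proof
    assume "tr i j p \<xi> = 0\<^sub>v r"
    then have "tr j i p (0\<^sub>v r) = \<xi>"
      using tr_comp[of i j i p \<xi>] tr_id[of i p \<xi>] assms by (simp add: nonzero_vecs_def)
    moreover have "tr j i p (0\<^sub>v r) = 0\<^sub>v r" by (intro eq_vecI) (auto simp: tr_def)
    ultimately show False using assms(5) by (simp add: nonzero_vecs_def)
  qed
  then show ?thesis using tr_carrier by (simp add: nonzero_vecs_def)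
qed

lemma tr_form_over:
  assumes "i \<in> index V" "j \<in> index V" "Op U" "U \<subseteq> chart V i" "U \<subseteq> chart V j" "l < r"
  shows "(\<lambda>p \<xi>. tr i j p \<xi> $ l) \<in> form_over (R U) r 1"
proof -
  have "(\<lambda>p \<xi>. \<Sum>k\<in>{..<r}. trans V i j p $$ (k, l) * \<xi> $ k) \<in> form_over (R U) r 1"
  proof (rule form_over_finite)
    fix k assume k: "k \<in> {..<r}"
    show "(\<lambda>p. trans V i j p $$ (k, l)) \<in> R U"
      by (rule regular_proj_restrict[OF trans_regular[of i j k l]]) (use assms k in auto)
    show "form r 1 (\<lambda>\<xi>. \<xi> $ k)" using k by (intro form_coord) auto
  qed simp
  then show ?thesis using assms(6) by (simp add: tr_def)
qed

lemma fun_ring_R: "Op U \<Longrightarrow> fun_ring (R U)"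
  by (rule fun_ring_regular_proj)

lemma form_over_restrict: "B \<in> form_over (R U) k d \<Longrightarrow> Op U' \<Longrightarrow> U' \<subseteq> U \<Longrightarrow> B \<in> form_over (R U') k d"
  by (erule form_over_mono) (auto intro: regular_proj_restrict)

lemma mem_pb_pt:
  assumes "i \<in> index V" "p \<in> chart V i" "\<xi> \<in> carrier_vec r"
  shows "(j, p', \<eta>) \<in> pb_pt V i p \<xi> \<longleftrightarrow>
    j \<in> index V \<and> p \<in> chart V j \<and> p' = p \<and> (\<exists>c. c \<noteq> 0 \<and> \<eta> = c \<cdot>\<^sub>v tr i j p \<xi>)"
  using assms tr_eq by (auto simp: pb_pt_def)

lemma pb_pt_self: "i \<in> index V \<Longrightarrow> p \<in> chart V i \<Longrightarrow> \<xi> \<in> carrier_vec r \<Longrightarrow> (i, p, \<xi>) \<in> pb_pt V i p \<xi>"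
  by (auto simp: mem_pb_pt tr_id intro!: exI[of _ 1])

text \<open>A point is the set of all its descriptions, so changing the chart is an equality of
  sets, given by the cocycle condition.\<close>

lemma pb_pt_change:
  assumes "i \<in> index V" "j \<in> index V" "p \<in> chart V i" "p \<in> chart V j" "\<xi> \<in> carrier_vec r"
  shows "pb_pt V j p (tr i j p \<xi>) = pb_pt V i p \<xi>"
proof -
  have "(k, p', \<eta>) \<in> pb_pt V j p (tr i j p \<xi>) \<longleftrightarrow> (k, p', \<eta>) \<in> pb_pt V i p \<xi>" for k p' \<eta>
  proof (cases "k \<in> index V \<and> p \<in> chart V k")
    case True
    then show ?thesis using assms by (simp add: mem_pb_pt tr_carrier tr_comp)
  next
    case False
    then show ?thesis using assms by (auto simp: mem_pb_pt tr_carrier)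
  qed
  then show ?thesis by (simp add: set_eq_iff split_paired_All)
qed

lemma pb_pt_smult:
  assumes "i \<in> index V" "p \<in> chart V i" "\<xi> \<in> carrier_vec r" "c \<noteq> 0"
  shows "pb_pt V i p (c \<cdot>\<^sub>v \<xi>) = pb_pt V i p \<xi>"
proof -
  have "(\<exists>d. d \<noteq> 0 \<and> \<eta> = d \<cdot>\<^sub>v (c \<cdot>\<^sub>v \<zeta>)) \<longleftrightarrow> (\<exists>d. d \<noteq> 0 \<and> \<eta> = d \<cdot>\<^sub>v \<zeta>)" for \<eta> \<zeta> :: "complex vec"
  proof
    assume "\<exists>d. d \<noteq> 0 \<and> \<eta> = d \<cdot>\<^sub>v \<zeta>"
    then obtain d where "d \<noteq> 0" "\<eta> = d \<cdot>\<^sub>v \<zeta>" by auto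
    then show "\<exists>d. d \<noteq> 0 \<and> \<eta> = d \<cdot>\<^sub>v (c \<cdot>\<^sub>v \<zeta>)" using assms(4)
      by (intro exI[of _ "d / c"]) (simp add: smult_smult_assoc)
  next
    assume "\<exists>d. d \<noteq> 0 \<and> \<eta> = d \<cdot>\<^sub>v (c \<cdot>\<^sub>v \<zeta>)"
    then obtain d where "d \<noteq> 0" "\<eta> = d \<cdot>\<^sub>v (c \<cdot>\<^sub>v \<zeta>)" by auto
    then show "\<exists>d. d \<noteq> 0 \<and> \<eta> = d \<cdot>\<^sub>v \<zeta>" using assms(4)
      by (intro exI[of _ "d * c"]) (simp add: smult_smult_assoc)
  qed
  then have "(k, p', \<eta>) \<in> pb_pt V i p (c \<cdot>\<^sub>v \<xi>) \<longleftrightarrow> (k, p', \<eta>) \<in> pb_pt V i p \<xi>" for k p' \<eta>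
    using assms by (simp add: mem_pb_pt tr_smult)
  then show ?thesis by (simp add: set_eq_iff split_paired_All)
qed

lemma pb_pt_eqD:
  assumes "pb_pt V i p \<xi> = pb_pt V j q \<eta>" "i \<in> index V" "p \<in> chart V i" "\<xi> \<in> carrier_vec r"
    "j \<in> index V" "q \<in> chart V j" "\<eta> \<in> carrier_vec r"
  shows "p = q \<and> (\<exists>c. c \<noteq> 0 \<and> \<xi> = c \<cdot>\<^sub>v tr j i p \<eta>)"
  using pb_pt_self[OF assms(2-4)] unfolding assms(1) using assms mem_pb_pt by auto

lemma pb_basicI: "p \<in> U \<Longrightarrow> \<xi> \<in> nonzero_vecs r \<Longrightarrow> B p \<xi> \<noteq> 0 \<Longrightarrow> pb_pt V i p \<xi> \<in> pb_basic V i U B"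
  by (auto simp: pb_basic_def)

text \<open>Membership only provides some description of the point over chart \<open>j\<close>; it
  differs from the transported one by a scalar, which homogeneity of \<open>B\<close>
  absorbs.\<close>

lemma pb_basicD:
  assumes "pb_pt V i p \<xi> \<in> pb_basic V j U B" "i \<in> index V" "p \<in> chart V i" "\<xi> \<in> nonzero_vecs r"
    "j \<in> index V" "U \<subseteq> chart V j" "B \<in> form_over Q r d"
  shows "p \<in> U \<and> B p (tr i j p \<xi>) \<noteq> 0"
proof -
  obtain q \<eta> where q: "q \<in> U" "\<eta> \<in> nonzero_vecs r" "B q \<eta> \<noteq> 0" "pb_pt V i p \<xi> = pb_pt V j q \<eta>"
    using assms(1) by (auto simp: pb_basic_def)
  have *: "\<xi> \<in> carrier_vec r" "\<eta> \<in> carrier_vec r" "q \<in> chart V j"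
    using q assms by (auto simp: nonzero_vecs_def)
  obtain c where c: "p = q" "c \<noteq> 0" "\<eta> = c \<cdot>\<^sub>v tr i j q \<xi>"
    using pb_pt_eqD[OF q(4)[symmetric] assms(5) *(3,2) assms(2,3) *(1)] by auto
  then show ?thesis using q form_over_homogeneous[OF assms(7) tr_carrier, of p c i j p \<xi>] by auto
qed

lemma pb_basic_iff:
  assumes "i \<in> index V" "U \<subseteq> chart V i" "p \<in> U" "\<xi> \<in> nonzero_vecs r" "B \<in> form_over Q r d"
  shows "pb_pt V i p \<xi> \<in> pb_basic V i U B \<longleftrightarrow> B p \<xi> \<noteq> 0"
  using pb_basicI[of p U \<xi> B i] pb_basicD[of i p \<xi> i U B Q d] assms tr_id[of i p \<xi>]
  by (auto simp: nonzero_vecs_def)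

abbreviation PV :: "('i \<times> pt \<times> complex vec) set fspace" where "PV \<equiv> proj_bundle (proj_space n) V"

abbreviation pb_base :: "('i \<times> pt \<times> complex vec) set set set" where
  "pb_base \<equiv> {pb_basic V i U B |i U d B. i \<in> index V \<and> Op U \<and> U \<subseteq> chart V i \<and> B \<in> form_over (R U) r d}"

lemma openin_pb_basic:
  "i \<in> index V \<Longrightarrow> Op U \<Longrightarrow> U \<subseteq> chart V i \<Longrightarrow> B \<in> form_over (R U) r d \<Longrightarrow> openin (topol PV) (pb_basic V i U B)"
  by (auto simp: proj_bundle_def intro!: topology_generated_by_Basis)

lemma topspace_PV:
  "topspace (topol PV) = {pb_pt V i p \<xi> |i p \<xi>. i \<in> index V \<and> p \<in> chart V i \<and> \<xi> \<in> nonzero_vecs r}"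
proof
  show "topspace (topol PV) \<subseteq> {pb_pt V i p \<xi> |i p \<xi>. i \<in> index V \<and> p \<in> chart V i \<and> \<xi> \<in> nonzero_vecs r}"
    unfolding proj_bundle_def fspace.simps topology_generated_by_topspace by (auto simp: pb_basic_def)
  show "{pb_pt V i p \<xi> |i p \<xi>. i \<in> index V \<and> p \<in> chart V i \<and> \<xi> \<in> nonzero_vecs r} \<subseteq> topspace (topol PV)"
  proof clarify
    fix i p \<xi> assume *: "i \<in> index V" "p \<in> chart V i" "\<xi> \<in> nonzero_vecs r"
    have "(\<lambda>p \<xi>. 1) \<in> form_over (R (chart V i)) r 0"
      using form_over_const[OF fun_ringD(1)[OF fun_ring_R[OF chart_open[OF *(1)]]]] .
    from openin_subset[OF openin_pb_basic[OF *(1) chart_open[OF *(1)] subset_refl this]]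
    show "pb_pt V i p \<xi> \<in> topspace (topol PV)" using * by (auto simp: pb_basic_def)
  qed
qed

text \<open>A basic set may be tied to another chart \<open>j\<close>. Over the overlap,
  substituting the transition functions, which are linear in \<open>\<xi>\<close> with regular
  coefficients, rewrites \<open>B\<close> as a form in the chart \<open>i\<close>.\<close>

lemma pb_base_refine:
  assumes "A \<in> pb_base" "pb_pt V i p \<xi> \<in> A" "i \<in> index V" "p \<in> chart V i" "\<xi> \<in> nonzero_vecs r"
  shows "\<exists>U d B. Op U \<and> p \<in> U \<and> U \<subseteq> chart V i \<and> B \<in> form_over (R U) r d \<and> B p \<xi> \<noteq> 0 \<and> pb_basic V i U B \<subseteq> A"
proof -
  obtain j U d B where A: "A = pb_basic V j U B" "j \<in> index V" "Op U" "U \<subseteq> chart V j" "B \<in> form_over (R U) r d"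
    using assms(1) by blast
  let ?U = "U \<inter> chart V i" and ?B = "\<lambda>p \<xi>. B p (tr i j p \<xi>)"
  have p: "p \<in> U" "?B p \<xi> \<noteq> 0" using pb_basicD assms A by blast+
  have U: "Op ?U" "?U \<subseteq> chart V i" "?U \<subseteq> chart V j" "?U \<subseteq> U" using A chart_open[OF assms(3)] by auto
  have "?B \<in> form_over (R ?U) r d"
    by (rule form_over_subst2[OF fun_ring_R[OF U(1)] form_over_restrict[OF A(5) U(1,4)], where G = "tr i j"])
      (rule tr_form_over[OF assms(3) A(2) U(1-3)])
  moreover have "pb_basic V i ?U ?B \<subseteq> A"
  proof
    fix P assume "P \<in> pb_basic V i ?U ?B"
    then obtain q \<eta> where q: "P = pb_pt V i q \<eta>" "q \<in> ?U" "\<eta> \<in> nonzero_vecs r" "?B q \<eta> \<noteq> 0"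
      by (auto simp: pb_basic_def)
    have "q \<in> chart V j" "q \<in> chart V i" using q U by auto
    then have "P = pb_pt V j q (tr i j q \<eta>)"
      using pb_pt_change[of i j q \<eta>] q assms A by (simp add: nonzero_vecs_def)
    then show "P \<in> A" using q tr_nonzero[of i j q \<eta>] A assms \<open>q \<in> chart V j\<close> \<open>q \<in> chart V i\<close> pb_basicI by simp
  qed
  ultimately show ?thesis using U p assms(4)
    by (intro exI[of _ ?U] exI[of _ d] exI[of _ ?B]) auto
qed

lemma openin_PVD:
  assumes "openin (topol PV) W" "pb_pt V i p \<xi> \<in> W" "i \<in> index V" "p \<in> chart V i" "\<xi> \<in> nonzero_vecs r"
  shows "\<exists>U d B. Op U \<and> p \<in> U \<and> U \<subseteq> chart V i \<and> B \<in> form_over (R U) r d \<and> B p \<xi> \<noteq> 0 \<and> pb_basic V i U B \<subseteq> W"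
proof -
  have "\<exists>A\<in>pb_base. pb_pt V i p \<xi> \<in> A \<and> A \<subseteq> W"
  proof (rule openin_generated_basisD)
    show "openin (topology_generated_by pb_base) W" using assms(1) by (simp add: proj_bundle_def)
    fix A A' P assume *: "A \<in> pb_base" "A' \<in> pb_base" "P \<in> A" "P \<in> A'"
    then obtain i p \<xi> where P: "P = pb_pt V i p \<xi>" "i \<in> index V" "p \<in> chart V i" "\<xi> \<in> nonzero_vecs r"
      by (auto simp: pb_basic_def)
    obtain U d B where 1: "Op U" "p \<in> U" "U \<subseteq> chart V i" "B \<in> form_over (R U) r d" "B p \<xi> \<noteq> 0" "pb_basic V i U B \<subseteq> A"
      using pb_base_refine[OF *(1) *(3)[unfolded P] P(2-4)] by (elim exE conjE) (rule that)
    obtain U' d' B' where 2: "Op U'" "p \<in> U'" "U' \<subseteq> chart V i" "B' \<in> form_over (R U') r d'" "B' p \<xi> \<noteq> 0" "pb_basic V i U' B' \<subseteq> A'"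
      using pb_base_refine[OF *(2) *(4)[unfolded P] P(2-4)] by (elim exE conjE) (rule that)
    \<comment> \<open>Both sets are now expressed in the same chart, where intersecting them means
      multiplying the forms.\<close>
    let ?B = "\<lambda>p \<xi>. B p \<xi> * B' p \<xi>"
    have U: "Op (U \<inter> U')" using 1 2 by auto
    have "B \<in> form_over (R (U \<inter> U')) r d" "B' \<in> form_over (R (U \<inter> U')) r d'"
      using form_over_restrict[OF 1(4) U] form_over_restrict[OF 2(4) U] by auto
    then have "?B \<in> form_over (R (U \<inter> U')) r (d + d')"
      by (intro form_over_mult fun_ring_R U)
    then have C: "pb_basic V i (U \<inter> U') ?B \<in> pb_base" using U 1(3) P(2)
      by (intro CollectI exI[of _ i] exI[of _ "U \<inter> U'"] exI[of _ "d + d'"] exI[of _ ?B]) auto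
    have "pb_basic V i (U \<inter> U') ?B \<subseteq> pb_basic V i U B \<inter> pb_basic V i U' B'"
      by (auto simp: pb_basic_def)
    also have "\<dots> \<subseteq> A \<inter> A'" using 1(6) 2(6) by (rule Int_mono)
    finally have sub: "pb_basic V i (U \<inter> U') ?B \<subseteq> A \<inter> A'" .
    have "P \<in> pb_basic V i (U \<inter> U') ?B" using P 1(2,5) 2(2,5) by (auto intro!: pb_basicI)
    then show "\<exists>C\<in>pb_base. P \<in> C \<and> C \<subseteq> A \<inter> A'" by (intro bexI[OF _ C] conjI sub)
  qed (use assms in auto)
  then obtain A where A: "A \<in> pb_base" "pb_pt V i p \<xi> \<in> A" "A \<subseteq> W" by blast
  obtain U d B where "Op U" "p \<in> U" "U \<subseteq> chart V i" "B \<in> form_over (R U) r d" "B p \<xi> \<noteq> 0" "pb_basic V i U B \<subseteq> A"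
    using pb_base_refine[OF A(1,2) assms(3-5)] by (elim exE conjE) (rule that)
  then show ?thesis using A(3) by (intro exI[of _ U] exI[of _ d] exI[of _ B]) auto
qed

definition pb_quot ::
    "('i \<times> pt \<times> complex vec) set set \<Rightarrow> (('i \<times> pt \<times> complex vec) set \<Rightarrow> complex) \<Rightarrow>
      'i \<Rightarrow> pt \<Rightarrow> complex vec \<Rightarrow> bool" where
  "pb_quot W \<phi> i p \<xi> \<longleftrightarrow> (\<exists>U d A B. Op U \<and> p \<in> U \<and> U \<subseteq> chart V i \<and>
     A \<in> form_over (R U) r d \<and> B \<in> form_over (R U) r d \<and> B p \<xi> \<noteq> 0 \<and> pb_basic V i U B \<subseteq> W \<and>
     (\<forall>q\<in>U. \<forall>\<eta>\<in>nonzero_vecs r. B q \<eta> \<noteq> 0 \<longrightarrow> \<phi> (pb_pt V i q \<eta>) = A q \<eta> / B q \<eta>))"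

lemma pb_quotI:
  assumes "Op U" "p \<in> U" "U \<subseteq> chart V i" "A \<in> form_over (R U) r d" "B \<in> form_over (R U) r d" "B p \<xi> \<noteq> 0"
    and "\<And>q \<eta>. q \<in> U \<Longrightarrow> \<eta> \<in> nonzero_vecs r \<Longrightarrow> B q \<eta> \<noteq> 0 \<Longrightarrow>
      pb_pt V i q \<eta> \<in> W \<and> \<phi> (pb_pt V i q \<eta>) = A q \<eta> / B q \<eta>"
  shows "pb_quot W \<phi> i p \<xi>"
  unfolding pb_quot_def using assms
  by (intro exI[of _ U] exI[of _ d] exI[of _ A] exI[of _ B]) (auto simp: pb_basic_def)

lemma regular_PV_iff: "\<phi> \<in> regular PV W \<longleftrightarrow> (\<forall>i\<in>index V. \<forall>p\<in>chart V i. \<forall>\<xi>\<in>nonzero_vecs r.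
    pb_pt V i p \<xi> \<in> W \<longrightarrow> pb_quot W \<phi> i p \<xi>)"
  unfolding proj_bundle_def fspace.simps mem_Collect_eq pb_quot_def ..

lemma regular_PVI:
  assumes "\<And>i p \<xi>. i \<in> index V \<Longrightarrow> p \<in> chart V i \<Longrightarrow> \<xi> \<in> nonzero_vecs r \<Longrightarrow> pb_pt V i p \<xi> \<in> W \<Longrightarrow>
    pb_quot W \<phi> i p \<xi>"
  shows "\<phi> \<in> regular PV W"
  using assms unfolding regular_PV_iff by blast

lemma coord_form_over: "Op U \<Longrightarrow> l < r \<Longrightarrow> (\<lambda>p \<xi>. \<xi> $ l) \<in> form_over (R U) r 1"
  by (intro form_over_form fun_ring_R form_coord)

section \<open>The universal quotient line bundle\<close>

abbreviation O1 :: "('i \<times> nat, ('i \<times> pt \<times> complex vec) set) lbundle" where "O1 \<equiv> pb_O1 V"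

lemma lchart_O1_iff:
  assumes "i \<in> index V" "l < r" "j \<in> index V" "p \<in> chart V j" "\<xi> \<in> nonzero_vecs r"
  shows "pb_pt V j p \<xi> \<in> lchart O1 (i, l) \<longleftrightarrow> p \<in> chart V i \<and> tr j i p \<xi> $ l \<noteq> 0"
proof
  assume "pb_pt V j p \<xi> \<in> lchart O1 (i, l)"
  then show "p \<in> chart V i \<and> tr j i p \<xi> $ l \<noteq> 0"
    using pb_basicD[OF _ assms(3-5,1) subset_refl coord_form_over[OF chart_open[OF assms(1)] assms(2)]]
    by (simp add: pb_O1_def)
next
  assume *: "p \<in> chart V i \<and> tr j i p \<xi> $ l \<noteq> 0"
  then have "pb_pt V j p \<xi> = pb_pt V i p (tr j i p \<xi>)"
    using pb_pt_change[of j i p \<xi>] assms by (simp add: nonzero_vecs_def)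
  then show "pb_pt V j p \<xi> \<in> lchart O1 (i, l)"
    using * tr_nonzero[of j i p \<xi>] assms pb_basicI by (simp add: pb_O1_def)
qed

text \<open>The \<open>THE\<close> is justified because the descriptions of a point in the chart
  \<open>i\<close> differ by a scalar that cancels in the quotient.\<close>

lemma ltrans_O1:
  assumes "i \<in> index V" "j \<in> index V" "p \<in> chart V i" "p \<in> chart V j" "\<xi> \<in> carrier_vec r" "m < r" "l < r"
  shows "ltrans O1 (i, l) (j, m) (pb_pt V i p \<xi>) = tr i j p \<xi> $ m / \<xi> $ l"
proof -
  have "(THE z. \<exists>q \<eta>. (i, q, \<eta>) \<in> pb_pt V i p \<xi> \<and> z = (transpose_mat (trans V i j q) *\<^sub>v \<eta>) $ m / \<eta> $ l)
      = tr i j p \<xi> $ m / \<xi> $ l"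
  proof (rule the_equality)
    show "\<exists>q \<eta>. (i, q, \<eta>) \<in> pb_pt V i p \<xi> \<and> tr i j p \<xi> $ m / \<xi> $ l = (transpose_mat (trans V i j q) *\<^sub>v \<eta>) $ m / \<eta> $ l"
      using pb_pt_self[OF assms(1,3,5)] tr_eq[OF assms(1-5)] by metis
    fix z assume "\<exists>q \<eta>. (i, q, \<eta>) \<in> pb_pt V i p \<xi> \<and> z = (transpose_mat (trans V i j q) *\<^sub>v \<eta>) $ m / \<eta> $ l"
    then obtain q \<eta> where z: "(i, q, \<eta>) \<in> pb_pt V i p \<xi>" "z = (transpose_mat (trans V i j q) *\<^sub>v \<eta>) $ m / \<eta> $ l"
      by blast
    then obtain c where c: "q = p" "c \<noteq> 0" "\<eta> = c \<cdot>\<^sub>v \<xi>"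
      using mem_pb_pt[OF assms(1,3,5)] tr_id[OF assms(1,3,5)] by auto
    have "z = tr i j p \<eta> $ m / \<eta> $ l" using z c tr_eq[OF assms(1-4), of \<eta>] assms(5) by simp
    then show "z = tr i j p \<xi> $ m / \<xi> $ l"
      using c tr_smult[OF assms(5)] assms tr_carrier[of i j p \<xi>] by simp
  qed
  then show ?thesis by (simp add: pb_O1_def)
qed

text \<open>Regularity is tested in an arbitrary chart \<open>k\<close>, so the transition functions
  are needed there as well.\<close>

lemma ltrans_O1':
  assumes "k \<in> index V" "i \<in> index V" "j \<in> index V" "p \<in> chart V k" "p \<in> chart V i" "p \<in> chart V j"
    "\<xi> \<in> carrier_vec r" "m < r" "l < r"
  shows "ltrans O1 (i, l) (j, m) (pb_pt V k p \<xi>) = tr k j p \<xi> $ m / tr k i p \<xi> $ l"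
  using ltrans_O1[OF assms(2,3,5,6) tr_carrier[of k i p \<xi>] assms(8,9)] tr_comp[OF assms(1,2,3,4,5,6,7)]
    pb_pt_change[OF assms(1,2,4,5,7)] by simp

lemma line_bundle_O1: "line_bundle PV O1"
  unfolding line_bundle_def
proof (intro conjI ballI)
  fix il assume "il \<in> lindex O1"
  then obtain i l where il: "il = (i, l)" "i \<in> index V" "l < r" by (auto simp: pb_O1_def)
  show "openin (topol PV) (lchart O1 il)" unfolding il
    using openin_pb_basic[OF il(2) chart_open subset_refl coord_form_over[OF chart_open]] il by (simp add: pb_O1_def)
  fix P assume P: "P \<in> lchart O1 il"
  then obtain p \<xi> where "P = pb_pt V i p \<xi>" "p \<in> chart V i" "\<xi> \<in> nonzero_vecs r" "\<xi> $ l \<noteq> 0"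
    unfolding il by (auto simp: pb_O1_def pb_basic_def)
  then show "ltrans O1 il il P = 1" unfolding il using il
    by (simp add: ltrans_O1 nonzero_vecs_def tr_id)
next
  show "(\<Union>il\<in>lindex O1. lchart O1 il) = topspace (topol PV)"
  proof
    show "(\<Union>il\<in>lindex O1. lchart O1 il) \<subseteq> topspace (topol PV)"
      by (auto simp: pb_O1_def pb_basic_def topspace_PV)
    show "topspace (topol PV) \<subseteq> (\<Union>il\<in>lindex O1. lchart O1 il)"
    proof
      fix P assume "P \<in> topspace (topol PV)"
      then obtain i p \<xi> where P: "P = pb_pt V i p \<xi>" "i \<in> index V" "p \<in> chart V i" "\<xi> \<in> nonzero_vecs r"
        by (auto simp: topspace_PV)
      obtain l where "l < r" "\<xi> $ l \<noteq> 0" using nonzero_vecs_coord[OF P(4)] by auto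
      then have "(i, l) \<in> lindex O1" "P \<in> lchart O1 (i, l)"
        using P by (auto simp: pb_O1_def intro!: pb_basicI)
      then show "P \<in> (\<Union>il\<in>lindex O1. lchart O1 il)" by blast
    qed
  qed
next
  fix a b assume "a \<in> lindex O1" "b \<in> lindex O1"
  then obtain i l j m where ab: "a = (i, l)" "b = (j, m)" "i \<in> index V" "j \<in> index V" "l < r" "m < r"
    by (auto simp: pb_O1_def)
  show "ltrans O1 a b \<in> regular PV (lchart O1 a \<inter> lchart O1 b)"
  proof (rule regular_PVI)
    fix k p \<xi> assume k: "k \<in> index V" "p \<in> chart V k" "\<xi> \<in> nonzero_vecs r"
      and P: "pb_pt V k p \<xi> \<in> lchart O1 a \<inter> lchart O1 b"
    have p: "p \<in> chart V i" "p \<in> chart V j" "tr k i p \<xi> $ l \<noteq> 0" "tr k j p \<xi> $ m \<noteq> 0"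
      using P k ab lchart_O1_iff by auto
    let ?U = "chart V k \<inter> chart V i \<inter> chart V j"
    have U: "Op ?U" using chart_open k ab by auto
    \<comment> \<open>Numerator and denominator are expanded by \<open>tr k j p \<xi> $ m\<close>,
      so that the denominator vanishes outside both charts of the line bundle, not just outside the
      first.\<close>
    let ?A = "\<lambda>p \<xi>. tr k j p \<xi> $ m * tr k j p \<xi> $ m" and ?B = "\<lambda>p \<xi>. tr k i p \<xi> $ l * tr k j p \<xi> $ m"
    have 1: "(\<lambda>p \<xi>. tr k i p \<xi> $ l) \<in> form_over (R ?U) r 1" "(\<lambda>p \<xi>. tr k j p \<xi> $ m) \<in> form_over (R ?U) r 1"
      using tr_form_over[OF k(1) ab(3) U _ _ ab(5)] tr_form_over[OF k(1) ab(4) U _ _ ab(6)] by auto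
    have "?A \<in> form_over (R ?U) r (1 + 1)" "?B \<in> form_over (R ?U) r (1 + 1)"
      by (intro form_over_mult fun_ring_R U 1)+
    moreover have "pb_pt V k q \<eta> \<in> lchart O1 a \<inter> lchart O1 b \<and>
        ltrans O1 a b (pb_pt V k q \<eta>) = ?A q \<eta> / ?B q \<eta>"
      if "q \<in> ?U" "\<eta> \<in> nonzero_vecs r" "?B q \<eta> \<noteq> 0" for q \<eta>
      using that k ab ltrans_O1'[OF k(1) ab(3,4) _ _ _ _ ab(6,5), of q \<eta>] lchart_O1_iff
      by (auto simp: nonzero_vecs_def)
    ultimately show "pb_quot (lchart O1 a \<inter> lchart O1 b) (ltrans O1 a b) k p \<xi>"
      using U p k by (intro pb_quotI[of ?U p k ?A _ ?B]) auto
  qed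
  fix c P assume "c \<in> lindex O1" and P: "P \<in> lchart O1 a \<inter> lchart O1 b \<inter> lchart O1 c"
  then obtain k o' where c: "c = (k, o')" "k \<in> index V" "o' < r" by (auto simp: pb_O1_def)
  obtain p \<xi> where \<xi>: "P = pb_pt V i p \<xi>" "p \<in> chart V i" "\<xi> \<in> nonzero_vecs r" "\<xi> $ l \<noteq> 0"
    using P ab by (auto simp: pb_O1_def pb_basic_def)
  have *: "p \<in> chart V j" "p \<in> chart V k" "tr i j p \<xi> $ m \<noteq> 0"
    using P \<xi> c ab lchart_O1_iff by auto
  show "ltrans O1 a b P * ltrans O1 b c P = ltrans O1 a c P"
    unfolding ab c \<xi>(1) using * \<xi> ab c by (simp add: ltrans_O1' nonzero_vecs_def tr_id)
qed

end

section \<open>The pencil attached to a functional\<close>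

text \<open>The bilinear expression xi M(x) as a linear map in x for fixed xi = \<open>y\<close>;
  its kernel is the fibre over \<open>y\<close>.\<close>

definition pencil :: "nat \<Rightarrow> nat \<Rightarrow> nat \<Rightarrow> (nat \<Rightarrow> complex mat) \<Rightarrow> complex vec \<Rightarrow> complex mat" where
  "pencil n t N M y = mat t (Suc n) (\<lambda>(u, l). \<Sum>s<N. y $ s * M l $$ (s, u))"

lemma kills_iff_pencil:
  assumes "x \<in> carrier_vec (Suc n)"
  shows "kills n t N M \<eta> x \<longleftrightarrow> pencil n t N M \<eta> *\<^sub>v x = 0\<^sub>v t"
proof -
  have P: "pencil n t N M \<eta> \<in> carrier_mat t (Suc n)" by (simp add: pencil_def)
  have *: "(pencil n t N M \<eta> *\<^sub>v x) $ u = (\<Sum>l\<le>n. x $ l * (\<Sum>s<N. \<eta> $ s * M l $$ (s, u)))" if "u < t" for u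
    unfolding mult_mat_vec_index[OF that P assms] lessThan_Suc_atMost
    using that by (intro sum.cong refl) (simp add: pencil_def)
  have "pencil n t N M \<eta> *\<^sub>v x = 0\<^sub>v t \<longleftrightarrow> (\<forall>u<t. (pencil n t N M \<eta> *\<^sub>v x) $ u = 0)"
    using P by (auto simp del: index_mult_mat_vec intro!: eq_vecI)
  then show ?thesis using * by (simp add: kills_def)
qed

lemma kills_iff_hom_at:
  assumes "\<eta> \<in> carrier_vec N"
  shows "kills n t N M \<eta> x \<longleftrightarrow> transpose_mat (hom_at n t N M x) *\<^sub>v \<eta> = 0\<^sub>v t"
proof -
  let ?A = "transpose_mat (hom_at n t N M x)"
  have A: "?A \<in> carrier_mat t N" by (simp add: hom_at_def)
  have *: "(?A *\<^sub>v \<eta>) $ u = (\<Sum>l\<le>n. x $ l * (\<Sum>s<N. \<eta> $ s * M l $$ (s, u)))" if "u < t" for u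
  proof -
    have "(?A *\<^sub>v \<eta>) $ u = (\<Sum>s<N. (\<Sum>l\<le>n. x $ l * M l $$ (s, u)) * \<eta> $ s)"
      unfolding mult_mat_vec_index[OF that A assms]
      using that by (intro sum.cong refl) (simp add: hom_at_def)
    also have "\<dots> = (\<Sum>l\<le>n. \<Sum>s<N. x $ l * M l $$ (s, u) * \<eta> $ s)"
      unfolding sum_distrib_right by (rule sum.swap)
    finally show ?thesis by (simp add: sum_distrib_left algebra_simps)
  qed
  have "?A *\<^sub>v \<eta> = 0\<^sub>v t \<longleftrightarrow> (\<forall>u<t. (?A *\<^sub>v \<eta>) $ u = 0)"
    using A by (auto simp del: index_mult_mat_vec intro!: eq_vecI)
  then show ?thesis using * by (simp add: kills_def)
qed

lemma kills_smult:
  assumes "kills n t N M \<eta> x" "x \<in> carrier_vec (Suc n)"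
  shows "kills n t N M \<eta> (c \<cdot>\<^sub>v x)"
  unfolding kills_def
proof (intro allI impI)
  fix u assume "u < t"
  have "(\<Sum>l\<le>n. (c \<cdot>\<^sub>v x) $ l * (\<Sum>s<N. \<eta> $ s * M l $$ (s, u)))
      = c * (\<Sum>l\<le>n. x $ l * (\<Sum>s<N. \<eta> $ s * M l $$ (s, u)))"
    unfolding sum_distrib_left using assms(2) by (intro sum.cong refl) (simp add: mult.assoc sum_distrib_left)
  then show "(\<Sum>l\<le>n. (c \<cdot>\<^sub>v x) $ l * (\<Sum>s<N. \<eta> $ s * M l $$ (s, u))) = 0"
    using assms(1) \<open>u < t\<close> by (simp add: kills_def)
qed

lemma kills_smult_left:
  assumes "kills n t N M \<eta> x" "\<eta> \<in> carrier_vec N"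
  shows "kills n t N M (c \<cdot>\<^sub>v \<eta>) x"
proof -
  have "c \<cdot>\<^sub>v 0\<^sub>v t = (0\<^sub>v t :: complex vec)" by (intro eq_vecI) auto
  then show ?thesis
    using assms mult_mat_vec[of "transpose_mat (hom_at n t N M x)" t N \<eta> c]
    by (simp add: kills_iff_hom_at hom_at_def)
qed

text \<open>Near a point of the cone over the image, the point of projective space that is killed is given by the
  maximal minors of the pencil, after adding a row to the pencil to make it injective.\<close>

lemma local_kernel_section:
  assumes sep: "separating n t N M" and \<eta>0: "\<eta>0 \<in> nonzero_vecs N"
    and x0: "x0 \<in> nonzero_vecs (Suc n)" "kills n t N M \<eta>0 x0"
  shows "\<exists>X \<Delta>. form N (Suc n) \<Delta> \<and> (\<forall>l<Suc n. form N n (\<lambda>y. X y $ l)) \<and> (\<forall>y. X y \<in> carrier_vec (Suc n)) \<and>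
    \<Delta> \<eta>0 \<noteq> 0 \<and> (\<forall>\<eta>\<in>nonzero_vecs N. \<forall>x\<in>nonzero_vecs (Suc n). kills n t N M \<eta> x \<longrightarrow> \<Delta> \<eta> \<noteq> 0 \<longrightarrow>
      X \<eta> \<in> nonzero_vecs (Suc n) \<and> kills n t N M \<eta> (X \<eta>))"
proof -
  obtain a where a: "a < N" "\<eta>0 $ a \<noteq> 0" using nonzero_vecs_coord[OF \<eta>0] by auto
  obtain i where i: "i < Suc n" "x0 $ i \<noteq> 0" using nonzero_vecs_coord[OF x0(1)] by auto
  \<comment> \<open>Row 0 is the added row. Its only entry is \<open>y $ a\<close> and not the
    constant 1, which makes all entries of \<open>A y\<close> linear forms in
    \<open>y\<close>.\<close>
  define A where "A y = mat (Suc t) (Suc n) (\<lambda>(u, l). case u of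
      0 \<Rightarrow> if l = i then y $ a else 0 | Suc v \<Rightarrow> \<Sum>s<N. y $ s * M l $$ (s, v))" for y
  have A: "A y \<in> carrier_mat (Suc t) (Suc n)" for y by (simp add: A_def)
  have A0: "(A y *\<^sub>v x) $ 0 = y $ a * x $ i" if "x \<in> carrier_vec (Suc n)" for y x
  proof -
    have "(A y *\<^sub>v x) $ 0 = (\<Sum>l<Suc n. A y $$ (0, l) * x $ l)"
      using A that by (intro mult_mat_vec_index) auto
    also have "\<dots> = (\<Sum>l<Suc n. if l = i then y $ a * x $ i else 0)"
      by (intro sum.cong refl) (auto simp: A_def)
    finally show ?thesis using i by simp
  qed
  have AS: "(A y *\<^sub>v x) $ Suc v = (pencil n t N M y *\<^sub>v x) $ v" if "x \<in> carrier_vec (Suc n)" "v < t" for y x v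
  proof -
    have P: "pencil n t N M y \<in> carrier_mat t (Suc n)" by (simp add: pencil_def)
    have "(A y *\<^sub>v x) $ Suc v = (\<Sum>l<Suc n. A y $$ (Suc v, l) * x $ l)"
      using that by (intro mult_mat_vec_index[OF _ A]) auto
    also have "\<dots> = (\<Sum>l<Suc n. pencil n t N M y $$ (v, l) * x $ l)"
      using that by (intro sum.cong refl) (auto simp: A_def pencil_def)
    finally show ?thesis using mult_mat_vec_index[OF that(2) P that(1)] by simp
  qed
  \<comment> \<open>By \<open>sep\<close> the kernel of the pencil at \<open>\<eta>0\<close> is
    spanned by \<open>x0\<close>, and \<open>x0 $ i \<noteq> 0\<close> rules this line out.\<close>
  have "\<exists>B\<in>carrier_mat (Suc n) (Suc t). B * A \<eta>0 = 1\<^sub>m (Suc n)"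
  proof (rule injective_left_inverse[OF A])
    fix x assume x: "x \<in> carrier_vec (Suc n)" and Ax: "A \<eta>0 *\<^sub>v x = 0\<^sub>v (Suc t)"
    have "x $ i = 0" using A0[OF x, of \<eta>0] a Ax by simp
    moreover have "pencil n t N M \<eta>0 *\<^sub>v x = 0\<^sub>v t"
      by (rule eq_vecI) (use AS[OF x, of _ \<eta>0] Ax in \<open>auto simp: pencil_def simp del: index_mult_mat_vec\<close>)
    then have "kills n t N M \<eta>0 x" using kills_iff_pencil[OF x] by blast
    ultimately show "x = 0\<^sub>v (Suc n)"
    proof -
      assume k: "x $ i = 0" "kills n t N M \<eta>0 x"
      show ?thesis
      proof (rule ccontr)
        assume "x \<noteq> 0\<^sub>v (Suc n)"
        then have "x \<in> nonzero_vecs (Suc n)" using x by (simp add: nonzero_vecs_def)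
        then have "ray x = ray x0" using sep \<eta>0 x0 k(2) unfolding separating_def by blast
        then obtain c where "c \<noteq> 0" "x = c \<cdot>\<^sub>v x0" using ray_eqD by blast
        then show False using k(1) i x0 by (auto simp: nonzero_vecs_def)
      qed
    qed
  qed
  then obtain B where B: "B \<in> carrier_mat (Suc n) (Suc t)" "B * A \<eta>0 = 1\<^sub>m (Suc n)" by blast
  \<comment> \<open>\<open>B\<close> is constant, so \<open>D y\<close> is square with linear
    entries; it is the identity at \<open>\<eta>0\<close>.\<close>
  define D where "D y = mat (Suc n) (Suc n) (\<lambda>(j, l). \<Sum>k<Suc t. B $$ (j, k) * A y $$ (k, l))" for y
  have D: "D y \<in> carrier_mat (Suc n) (Suc n)" for y by (simp add: D_def)
  have D_eq: "D y = B * A y" for y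
    using B A[of y] by (intro eq_matI) (auto simp: D_def scalar_prod_def lessThan_atLeast0)
  \<comment> \<open>Cramer's rule: a killed \<open>x\<close> satisfies
    \<open>A y *\<^sub>v x = c \<cdot>\<^sub>v unit_vec (Suc t) 0\<close> for some \<open>c\<close>,
    hence \<open>D y *\<^sub>v x = c \<cdot>\<^sub>v col B 0\<close>, and the adjugate solves this
    up to a scalar.\<close>
  define X where "X y = vec (Suc n) (\<lambda>l. \<Sum>k<Suc n. adj_mat (D y) $$ (l, k) * B $$ (k, 0))" for y
  have N0: "0 < N" using a by simp
  have Dform: "form N 1 (\<lambda>y. D y $$ (j, l))" if "j < Suc n" "l < Suc n" for j l
  proof -
    have "form N 1 (\<lambda>y. A y $$ (k, l))" if k: "k < Suc t" for k
    proof (cases k)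
      case 0
      then show ?thesis using form_zero[OF N0, of 1] form_coord[OF a(1)] \<open>l < Suc n\<close>
        by (cases "l = i") (auto simp: A_def)
    next
      case (Suc v)
      have "form N 1 (\<lambda>y. \<Sum>s<N. M l $$ (s, v) * y $ s)"
        by (intro form_sum N0 form_smult form_coord) auto
      then show ?thesis using Suc k \<open>l < Suc n\<close> by (simp add: A_def mult.commute)
    qed
    then have "form N 1 (\<lambda>y. \<Sum>k<Suc t. B $$ (j, k) * A y $$ (k, l))"
      by (intro form_sum N0 form_smult) auto
    then show ?thesis using that by (simp add: D_def)
  qed
  have "form N (\<Sum>j<Suc n. 1) (\<lambda>y. det (D y))" by (rule form_det[OF N0 D Dform])
  then have F1: "form N (Suc n) (\<lambda>y. det (D y))" by simp
  have F2: "form N n (\<lambda>y. X y $ l)" if l: "l < Suc n" for l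
  proof -
    have "form N n (\<lambda>y. adj_mat (D y) $$ (l, k))" if "k < Suc n" for k
      using form_adj[OF N0 D Dform l that] l by simp
    then have "form N n (\<lambda>y. \<Sum>k<Suc n. B $$ (k, 0) * adj_mat (D y) $$ (l, k))"
      by (intro form_sum N0 form_smult) auto
    then show ?thesis using l by (simp add: X_def mult.commute)
  qed
  have cB: "col B 0 \<in> carrier_vec (Suc n)" using col_dim[of B 0] B(1) by simp
  have X: "X y = adj_mat (D y) *\<^sub>v col B 0" for y
  proof -
    show ?thesis
    proof (rule eq_vecI)
      fix l assume "l < dim_vec (adj_mat (D y) *\<^sub>v col B 0)"
      then have l: "l < Suc n" using adj_mat(1)[OF D, of y] by simp
      show "X y $ l = (adj_mat (D y) *\<^sub>v col B 0) $ l"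
        unfolding mult_mat_vec_index[OF l adj_mat(1)[OF D] cB]
        using l B(1) by (simp add: X_def del: sum.lessThan_Suc)
    qed (use adj_mat(1)[OF D, of y] in \<open>simp add: X_def\<close>)
  qed
  have F3: "X \<eta> \<in> nonzero_vecs (Suc n) \<and> kills n t N M \<eta> (X \<eta>)"
    if \<eta>: "\<eta> \<in> nonzero_vecs N" and x: "x \<in> nonzero_vecs (Suc n)" "kills n t N M \<eta> x" and d: "det (D \<eta>) \<noteq> 0" for \<eta> x
  proof -
    have xc: "x \<in> carrier_vec (Suc n)" using x by (simp add: nonzero_vecs_def)
    have Px: "pencil n t N M \<eta> *\<^sub>v x = 0\<^sub>v t" using kills_iff_pencil[OF xc] x by blast
    let ?c = "\<eta> $ a * x $ i"
    have Axe: "A \<eta> *\<^sub>v x = ?c \<cdot>\<^sub>v unit_vec (Suc t) 0"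
    proof (rule eq_vecI)
      fix u assume "u < dim_vec (?c \<cdot>\<^sub>v unit_vec (Suc t) 0)"
      then show "(A \<eta> *\<^sub>v x) $ u = (?c \<cdot>\<^sub>v unit_vec (Suc t) 0) $ u"
        using A0[OF xc, of \<eta>] AS[OF xc, of _ \<eta>] Px by (cases u) (auto simp del: index_mult_mat_vec)
    qed (use A in auto)
    have "D \<eta> *\<^sub>v x = B *\<^sub>v (A \<eta> *\<^sub>v x)" unfolding D_eq by (rule assoc_mult_mat_vec[OF B(1) A xc])
    also have "\<dots> = ?c \<cdot>\<^sub>v (B *\<^sub>v unit_vec (Suc t) 0)"
      unfolding Axe by (rule mult_mat_vec[OF B(1)]) simp
    also have "B *\<^sub>v unit_vec (Suc t) 0 = col B 0" using B(1) by (intro eq_vecI) auto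
    finally have Dx: "D \<eta> *\<^sub>v x = ?c \<cdot>\<^sub>v col B 0" .
    have "det (D \<eta>) \<cdot>\<^sub>v x = (det (D \<eta>) \<cdot>\<^sub>m 1\<^sub>m (Suc n)) *\<^sub>v x" using xc by (intro eq_vecI) auto
    also have "\<dots> = adj_mat (D \<eta>) *\<^sub>v (D \<eta> *\<^sub>v x)"
      using assoc_mult_mat_vec[OF adj_mat(1)[OF D] D xc] adj_mat(3)[OF D] by metis
    also have "\<dots> = ?c \<cdot>\<^sub>v X \<eta>"
      unfolding Dx X by (rule mult_mat_vec[OF adj_mat(1)[OF D] cB])
    finally have e: "det (D \<eta>) \<cdot>\<^sub>v x = ?c \<cdot>\<^sub>v X \<eta>" .
    have Xc: "X \<eta> \<in> carrier_vec (Suc n)" by (simp add: X_def)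
    \<comment> \<open>If \<open>\<eta> $ a\<close> or \<open>x $ i\<close> vanished, the nonzero
      determinant would force \<open>x\<close> to be zero.\<close>
    have "?c \<noteq> 0"
    proof
      assume "?c = 0"
      then have "det (D \<eta>) \<cdot>\<^sub>v x = 0 \<cdot>\<^sub>v X \<eta>" using e by (simp only:)
      then have "det (D \<eta>) \<cdot>\<^sub>v x = 0\<^sub>v (Suc n)" using Xc by (auto intro!: eq_vecI)
      then show False using smult_nonzero_vecs[OF d x(1)] by (simp add: nonzero_vecs_def)
    qed
    then have "X \<eta> = (1 / ?c) \<cdot>\<^sub>v (?c \<cdot>\<^sub>v X \<eta>)" by (simp add: smult_smult_assoc)
    then have "X \<eta> = (1 / ?c) \<cdot>\<^sub>v (det (D \<eta>) \<cdot>\<^sub>v x)" unfolding e .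
    then have Xe: "X \<eta> = (det (D \<eta>) / ?c) \<cdot>\<^sub>v x" by (simp add: smult_smult_assoc)
    show ?thesis unfolding Xe using \<open>?c \<noteq> 0\<close> d
      by (intro conjI smult_nonzero_vecs kills_smult x xc) auto
  qed
  have "det (D \<eta>0) = 1" unfolding D_eq B(2) by simp
  then show ?thesis using F1 F2 F3
    by (intro exI[of _ X] exI[of _ "\<lambda>y. det (D y)"]) (auto simp: X_def)
qed

text \<open>If \<open>\<eta>\<close> kills no point, its pencil has a left inverse \<open>B\<close>.
  The determinant of \<open>B\<close> times the pencil of \<open>y\<close> is a form in
  \<open>y\<close> that equals 1 at \<open>\<eta>\<close> and vanishes whenever the pencil of
  \<open>y\<close> has a kernel.\<close>

lemma image_locus_closed:
  assumes \<eta>: "\<eta> \<in> nonzero_vecs N" and no: "\<And>x. x \<in> nonzero_vecs (Suc n) \<Longrightarrow> \<not> kills n t N M \<eta> x"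
  shows "\<exists>d f. form N d f \<and> f \<eta> \<noteq> 0 \<and> (\<forall>y. \<forall>x\<in>nonzero_vecs (Suc n). kills n t N M y x \<longrightarrow> f y = 0)"
proof -
  let ?P = "pencil n t N M"
  have N0: "0 < N" using nonzero_vecs_coord[OF \<eta>] by auto
  have P: "?P y \<in> carrier_mat t (Suc n)" for y by (simp add: pencil_def)
  obtain B where B: "B \<in> carrier_mat (Suc n) t" "B * ?P \<eta> = 1\<^sub>m (Suc n)"
    using injective_left_inverse[OF P, of \<eta>] no kills_iff_pencil by (fastforce simp: nonzero_vecs_def)
  define D where "D y = mat (Suc n) (Suc n) (\<lambda>(j, l). \<Sum>k<t. B $$ (j, k) * ?P y $$ (k, l))" for y
  have D: "D y \<in> carrier_mat (Suc n) (Suc n)" for y by (simp add: D_def)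
  have D_eq: "D y = B * ?P y" for y
    using B P[of y] by (intro eq_matI) (auto simp: D_def scalar_prod_def lessThan_atLeast0)
  have Dform: "form N 1 (\<lambda>y. D y $$ (j, l))" if "j < Suc n" "l < Suc n" for j l
  proof -
    have "form N 1 (\<lambda>y. ?P y $$ (v, l))" if v: "v < t" for v
    proof -
      have "form N 1 (\<lambda>y. \<Sum>s<N. M l $$ (s, v) * y $ s)"
        by (intro form_sum N0 form_smult form_coord) auto
      then show ?thesis using v \<open>l < Suc n\<close> by (simp add: pencil_def mult.commute)
    qed
    then have "form N 1 (\<lambda>y. \<Sum>k<t. B $$ (j, k) * ?P y $$ (k, l))"
      by (intro form_sum N0 form_smult) auto
    then show ?thesis using that by (simp add: D_def)
  qed
  have "form N (\<Sum>j<Suc n. 1) (\<lambda>y. det (D y))" by (rule form_det[OF N0 D Dform])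
  moreover have "det (D \<eta>) \<noteq> 0" unfolding D_eq B(2) by simp
  moreover have "det (D y) = 0" if x: "x \<in> nonzero_vecs (Suc n)" and k: "kills n t N M y x" for x y
  proof -
    have xc: "x \<in> carrier_vec (Suc n)" using x by (simp add: nonzero_vecs_def)
    have "D y *\<^sub>v x = B *\<^sub>v (?P y *\<^sub>v x)" unfolding D_eq by (rule assoc_mult_mat_vec[OF B(1) P xc])
    also have "?P y *\<^sub>v x = 0\<^sub>v t" using kills_iff_pencil[OF xc] k by blast
    finally have "D y *\<^sub>v x = 0\<^sub>v (Suc n)" using B(1) by (auto intro!: eq_vecI)
    then show ?thesis using det_0_iff_vec_prod_zero[OF D] x by (auto simp: nonzero_vecs_def)
  qed
  ultimately show ?thesis by blast
qed

section \<open>The closed immersion defined by the universal quotient\<close>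

text \<open>\<open>m\<close> is the dimension of the target projective space, whose coordinate
  vectors have \<open>Suc m = N\<close> entries.\<close>

locale presented = vbundle_on_proj n V for n :: nat and V :: "('i, pt) vbundle" +
  fixes t m N :: nat and M :: "nat \<Rightarrow> complex mat" and q :: "'i \<Rightarrow> pt \<Rightarrow> complex mat"
  assumes pres: "presentation n t N M V q" and sep: "separating n t N M" and N_eq: "N = Suc m"
begin

lemma q_regular_mat: "i \<in> index V \<Longrightarrow> regular_mat (proj_space n) (chart V i) r N (q i)"
  using pres unfolding presentation_def by blast

lemma q_carrier: "i \<in> index V \<Longrightarrow> p \<in> chart V i \<Longrightarrow> q i p \<in> carrier_mat r N"
  using q_regular_mat[of i] by (simp add: regular_mat_def)

lemma q_regular: "i \<in> index V \<Longrightarrow> k < r \<Longrightarrow> s < N \<Longrightarrow> (\<lambda>p. q i p $$ (k, s)) \<in> R (chart V i)"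
  using q_regular_mat[of i] by (simp add: regular_mat_def)

lemma q_trans: "i \<in> index V \<Longrightarrow> j \<in> index V \<Longrightarrow> p \<in> chart V i \<Longrightarrow> p \<in> chart V j \<Longrightarrow> q i p = trans V i j p * q j p"
  using pres unfolding presentation_def by blast

lemma q_exact:
  assumes "i \<in> index V" "x \<in> nonzero_vecs (Suc n)" "ray x \<in> chart V i"
  shows "(\<lambda>c. hom_at n t N M x *\<^sub>v c) ` carrier_vec t = mat_kernel (q i (ray x))"
    "(\<lambda>v. q i (ray x) *\<^sub>v v) ` carrier_vec N = carrier_vec r"
  using pres assms unfolding presentation_def by blast+

section \<open>Functionals on the fibres as functionals on the trivial bundle\<close>

text \<open>The composition of the functional \<open>\<xi>\<close> on the fibre with the quotient
  map. It is a sum over indices for the same reason as \<open>tr\<close>.\<close>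

definition row :: "'i \<Rightarrow> pt \<Rightarrow> complex vec \<Rightarrow> complex vec" where
  "row i p \<xi> = vec N (\<lambda>s. \<Sum>k<r. q i p $$ (k, s) * \<xi> $ k)"

lemma row_carrier: "row i p \<xi> \<in> carrier_vec N"
  by (simp add: row_def)

lemma row_eq:
  assumes "i \<in> index V" "p \<in> chart V i" "\<xi> \<in> carrier_vec r"
  shows "transpose_mat (q i p) *\<^sub>v \<xi> = row i p \<xi>"
  using q_carrier[OF assms(1,2)] assms(3)
  by (intro eq_vecI) (auto simp: row_def scalar_prod_def lessThan_atLeast0)

lemma row_smult: "\<xi> \<in> carrier_vec r \<Longrightarrow> row i p (c \<cdot>\<^sub>v \<xi>) = c \<cdot>\<^sub>v row i p \<xi>"
  by (intro eq_vecI) (auto simp: row_def sum_distrib_left algebra_simps)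

lemma row_tr:
  assumes "i \<in> index V" "j \<in> index V" "p \<in> chart V i" "p \<in> chart V j" "\<xi> \<in> carrier_vec r"
  shows "row j p (tr i j p \<xi>) = row i p \<xi>"
proof -
  have c: "trans V i j p \<in> carrier_mat r r" "q j p \<in> carrier_mat r N"
    using assms by (auto intro: trans_carrier q_carrier)
  have "row j p (tr i j p \<xi>) = transpose_mat (q j p) *\<^sub>v (transpose_mat (trans V i j p) *\<^sub>v \<xi>)"
    using row_eq[OF assms(2,4) tr_carrier] tr_eq[OF assms] by simp
  also have "\<dots> = (transpose_mat (q j p) * transpose_mat (trans V i j p)) *\<^sub>v \<xi>"
    using c assms(5) by (intro assoc_mult_mat_vec[symmetric]) auto
  also have "\<dots> = transpose_mat (q i p) *\<^sub>v \<xi>"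
    using transpose_mult[OF c] q_trans[OF assms(1-4)] by simp
  finally show ?thesis using row_eq[OF assms(1,3,5)] by simp
qed

lemma row_form_over:
  assumes "i \<in> index V" "Op U" "U \<subseteq> chart V i" "s < N"
  shows "(\<lambda>p \<xi>. row i p \<xi> $ s) \<in> form_over (R U) r 1"
proof -
  have "(\<lambda>p \<xi>. \<Sum>k\<in>{..<r}. q i p $$ (k, s) * \<xi> $ k) \<in> form_over (R U) r 1"
  proof (rule form_over_finite)
    fix k assume k: "k \<in> {..<r}"
    show "(\<lambda>p. q i p $$ (k, s)) \<in> R U"
      by (rule regular_proj_restrict[OF q_regular[of i k s]]) (use assms k in auto)
    show "form r 1 (\<lambda>\<xi>. \<xi> $ k)" using k by (intro form_coord) auto
  qed simp
  then show ?thesis using assms(4) by (simp add: row_def)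
qed

lemma q_section:
  assumes "i \<in> index V" "p \<in> chart V i"
  shows "\<exists>E\<in>carrier_mat N r. q i p * E = 1\<^sub>m r"
proof -
  obtain x where x: "x \<in> nonzero_vecs (Suc n)" "p = ray x" using chart_ray[OF assms] by auto
  then show ?thesis using surjective_right_inverse[OF q_carrier[OF assms]] q_exact(2)[of i x] assms by simp
qed

lemma row_recover:
  assumes "i \<in> index V" "p \<in> chart V i" "E \<in> carrier_mat N r" "q i p * E = 1\<^sub>m r" "\<xi> \<in> carrier_vec r"
  shows "transpose_mat E *\<^sub>v row i p \<xi> = \<xi>"
proof -
  note c = q_carrier[OF assms(1,2)]
  have "transpose_mat E *\<^sub>v row i p \<xi> = transpose_mat E *\<^sub>v (transpose_mat (q i p) *\<^sub>v \<xi>)"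
    using row_eq assms by simp
  also have "\<dots> = (transpose_mat E * transpose_mat (q i p)) *\<^sub>v \<xi>"
    using c assms by (intro assoc_mult_mat_vec[symmetric]) auto
  also have "\<dots> = \<xi>" unfolding transpose_mult[OF c assms(3), symmetric] assms(4) using assms(5) by simp
  finally show ?thesis .
qed

lemma row_inj:
  assumes "i \<in> index V" "p \<in> chart V i" "\<xi> \<in> carrier_vec r" "\<zeta> \<in> carrier_vec r" "row i p \<xi> = row i p \<zeta>"
  shows "\<xi> = \<zeta>"
  using q_section[OF assms(1,2)] row_recover[OF assms(1,2)] assms(3-5) by metis

lemma row_nonzero:
  assumes "i \<in> index V" "p \<in> chart V i" "\<xi> \<in> nonzero_vecs r"
  shows "row i p \<xi> \<in> nonzero_vecs N"
proof -
  have "row i p (0\<^sub>v r) = 0\<^sub>v N" by (intro eq_vecI) (auto simp: row_def)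
  then have "row i p \<xi> \<noteq> 0\<^sub>v N" using row_inj[OF assms(1,2), of \<xi> "0\<^sub>v r"] assms(3) by (auto simp: nonzero_vecs_def)
  then show ?thesis using row_carrier by (simp add: nonzero_vecs_def)
qed

lemma row_kills:
  assumes "i \<in> index V" "x \<in> nonzero_vecs (Suc n)" "ray x \<in> chart V i" "\<xi> \<in> carrier_vec r"
  shows "kills n t N M (row i (ray x) \<xi>) x"
proof -
  let ?H = "hom_at n t N M x" and ?q = "q i (ray x)"
  have H: "?H \<in> carrier_mat N t" by (rule hom_at_carrier)
  note c = q_carrier[OF assms(1,3)]
  have "?q * ?H = 0\<^sub>m r t"
  proof (rule eq_matI)
    fix k u assume ku: "k < dim_row (0\<^sub>m r t)" "u < dim_col (0\<^sub>m r t)"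
    have "?H *\<^sub>v unit_vec t u \<in> mat_kernel ?q"
      using q_exact(1)[OF assms(1-3)] unit_vec_carrier by blast
    then have "?q *\<^sub>v (?H *\<^sub>v unit_vec t u) = 0\<^sub>v r" using mat_kernelD[OF c] by blast
    moreover have "?H *\<^sub>v unit_vec t u = col ?H u" using H ku by (intro eq_vecI) auto
    ultimately have "(?q *\<^sub>v col ?H u) $ k = 0" using ku by simp
    then show "(?q * ?H) $$ (k, u) = 0\<^sub>m r t $$ (k, u)" using ku c H by simp
  qed (use c H in auto)
  then have "transpose_mat ?H * transpose_mat ?q = 0\<^sub>m t r"
    using transpose_mult[OF c H] by simp
  moreover have "transpose_mat ?H *\<^sub>v (transpose_mat ?q *\<^sub>v \<xi>) = (transpose_mat ?H * transpose_mat ?q) *\<^sub>v \<xi>"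
    using c H assms(4) by (intro assoc_mult_mat_vec[symmetric]) auto
  ultimately have "transpose_mat ?H *\<^sub>v row i (ray x) \<xi> = 0\<^sub>v t"
    using row_eq[OF assms(1,3,4)] assms(4) by (auto intro!: eq_vecI)
  then show ?thesis using kills_iff_hom_at[OF row_carrier] by blast
qed

text \<open>A functional that vanishes on the image of M(x) factors through the quotient: with a
  right inverse \<open>E\<close> of \<open>q\<close>, the vector v - E q v lies in the kernel of
  \<open>q\<close>, which is that image, so \<open>\<eta>\<close> takes equal values at v and at E q
  v.\<close>

lemma kills_imp_row:
  assumes "i \<in> index V" "x \<in> nonzero_vecs (Suc n)" "ray x \<in> chart V i" "\<eta> \<in> carrier_vec N"
    and k: "kills n t N M \<eta> x"
  shows "\<exists>\<xi>\<in>carrier_vec r. \<eta> = row i (ray x) \<xi>"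
proof -
  let ?H = "hom_at n t N M x" and ?q = "q i (ray x)"
  have H: "?H \<in> carrier_mat N t" by (rule hom_at_carrier)
  note c = q_carrier[OF assms(1,3)]
  obtain E where E: "E \<in> carrier_mat N r" "?q * E = 1\<^sub>m r" using q_section[OF assms(1,3)] by auto
  let ?\<xi> = "transpose_mat E *\<^sub>v \<eta>"
  have \<xi>: "?\<xi> \<in> carrier_vec r"
    using E(1) assms(4) mult_mat_vec_carrier[of "transpose_mat E" r N \<eta>] by simp
  have eqs: "\<eta> \<bullet> v = row i (ray x) ?\<xi> \<bullet> v" if v: "v \<in> carrier_vec N" for v
  proof -
    have qv: "?q *\<^sub>v v \<in> carrier_vec r" by (rule mult_mat_vec_carrier[OF c v])
    have Eqv: "E *\<^sub>v (?q *\<^sub>v v) \<in> carrier_vec N" by (rule mult_mat_vec_carrier[OF E(1) qv])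
    have "?q *\<^sub>v (v - E *\<^sub>v (?q *\<^sub>v v)) = ?q *\<^sub>v v - ?q *\<^sub>v (E *\<^sub>v (?q *\<^sub>v v))"
      by (rule mult_minus_distrib_mat_vec[OF c v Eqv])
    also have "?q *\<^sub>v (E *\<^sub>v (?q *\<^sub>v v)) = ?q *\<^sub>v v"
      using assoc_mult_mat_vec[OF c E(1) qv] E(2) qv by simp
    finally have "v - E *\<^sub>v (?q *\<^sub>v v) \<in> mat_kernel ?q"
      using c v Eqv qv by (intro mat_kernelI[OF c]) auto
    then obtain d where d: "d \<in> carrier_vec t" "v - E *\<^sub>v (?q *\<^sub>v v) = ?H *\<^sub>v d"
      using q_exact(1)[OF assms(1-3)] by (metis imageE)
    have "\<eta> \<bullet> (?H *\<^sub>v d) = (transpose_mat ?H *\<^sub>v \<eta>) \<bullet> d"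
      using transpose_vec_mult_scalar[OF H d(1) assms(4)] by simp
    also have "\<dots> = 0" using kills_iff_hom_at[OF assms(4)] k d(1) by simp
    finally have "\<eta> \<bullet> v = \<eta> \<bullet> (E *\<^sub>v (?q *\<^sub>v v))"
      using scalar_prod_minus_distrib[OF assms(4) v Eqv] d(2) by simp
    also have "\<dots> = ?\<xi> \<bullet> (?q *\<^sub>v v)"
      using transpose_vec_mult_scalar[OF E(1) qv assms(4)] by simp
    also have "\<dots> = row i (ray x) ?\<xi> \<bullet> v"
      using transpose_vec_mult_scalar[OF c v \<xi>] row_eq[OF assms(1,3) \<xi>] by simp
    finally show ?thesis .
  qed
  have "\<eta> $ s = row i (ray x) ?\<xi> $ s" if "s < N" for s
    using eqs[OF unit_vec_carrier[of N s]] unfolding scalar_prod_right_unit[OF that] .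
  then have "\<eta> = row i (ray x) ?\<xi>" using assms(4) row_carrier[of i "ray x" ?\<xi>]
    by (intro eq_vecI) auto
  then show ?thesis using \<xi> by blast
qed

section \<open>The map to projective space and its image\<close>

definition emb :: "('i \<times> pt \<times> complex vec) set \<Rightarrow> pt" where
  "emb P = (THE z. \<exists>i p \<xi>. (i, p, \<xi>) \<in> P \<and> z = ray (row i p \<xi>))"

lemma emb_pb_pt:
  assumes "i \<in> index V" "p \<in> chart V i" "\<xi> \<in> carrier_vec r"
  shows "emb (pb_pt V i p \<xi>) = ray (row i p \<xi>)"
  unfolding emb_def
proof (rule the_equality)
  show "\<exists>j p' \<eta>. (j, p', \<eta>) \<in> pb_pt V i p \<xi> \<and> ray (row i p \<xi>) = ray (row j p' \<eta>)"
    using pb_pt_self[OF assms] by blast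
  fix z assume "\<exists>j p' \<eta>. (j, p', \<eta>) \<in> pb_pt V i p \<xi> \<and> z = ray (row j p' \<eta>)"
  then obtain j \<eta> c where *: "j \<in> index V" "p \<in> chart V j" "c \<noteq> 0" "\<eta> = c \<cdot>\<^sub>v tr i j p \<xi>" "z = ray (row j p \<eta>)"
    using mem_pb_pt[OF assms] by auto
  then show "z = ray (row i p \<xi>)"
    using row_smult[OF tr_carrier] row_tr[OF assms(1) *(1) assms(2) *(2) assms(3)] ray_smult by simp
qed

text \<open>The affine cone over the image without its vertex, described by \<open>M\<close> without
  reference to \<open>V\<close>.\<close>

definition cone :: "complex vec set" where
  "cone = {\<eta> \<in> nonzero_vecs N. \<exists>x\<in>nonzero_vecs (Suc n). kills n t N M \<eta> x}"

definition locus :: "pt set" where "locus = ray ` cone"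

lemma cone_pt:
  assumes "\<eta> \<in> nonzero_vecs N" "x \<in> nonzero_vecs (Suc n)" "kills n t N M \<eta> x" "i \<in> index V" "ray x \<in> chart V i"
  shows "\<exists>\<xi>\<in>nonzero_vecs r. \<eta> = row i (ray x) \<xi>"
proof -
  obtain \<xi> where \<xi>: "\<xi> \<in> carrier_vec r" "\<eta> = row i (ray x) \<xi>"
    using kills_imp_row[OF assms(4,2,5) _ assms(3)] assms(1) by (auto simp: nonzero_vecs_def)
  have "row i (ray x) (0\<^sub>v r) = 0\<^sub>v N" by (intro eq_vecI) (auto simp: row_def)
  then have "\<xi> \<noteq> 0\<^sub>v r" using \<xi> assms(1) by (auto simp: nonzero_vecs_def)
  then show ?thesis using \<xi> by (auto simp: nonzero_vecs_def)
qed

lemma row_cone: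
  assumes "i \<in> index V" "p \<in> chart V i" "\<xi> \<in> nonzero_vecs r"
  shows "row i p \<xi> \<in> cone"
proof -
  obtain x where x: "x \<in> nonzero_vecs (Suc n)" "p = ray x" using chart_ray[OF assms(1,2)] by auto
  then show ?thesis using row_nonzero[OF assms] row_kills[of i x \<xi>] assms
    by (auto simp: cone_def nonzero_vecs_def)
qed

lemma emb_image: "emb ` topspace (topol PV) = locus"
proof
  show "emb ` topspace (topol PV) \<subseteq> locus"
    using emb_pb_pt row_cone by (auto simp: topspace_PV locus_def nonzero_vecs_def)
  show "locus \<subseteq> emb ` topspace (topol PV)"
  proof
    fix z assume "z \<in> locus"
    then obtain \<eta> x where *: "z = ray \<eta>" "\<eta> \<in> nonzero_vecs N" "x \<in> nonzero_vecs (Suc n)" "kills n t N M \<eta> x"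
      by (auto simp: locus_def cone_def)
    obtain i where i: "i \<in> index V" "ray x \<in> chart V i" using chart_cover[OF *(3)] by auto
    obtain \<xi> where \<xi>: "\<xi> \<in> nonzero_vecs r" "\<eta> = row i (ray x) \<xi>" using cone_pt[OF *(2-4) i] by auto
    have "pb_pt V i (ray x) \<xi> \<in> topspace (topol PV)" using i \<xi> by (auto simp: topspace_PV)
    moreover have "emb (pb_pt V i (ray x) \<xi>) = z" using emb_pb_pt[OF i] \<xi> * by (simp add: nonzero_vecs_def)
    ultimately show "z \<in> emb ` topspace (topol PV)" by blast
  qed
qed

text \<open>Proportional functionals kill the same points, so \<open>sep\<close> yields equal base
  points; over one base point, \<open>row\<close> is injective because \<open>q\<close> is
  surjective.\<close>

lemma emb_inj: "inj_on emb (topspace (topol PV))"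
proof (rule inj_onI)
  fix P Q assume "P \<in> topspace (topol PV)" "Q \<in> topspace (topol PV)" and eq: "emb P = emb Q"
  then obtain i p \<xi> j p' \<zeta> where
    P: "P = pb_pt V i p \<xi>" "i \<in> index V" "p \<in> chart V i" "\<xi> \<in> nonzero_vecs r" and
    Q: "Q = pb_pt V j p' \<zeta>" "j \<in> index V" "p' \<in> chart V j" "\<zeta> \<in> nonzero_vecs r"
    unfolding topspace_PV by blast
  have car: "\<xi> \<in> carrier_vec r" "\<zeta> \<in> carrier_vec r" using P Q by (auto simp: nonzero_vecs_def)
  obtain x where x: "x \<in> nonzero_vecs (Suc n)" "p = ray x" using chart_ray[OF P(2,3)] by auto
  obtain y where y: "y \<in> nonzero_vecs (Suc n)" "p' = ray y" using chart_ray[OF Q(2,3)] by auto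
  have "ray (row i p \<xi>) = ray (row j p' \<zeta>)"
    using eq P Q emb_pb_pt car by simp
  then obtain c where c: "c \<noteq> 0" "row i p \<xi> = c \<cdot>\<^sub>v row j p' \<zeta>" using ray_eqD by blast
  have kx: "kills n t N M (row i p \<xi>) x" using row_kills[of i x \<xi>] P x car by simp
  have "kills n t N M (row j p' \<zeta>) y" using row_kills[of j y \<zeta>] Q y car by simp
  then have ky: "kills n t N M (row i p \<xi>) y" unfolding c(2) by (rule kills_smult_left[OF _ row_carrier])
  have pp: "p' = p" using sep row_nonzero[OF P(2-4)] x y kx ky unfolding separating_def by blast
  let ?\<zeta> = "tr j i p \<zeta>"
  have "row i p \<xi> = row i p (c \<cdot>\<^sub>v ?\<zeta>)"
    using c row_smult[OF tr_carrier] row_tr[of j i p \<zeta>] P Q pp car by simp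
  then have "\<xi> = c \<cdot>\<^sub>v ?\<zeta>" using row_inj[OF P(2,3) car(1)] tr_carrier by simp
  then show "P = Q" using P Q pp c car pb_pt_smult[OF P(2,3) tr_carrier c(1)] pb_pt_change[of j i p \<zeta>] by simp
qed

definition emb_inv :: "pt \<Rightarrow> ('i \<times> pt \<times> complex vec) set" where
  "emb_inv = inv_into (topspace (topol PV)) emb"

lemma emb_inv_emb: "P \<in> topspace (topol PV) \<Longrightarrow> emb_inv (emb P) = P"
  unfolding emb_inv_def by (rule inv_into_f_f[OF emb_inj])

lemma emb_emb_inv: "z \<in> locus \<Longrightarrow> emb (emb_inv z) = z"
  unfolding emb_inv_def using emb_image by (intro f_inv_into_f) simp

lemma emb_inv_row:
  assumes "i \<in> index V" "p \<in> chart V i" "\<xi> \<in> nonzero_vecs r"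
  shows "emb_inv (ray (row i p \<xi>)) = pb_pt V i p \<xi>"
  using emb_inv_emb[of "pb_pt V i p \<xi>"] emb_pb_pt[OF assms(1,2)] assms
  by (auto simp: topspace_PV nonzero_vecs_def)

lemma locus_iff: "\<eta> \<in> nonzero_vecs N \<Longrightarrow> ray \<eta> \<in> locus \<longleftrightarrow> \<eta> \<in> cone"
proof
  assume \<eta>: "\<eta> \<in> nonzero_vecs N" and "ray \<eta> \<in> locus"
  then obtain \<zeta> where "\<zeta> \<in> cone" "ray \<eta> = ray \<zeta>" by (auto simp: locus_def)
  then obtain c where "\<eta> = c \<cdot>\<^sub>v \<zeta>" using ray_eqD by blast
  moreover obtain x where x: "x \<in> nonzero_vecs (Suc n)" "kills n t N M \<zeta> x" "\<zeta> \<in> nonzero_vecs N"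
    using \<open>\<zeta> \<in> cone\<close> by (auto simp: cone_def)
  moreover have "kills n t N M (c \<cdot>\<^sub>v \<zeta>) x"
    using x by (intro kills_smult_left) (auto simp: nonzero_vecs_def)
  ultimately show "\<eta> \<in> cone" using \<eta> by (auto simp: cone_def)
qed (auto simp: locus_def)

lemma locus_subset: "locus \<subseteq> topspace (topol (proj_space m))"
  unfolding topspace_proj N_eq[symmetric] by (auto simp: locus_def cone_def)

lemma locus_closed: "closedin (topol (proj_space m)) locus"
proof -
  have "openin (topol (proj_space m)) (topspace (topol (proj_space m)) - locus)"
  proof (subst openin_subopen, intro ballI)
    fix z assume "z \<in> topspace (topol (proj_space m)) - locus"
    then obtain \<eta> where \<eta>: "\<eta> \<in> nonzero_vecs N" "z = ray \<eta>" "\<eta> \<notin> cone"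
      using locus_iff N_eq by (auto simp: topspace_proj)
    have "\<And>x. x \<in> nonzero_vecs (Suc n) \<Longrightarrow> \<not> kills n t N M \<eta> x" using \<eta> by (auto simp: cone_def)
    from image_locus_closed[OF \<eta>(1) this] obtain d f where
      f: "form N d f" "f \<eta> \<noteq> 0" "\<forall>y. \<forall>x\<in>nonzero_vecs (Suc n). kills n t N M y x \<longrightarrow> f y = 0" by blast
    have fm: "form (Suc m) d f" using f N_eq by simp
    have pbi: "ray y \<in> proj_basic m f \<longleftrightarrow> f y \<noteq> 0" if "y \<in> nonzero_vecs N" for y
      using proj_basic_iff[OF fm] that unfolding N_eq by blast
    have "z \<in> proj_basic m f" using pbi \<eta> f by simp
    moreover have "proj_basic m f \<inter> locus = {}"
      using pbi f(3) by (auto simp: locus_def cone_def)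
    ultimately show "\<exists>T. openin (topol (proj_space m)) T \<and> z \<in> T \<and> T \<subseteq> topspace (topol (proj_space m)) - locus"
      using openin_proj_basic[OF fm] openin_subset[OF openin_proj_basic[OF fm]] by blast
  qed
  then show ?thesis using locus_subset by (simp add: closedin_def)
qed

section \<open>The inverse as a local quotient of forms\<close>

text \<open>Functions on the cone that are homogeneous of degree \<open>e\<close> and given by
  quotients of forms near \<open>\<eta>0\<close>: functions of the base point have degree 0, fibre
  coordinates degree 1. The identity is demanded on the cone only, since off it there is no point to
  recover.\<close>

definition local_quot :: "complex vec \<Rightarrow> nat \<Rightarrow> (complex vec \<Rightarrow> complex) \<Rightarrow> bool" where
  "local_quot \<eta>0 e \<phi> \<longleftrightarrow> (\<exists>d F G. form N (d + e) F \<and> form N d G \<and> G \<eta>0 \<noteq> 0 \<and>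
     (\<forall>\<eta>\<in>cone. G \<eta> \<noteq> 0 \<longrightarrow> \<phi> \<eta> = F \<eta> / G \<eta>))"

lemma N_pos: "0 < N" using N_eq by simp

lemma local_quot_form: "form N e F \<Longrightarrow> local_quot \<eta>0 e F"
  unfolding local_quot_def
  by (intro exI[of _ 0] exI[of _ F] exI[of _ "\<lambda>_. 1"]) (auto intro: form_const)

lemma local_quot_add:
  assumes "local_quot \<eta>0 e \<phi>" "local_quot \<eta>0 e \<psi>"
  shows "local_quot \<eta>0 e (\<lambda>\<eta>. \<phi> \<eta> + \<psi> \<eta>)"
proof -
  obtain d F G where 1: "form N (d + e) F" "form N d G" "G \<eta>0 \<noteq> 0" "\<forall>\<eta>\<in>cone. G \<eta> \<noteq> 0 \<longrightarrow> \<phi> \<eta> = F \<eta> / G \<eta>"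
    using assms(1) unfolding local_quot_def by blast
  obtain d' F' G' where 2: "form N (d' + e) F'" "form N d' G'" "G' \<eta>0 \<noteq> 0" "\<forall>\<eta>\<in>cone. G' \<eta> \<noteq> 0 \<longrightarrow> \<psi> \<eta> = F' \<eta> / G' \<eta>"
    using assms(2) unfolding local_quot_def by blast
  have "form N (d + (d' + e)) (\<lambda>y. G y * F' y)" using 1 2 by (intro form_mult)
  then have "form N (d + d' + e) (\<lambda>y. G y * F' y)" by (simp add: add.assoc)
  moreover have "form N ((d + e) + d') (\<lambda>y. F y * G' y)" using 1 2 by (intro form_mult)
  then have "form N (d + d' + e) (\<lambda>y. F y * G' y)" by (simp add: add.assoc add.commute[of e])
  ultimately have "form N (d + d' + e) (\<lambda>y. F y * G' y + G y * F' y)" by (simp add: form_add)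
  moreover have "form N (d + d') (\<lambda>y. G y * G' y)" using 1 2 by (intro form_mult)
  ultimately show ?thesis using 1 2 unfolding local_quot_def
    by (intro exI[of _ "d + d'"] exI[of _ "\<lambda>y. F y * G' y + G y * F' y"] exI[of _ "\<lambda>y. G y * G' y"])
      (auto simp: add_frac_eq)
qed

lemma local_quot_mult:
  assumes "local_quot \<eta>0 e \<phi>" "local_quot \<eta>0 e' \<psi>"
  shows "local_quot \<eta>0 (e + e') (\<lambda>\<eta>. \<phi> \<eta> * \<psi> \<eta>)"
proof -
  obtain d F G where 1: "form N (d + e) F" "form N d G" "G \<eta>0 \<noteq> 0" "\<forall>\<eta>\<in>cone. G \<eta> \<noteq> 0 \<longrightarrow> \<phi> \<eta> = F \<eta> / G \<eta>"
    using assms(1) unfolding local_quot_def by blast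
  obtain d' F' G' where 2: "form N (d' + e') F'" "form N d' G'" "G' \<eta>0 \<noteq> 0" "\<forall>\<eta>\<in>cone. G' \<eta> \<noteq> 0 \<longrightarrow> \<psi> \<eta> = F' \<eta> / G' \<eta>"
    using assms(2) unfolding local_quot_def by blast
  have "form N ((d + e) + (d' + e')) (\<lambda>y. F y * F' y)" using 1 2 by (intro form_mult)
  then have "form N (d + d' + (e + e')) (\<lambda>y. F y * F' y)" by (simp add: ac_simps)
  moreover have "form N (d + d') (\<lambda>y. G y * G' y)" using 1 2 by (intro form_mult)
  ultimately show ?thesis using 1 2 unfolding local_quot_def
    by (intro exI[of _ "d + d'"] exI[of _ "\<lambda>y. F y * F' y"] exI[of _ "\<lambda>y. G y * G' y"]) auto
qed

lemma local_quot_sum: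
  assumes "\<And>s. s \<in> S \<Longrightarrow> local_quot \<eta>0 e (\<phi> s)"
  shows "local_quot \<eta>0 e (\<lambda>\<eta>. \<Sum>s\<in>S. \<phi> s \<eta>)"
  using assms
proof (induction S rule: infinite_finite_induct)
  case (insert s S)
  then show ?case by (simp add: local_quot_add)
qed (simp_all add: local_quot_form form_zero N_pos)

lemma local_quot_subst:
  assumes "form k d f" "\<And>l. l < k \<Longrightarrow> local_quot \<eta>0 1 (\<lambda>\<eta>. \<Xi> \<eta> $ l)"
  shows "local_quot \<eta>0 d (\<lambda>\<eta>. f (\<Xi> \<eta>))"
  using assms(1)
proof induction
  case (form_const c)
  show ?case by (intro local_quot_form form.form_const)
next
  case (form_coord i)
  then show ?case using assms(2) by simp
next
  case (form_add d f g)
  then show ?case by (simp add: local_quot_add)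
next
  case (form_mult d f e g)
  then show ?case by (simp add: local_quot_mult)
qed

lemma local_quot_form_over:
  assumes "B \<in> form_over Q k d" "\<And>a. a \<in> Q \<Longrightarrow> local_quot \<eta>0 0 (\<lambda>\<eta>. a (p \<eta>))"
    and "\<And>l. l < k \<Longrightarrow> local_quot \<eta>0 1 (\<lambda>\<eta>. \<Xi> \<eta> $ l)"
  shows "local_quot \<eta>0 d (\<lambda>\<eta>. B (p \<eta>) (\<Xi> \<eta>))"
proof -
  obtain o' :: nat and a f where *: "\<forall>l<o'. a l \<in> Q \<and> form k d (f l)" "B = (\<lambda>p \<xi>. \<Sum>l<o'. a l p * f l \<xi>)"
    using assms(1) by (rule form_overE)
  have "local_quot \<eta>0 d (\<lambda>\<eta>. \<Sum>l<o'. a l (p \<eta>) * f l (\<Xi> \<eta>))"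
  proof (rule local_quot_sum)
    fix l assume "l \<in> {..<o'}"
    then have "local_quot \<eta>0 (0 + d) (\<lambda>\<eta>. a l (p \<eta>) * f l (\<Xi> \<eta>))"
      using * by (intro local_quot_mult assms(2) local_quot_subst[OF _ assms(3)]) auto
    then show "local_quot \<eta>0 d (\<lambda>\<eta>. a l (p \<eta>) * f l (\<Xi> \<eta>))" by simp
  qed
  then show ?thesis using * by simp
qed

text \<open>The base point \<open>p \<eta>\<close> is read off from the minors
  \<open>X \<eta>\<close>. For the fibre coordinates, a right inverse \<open>E\<close> of the
  quotient map is chosen at \<open>x0\<close> only; \<open>Q = q E\<close> is the identity there and
  invertible nearby. Its adjugate replaces the inverse, so \<open>\<Xi>\<close> is found up to the
  scalar \<open>det Q\<close>, which does not change the point.\<close>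

lemma emb_inv_local:
  assumes \<eta>0: "\<eta>0 \<in> cone" and x0: "x0 \<in> nonzero_vecs (Suc n)" "kills n t N M \<eta>0 x0"
    and i: "i \<in> index V" and U: "Op U" "ray x0 \<in> U" "U \<subseteq> chart V i"
  shows "\<exists>p \<Xi> d G. form N d G \<and> G \<eta>0 \<noteq> 0 \<and>
    (\<forall>\<eta>\<in>cone. G \<eta> \<noteq> 0 \<longrightarrow> p \<eta> \<in> U \<and> \<Xi> \<eta> \<in> nonzero_vecs r \<and> emb_inv (ray \<eta>) = pb_pt V i (p \<eta>) (\<Xi> \<eta>)) \<and>
    (\<forall>B d'. B \<in> form_over (R U) r d' \<longrightarrow> local_quot \<eta>0 d' (\<lambda>\<eta>. B (p \<eta>) (\<Xi> \<eta>)))"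
proof -
  have \<eta>0': "\<eta>0 \<in> nonzero_vecs N" using \<eta>0 by (simp add: cone_def)
  obtain X \<Delta> where \<Delta>: "form N (Suc n) \<Delta>" "\<Delta> \<eta>0 \<noteq> 0" and X: "\<And>l. l < Suc n \<Longrightarrow> form N n (\<lambda>y. X y $ l)"
    and XX: "\<And>\<eta> x. \<eta> \<in> nonzero_vecs N \<Longrightarrow> x \<in> nonzero_vecs (Suc n) \<Longrightarrow> kills n t N M \<eta> x \<Longrightarrow> \<Delta> \<eta> \<noteq> 0 \<Longrightarrow>
      X \<eta> \<in> nonzero_vecs (Suc n) \<and> kills n t N M \<eta> (X \<eta>)"
    using local_kernel_section[OF sep \<eta>0' x0] by blast
  have XC: "X \<eta> \<in> nonzero_vecs (Suc n) \<and> kills n t N M \<eta> (X \<eta>)" if "\<eta> \<in> cone" "\<Delta> \<eta> \<noteq> 0" for \<eta>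
    using XX that by (auto simp: cone_def)
  define p where "p \<eta> = ray (X \<eta>)" for \<eta>
  \<comment> \<open>\<open>\<eta>0\<close> kills both \<open>X \<eta>0\<close> and
    \<open>x0\<close>, and \<open>sep\<close> allows only one such point.\<close>
  have p0: "p \<eta>0 = ray x0"
    using XC[OF \<eta>0 \<Delta>(2)] x0 \<eta>0' sep unfolding separating_def p_def by blast
  have LR0: "local_quot \<eta>0 0 (\<lambda>\<eta>. a (p \<eta>))" if a: "a \<in> R U" for a
  proof -
    obtain d f g where 1: "form (Suc n) d f" "form (Suc n) d g" "g (X \<eta>0) \<noteq> 0"
        "\<forall>y \<in> nonzero_vecs (Suc n). g y \<noteq> 0 \<longrightarrow> a (ray y) = f y / g y"
      using regular_projD[OF a, of "X \<eta>0"] XC[OF \<eta>0 \<Delta>(2)] U p0 unfolding p_def by auto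
    \<comment> \<open>The common factor \<open>\<Delta>\<close> restricts the claim to functionals
      at which \<open>X\<close> is a killed point.\<close>
    have "form N (d * n + Suc n) (\<lambda>y. f (X y) * \<Delta> y)"
      by (intro form_mult form_subst[OF 1(1) X] \<Delta>) simp
    moreover have "form N (d * n + Suc n) (\<lambda>y. g (X y) * \<Delta> y)"
      by (intro form_mult form_subst[OF 1(2) X] \<Delta>) simp
    moreover have "a (p \<eta>) = (f (X \<eta>) * \<Delta> \<eta>) / (g (X \<eta>) * \<Delta> \<eta>)" if "\<eta> \<in> cone" "g (X \<eta>) * \<Delta> \<eta> \<noteq> 0" for \<eta>
      using that XC[of \<eta>] 1 by (simp add: p_def)
    ultimately show ?thesis using 1 \<Delta> unfolding local_quot_def
      by (intro exI[of _ "d * n + Suc n"] exI[of _ "\<lambda>y. f (X y) * \<Delta> y"] exI[of _ "\<lambda>y. g (X y) * \<Delta> y"]) simp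
  qed
  have p0i: "ray x0 \<in> chart V i" using U by auto
  obtain E where E: "E \<in> carrier_mat N r" "q i (ray x0) * E = 1\<^sub>m r" using q_section[OF i p0i] by auto
  define Q where "Q p = mat r r (\<lambda>(k, l). \<Sum>s<N. q i p $$ (k, s) * E $$ (s, l))" for p
  have Q: "Q p \<in> carrier_mat r r" for p by (simp add: Q_def)
  have Q_eq: "Q p = q i p * E" if "p \<in> chart V i" for p
    using q_carrier[OF i that] E by (intro eq_matI) (auto simp: Q_def scalar_prod_def lessThan_atLeast0)
  have ring: "fun_ring (R U)" by (rule fun_ring_R[OF U(1)])
  have QR: "(\<lambda>p. Q p $$ (k, l)) \<in> R U" if "k < r" "l < r" for k l
  proof -
    have "(\<lambda>p. q i p $$ (k, s)) \<in> R U" if "s < N" for s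
      by (rule regular_proj_restrict[OF q_regular[OF i \<open>k < r\<close> that] U(1,3)])
    then have "(\<lambda>p. \<Sum>s<N. q i p $$ (k, s) * E $$ (s, l)) \<in> R U"
      by (intro fun_ring_sum[OF ring] fun_ringD(3)[OF ring] fun_ringD(1)[OF ring]) auto
    then show ?thesis using that by (simp add: Q_def)
  qed
  have detR: "(\<lambda>p. det (Q p)) \<in> R U" by (rule fun_ring_det[OF ring Q QR])
  have adjR: "(\<lambda>p. adj_mat (Q p) $$ (k, l)) \<in> R U" if "k < r" "l < r" for k l
    by (rule fun_ring_adj[OF ring Q QR that])
  \<comment> \<open>This is the transpose of \<open>adj_mat Q\<close> applied to the transpose of
    \<open>E\<close> applied to \<open>\<eta>\<close>. For \<open>\<eta> = row i p \<xi>\<close> the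
    latter is the transpose of \<open>Q\<close> applied to \<open>\<xi>\<close>, whence
    \<open>\<Xi> = det Q \<cdot>\<^sub>v \<xi>\<close>.\<close>
  define \<Xi> where "\<Xi> \<eta> = vec r (\<lambda>l. \<Sum>k<r. adj_mat (Q (p \<eta>)) $$ (k, l) * (\<Sum>s<N. E $$ (s, k) * \<eta> $ s))" for \<eta>
  have LR1: "local_quot \<eta>0 1 (\<lambda>\<eta>. \<Xi> \<eta> $ l)" if l: "l < r" for l
  proof -
    have "local_quot \<eta>0 1 (\<lambda>\<eta>. \<Sum>k<r. adj_mat (Q (p \<eta>)) $$ (k, l) * (\<Sum>s<N. E $$ (s, k) * \<eta> $ s))"
    proof (rule local_quot_sum)
      fix k assume k: "k \<in> {..<r}"
      have "local_quot \<eta>0 0 (\<lambda>\<eta>. adj_mat (Q (p \<eta>)) $$ (k, l))" using LR0[OF adjR[of k l]] k l by simp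
      moreover have "form N 1 (\<lambda>\<eta>. \<Sum>s<N. E $$ (s, k) * \<eta> $ s)"
        by (intro form_sum N_pos form_smult form_coord) auto
      ultimately show "local_quot \<eta>0 1 (\<lambda>\<eta>. adj_mat (Q (p \<eta>)) $$ (k, l) * (\<Sum>s<N. E $$ (s, k) * \<eta> $ s))"
        using local_quot_mult[OF _ local_quot_form] by fastforce
    qed
    then show ?thesis using l by (simp add: \<Xi>_def)
  qed
  have \<Xi>_row: "\<Xi> \<eta> = det (Q (p \<eta>)) \<cdot>\<^sub>v \<xi>" if pi: "p \<eta> \<in> chart V i" and \<xi>: "\<xi> \<in> carrier_vec r"
    and row: "\<eta> = row i (p \<eta>) \<xi>" for \<eta> \<xi>
  proof -
    let ?Q = "Q (p \<eta>)"
    have e: "(\<Sum>s<N. E $$ (s, k) * \<eta> $ s) = (\<Sum>j<r. ?Q $$ (j, k) * \<xi> $ j)" if "k < r" for k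
    proof -
      have "(\<Sum>s<N. E $$ (s, k) * \<eta> $ s) = (\<Sum>s<N. E $$ (s, k) * row i (p \<eta>) \<xi> $ s)"
        using row by simp
      also have "\<dots> = (\<Sum>s<N. \<Sum>j<r. q i (p \<eta>) $$ (j, s) * E $$ (s, k) * \<xi> $ j)"
        by (intro sum.cong refl) (simp add: row_def sum_distrib_left algebra_simps)
      also have "\<dots> = (\<Sum>j<r. (\<Sum>s<N. q i (p \<eta>) $$ (j, s) * E $$ (s, k)) * \<xi> $ j)"
        unfolding sum_distrib_right by (rule sum.swap)
      also have "\<dots> = (\<Sum>j<r. ?Q $$ (j, k) * \<xi> $ j)"
        using that by (intro sum.cong refl) (simp add: Q_def)
      finally show ?thesis .
    qed
    have QA: "(\<Sum>k<r. ?Q $$ (j, k) * adj_mat ?Q $$ (k, l)) = (if j = l then det ?Q else 0)"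
      if "j < r" "l < r" for j l
    proof -
      have 1: "(?Q * adj_mat ?Q) $$ (j, l) = (\<Sum>k<r. ?Q $$ (j, k) * adj_mat ?Q $$ (k, l))"
        using that Q[of "p \<eta>"] adj_mat(1)[OF Q[of "p \<eta>"]] by (simp add: scalar_prod_def lessThan_atLeast0)
      have 2: "(?Q * adj_mat ?Q) $$ (j, l) = (if j = l then det ?Q else 0)"
        unfolding adj_mat(2)[OF Q] using that by simp
      show ?thesis by (rule trans[OF sym[OF 1] 2])
    qed
    show ?thesis
    proof (rule eq_vecI)
      fix l assume "l < dim_vec (det ?Q \<cdot>\<^sub>v \<xi>)"
      then have l: "l < r" using \<xi> by simp
      have "\<Xi> \<eta> $ l = (\<Sum>k<r. adj_mat ?Q $$ (k, l) * (\<Sum>j<r. ?Q $$ (j, k) * \<xi> $ j))"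
        using l by (simp add: \<Xi>_def e)
      also have "\<dots> = (\<Sum>k<r. \<Sum>j<r. ?Q $$ (j, k) * adj_mat ?Q $$ (k, l) * \<xi> $ j)"
        unfolding sum_distrib_left by (intro sum.cong refl) (simp add: algebra_simps)
      also have "\<dots> = (\<Sum>j<r. (\<Sum>k<r. ?Q $$ (j, k) * adj_mat ?Q $$ (k, l)) * \<xi> $ j)"
        unfolding sum_distrib_right by (rule sum.swap)
      also have "\<dots> = (\<Sum>j<r. if j = l then det ?Q * \<xi> $ l else 0)"
        using l by (intro sum.cong refl) (simp add: QA)
      finally show "\<Xi> \<eta> $ l = (det ?Q \<cdot>\<^sub>v \<xi>) $ l" using l \<xi> by simp
    qed (use \<xi> in \<open>simp add: \<Xi>_def\<close>)
  qed
  obtain d1 F1 G1 where D: "form N (d1 + 0) F1" "form N d1 G1" "G1 \<eta>0 \<noteq> 0"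
    "\<forall>\<eta>\<in>cone. G1 \<eta> \<noteq> 0 \<longrightarrow> det (Q (p \<eta>)) = F1 \<eta> / G1 \<eta>"
    using LR0[OF detR] unfolding local_quot_def by blast
  have "det (Q (p \<eta>0)) = 1" unfolding p0 using Q_eq[OF p0i] E by simp
  then have F1: "F1 \<eta>0 \<noteq> 0" using D \<eta>0 by auto
  obtain d2 f where f: "form (Suc n) d2 f" "f (X \<eta>0) \<noteq> 0" "proj_basic n f \<subseteq> U"
    using openin_projD[OF U(1), of "X \<eta>0"] XC[OF \<eta>0 \<Delta>(2)] U(2) p0 unfolding p_def by auto
  \<comment> \<open>\<open>\<Delta>\<close> makes \<open>X \<eta>\<close> a killed point,
    \<open>f\<close> keeps it in \<open>U\<close>, \<open>G1\<close> makes the expression for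
    \<open>det Q\<close> valid and \<open>F1\<close> makes \<open>det Q\<close> nonzero.\<close>
  define G where "G \<eta> = \<Delta> \<eta> * f (X \<eta>) * (F1 \<eta> * G1 \<eta>)" for \<eta>
  have "form N ((Suc n + d2 * n) + ((d1 + 0) + d1)) G" unfolding G_def[abs_def]
    by (intro form_mult \<Delta> form_subst[OF f(1) X] D) simp
  moreover have "G \<eta>0 \<noteq> 0" using \<Delta> f F1 D by (simp add: G_def)
  moreover have "p \<eta> \<in> U \<and> \<Xi> \<eta> \<in> nonzero_vecs r \<and> emb_inv (ray \<eta>) = pb_pt V i (p \<eta>) (\<Xi> \<eta>)"
    if \<eta>: "\<eta> \<in> cone" "G \<eta> \<noteq> 0" for \<eta>
  proof -
    have nz: "\<Delta> \<eta> \<noteq> 0" "f (X \<eta>) \<noteq> 0" "F1 \<eta> \<noteq> 0" "G1 \<eta> \<noteq> 0" using \<eta> by (auto simp: G_def)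
    note xc = XC[OF \<eta>(1) nz(1)]
    have pU: "p \<eta> \<in> U" using f nz xc proj_basic_iff[OF f(1)] by (auto simp: p_def)
    then have pi: "p \<eta> \<in> chart V i" using U by auto
    have \<eta>N: "\<eta> \<in> nonzero_vecs N" using \<eta> by (simp add: cone_def)
    obtain \<xi> where \<xi>: "\<xi> \<in> nonzero_vecs r" "\<eta> = row i (p \<eta>) \<xi>"
      using cone_pt[OF \<eta>N _ _ i] xc pi unfolding p_def by blast
    have \<xi>c: "\<xi> \<in> carrier_vec r" using \<xi> by (simp add: nonzero_vecs_def)
    have d: "det (Q (p \<eta>)) \<noteq> 0" using D(4) \<eta> nz by auto
    have e: "\<Xi> \<eta> = det (Q (p \<eta>)) \<cdot>\<^sub>v \<xi>" by (rule \<Xi>_row[OF pi \<xi>c \<xi>(2)])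
    have "emb_inv (ray \<eta>) = pb_pt V i (p \<eta>) \<xi>" using emb_inv_row[OF i pi \<xi>(1)] \<xi>(2) by simp
    also have "\<dots> = pb_pt V i (p \<eta>) (\<Xi> \<eta>)" unfolding e by (rule pb_pt_smult[OF i pi \<xi>c d, symmetric])
    finally show ?thesis using pU smult_nonzero_vecs[OF d \<xi>(1)] e by simp
  qed
  moreover have "local_quot \<eta>0 d' (\<lambda>\<eta>. B (p \<eta>) (\<Xi> \<eta>))" if "B \<in> form_over (R U) r d'" for B d'
    by (rule local_quot_form_over[OF that LR0 LR1])
  ultimately show ?thesis
    by (intro exI[of _ p] exI[of _ \<Xi>] exI[of _ "(Suc n + d2 * n) + ((d1 + 0) + d1)"] exI[of _ G]) blast
qed

end

lemma proj_O1_trans: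
  assumes "x \<in> carrier_vec k" "a < k" "b < k"
  shows "ltrans (proj_O1 m) a b (ray x) = x $ b / x $ a"
proof -
  have "(THE z. \<exists>y\<in>ray x. z = y $ b / y $ a) = x $ b / x $ a"
  proof (rule the_equality)
    show "\<exists>y\<in>ray x. x $ b / x $ a = y $ b / y $ a" using ray_self by blast
    fix z assume "\<exists>y\<in>ray x. z = y $ b / y $ a"
    then show "z = x $ b / x $ a" using assms by (auto simp: ray_def)
  qed
  then show ?thesis by (simp add: proj_O1_def)
qed

section \<open>The isomorphism onto the image\<close>

context presented
begin

lemma form_row_form_over:
  assumes "form N d f" "i \<in> index V" "Op U" "U \<subseteq> chart V i"
  shows "(\<lambda>p \<xi>. f (row i p \<xi>)) \<in> form_over (R U) r d"
  by (rule form_over_subst[OF fun_ring_R[OF assms(3)] assms(1), where G = "row i"])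
    (rule row_form_over[OF assms(2-4)])

lemma emb_proj_basic_iff:
  assumes "form N d f" "i \<in> index V" "p \<in> chart V i" "\<xi> \<in> nonzero_vecs r"
  shows "emb (pb_pt V i p \<xi>) \<in> proj_basic m f \<longleftrightarrow> f (row i p \<xi>) \<noteq> 0"
proof -
  have "emb (pb_pt V i p \<xi>) = ray (row i p \<xi>)" using assms by (intro emb_pb_pt) (auto simp: nonzero_vecs_def)
  then show ?thesis using proj_basic_iff[of m d f "row i p \<xi>"] assms(1) row_nonzero[OF assms(2-4)]
    unfolding N_eq by simp
qed

lemma induced_topspace: "topspace (topol (induced (proj_space m) locus)) = locus"
  using locus_subset by (auto simp: induced_def)

lemma continuous_emb: "continuous_map (topol PV) (topol (proj_space m)) emb"
proof -
  let ?S = "{proj_basic m f |f d. form (Suc m) d f}"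
  have T: "topol (proj_space m) = topology_generated_by ?S" by (simp add: proj_space_def)
  show ?thesis unfolding T continuous_on_generated_topo_iff
  proof (intro conjI allI impI)
    fix W assume "W \<in> ?S"
    then obtain f d where f: "W = proj_basic m f" "form N d f" unfolding N_eq by auto
    have "emb -` W \<inter> topspace (topol PV) = (\<Union>i\<in>index V. pb_basic V i (chart V i) (\<lambda>p \<xi>. f (row i p \<xi>)))"
    proof (rule Set.set_eqI, rule iffI)
      fix P assume P: "P \<in> emb -` W \<inter> topspace (topol PV)"
      then obtain i p \<xi> where *: "P = pb_pt V i p \<xi>" "i \<in> index V" "p \<in> chart V i" "\<xi> \<in> nonzero_vecs r"
        by (auto simp: topspace_PV)
      then have "f (row i p \<xi>) \<noteq> 0" using P f emb_proj_basic_iff[OF f(2) *(2-4)] by auto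
      then show "P \<in> (\<Union>i\<in>index V. pb_basic V i (chart V i) (\<lambda>p \<xi>. f (row i p \<xi>)))"
        using * by (auto intro!: pb_basicI)
    next
      fix P assume "P \<in> (\<Union>i\<in>index V. pb_basic V i (chart V i) (\<lambda>p \<xi>. f (row i p \<xi>)))"
      then obtain i p \<xi> where *: "P = pb_pt V i p \<xi>" "i \<in> index V" "p \<in> chart V i" "\<xi> \<in> nonzero_vecs r"
        "f (row i p \<xi>) \<noteq> 0" by (auto simp: pb_basic_def)
      then show "P \<in> emb -` W \<inter> topspace (topol PV)"
        using f emb_proj_basic_iff[OF f(2) *(2-4)] by (auto simp: topspace_PV)
    qed
    moreover have "openin (topol PV) (pb_basic V i (chart V i) (\<lambda>p \<xi>. f (row i p \<xi>)))" if "i \<in> index V" for i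
      by (rule openin_pb_basic[OF that chart_open[OF that] subset_refl
            form_row_form_over[OF f(2) that chart_open[OF that] subset_refl]])
    ultimately show "openin (topol PV) (emb -` W \<inter> topspace (topol PV))" by auto
  next
    show "emb ` topspace (topol PV) \<subseteq> \<Union>?S"
      using locus_subset unfolding T topology_generated_by_topspace emb_image .
  qed
qed

text \<open>\<open>row\<close> is linear in \<open>\<xi>\<close> with regular coefficients, so
  composing with it turns quotients of forms into quotients of forms over a chart.\<close>

lemma morphism_emb: "morphism PV (induced (proj_space m) locus) emb"
  unfolding morphism_def
proof (intro conjI allI impI)
  show "continuous_map (topol PV) (topol (induced (proj_space m) locus)) emb"
    using continuous_emb emb_image by (auto simp: induced_def continuous_map_in_subtopology)
  fix W \<phi> assume \<phi>: "\<phi> \<in> regular (induced (proj_space m) locus) W"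
  show "\<phi> \<circ> emb \<in> regular PV {P \<in> topspace (topol PV). emb P \<in> W}"
  proof (rule regular_PVI)
    fix i p \<xi> assume i: "i \<in> index V" "p \<in> chart V i" and \<xi>: "\<xi> \<in> nonzero_vecs r"
      and P: "pb_pt V i p \<xi> \<in> {P \<in> topspace (topol PV). emb P \<in> W}"
    have emb_eq: "emb (pb_pt V i q \<eta>) = ray (row i q \<eta>)" if "q \<in> chart V i" "\<eta> \<in> nonzero_vecs r" for q \<eta>
      using that i by (intro emb_pb_pt) (auto simp: nonzero_vecs_def)
    have zW: "ray (row i p \<xi>) \<in> W" using P emb_eq[OF i(2) \<xi>] by simp
    obtain W' \<psi> where W': "ray (row i p \<xi>) \<in> W'" "W' \<inter> locus \<subseteq> W" "\<psi> \<in> regular (proj_space m) W'"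
      "\<forall>w\<in>W' \<inter> locus. \<phi> w = \<psi> w"
      using \<phi> zW unfolding induced_def fspace.simps by blast
    obtain d f g where fg: "form N d f" "form N d g" "g (row i p \<xi>) \<noteq> 0" "proj_basic m g \<subseteq> W'"
      "\<forall>y\<in>nonzero_vecs N. g y \<noteq> 0 \<longrightarrow> \<psi> (ray y) = f y / g y"
      using regular_projD[OF W'(3) _ W'(1)] row_nonzero[OF i \<xi>] unfolding N_eq by blast
    have "pb_pt V i q \<eta> \<in> {P \<in> topspace (topol PV). emb P \<in> W} \<and>
        (\<phi> \<circ> emb) (pb_pt V i q \<eta>) = f (row i q \<eta>) / g (row i q \<eta>)"
      if q: "q \<in> chart V i" "\<eta> \<in> nonzero_vecs r" "g (row i q \<eta>) \<noteq> 0" for q \<eta>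
    proof -
      have "emb (pb_pt V i q \<eta>) \<in> W'" using emb_proj_basic_iff[OF fg(2) i(1) q(1,2)] q(3) fg(4) by auto
      then have 1: "ray (row i q \<eta>) \<in> W' \<inter> locus"
        using emb_eq[OF q(1,2)] row_cone[OF i(1) q(1,2)] by (auto simp: locus_def)
      have "\<psi> (ray (row i q \<eta>)) = f (row i q \<eta>) / g (row i q \<eta>)"
        using fg(5) row_nonzero[OF i(1) q(1,2)] q(3) by blast
      then show ?thesis using 1 W' emb_eq[OF q(1,2)] i(1) q by (auto simp: topspace_PV)
    qed
    then show "pb_quot {P \<in> topspace (topol PV). emb P \<in> W} (\<phi> \<circ> emb) i p \<xi>"
      using i fg(3)
      by (intro pb_quotI[OF chart_open[OF i(1)] i(2) subset_refl
            form_row_form_over[OF fg(1) i(1) chart_open[OF i(1)] subset_refl]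
            form_row_form_over[OF fg(2) i(1) chart_open[OF i(1)] subset_refl]]) auto
  qed
qed

text \<open>\<open>A\<close> and \<open>B\<close> have the same degree \<open>d\<close> in the fibre
  coordinates, so along the inverse they become local quotients of the same degree and the degrees
  cancel in their ratio.\<close>

lemma emb_inv_quot:
  assumes \<phi>: "\<phi> \<in> regular PV W" and \<eta>0: "\<eta>0 \<in> cone" and W: "emb_inv (ray \<eta>0) \<in> W"
  shows "\<exists>d F G. form N d F \<and> form N d G \<and> G \<eta>0 \<noteq> 0 \<and>
    (\<forall>\<eta>\<in>cone. G \<eta> \<noteq> 0 \<longrightarrow> emb_inv (ray \<eta>) \<in> W \<and> \<phi> (emb_inv (ray \<eta>)) = F \<eta> / G \<eta>)"
proof -
  obtain x0 where x0: "x0 \<in> nonzero_vecs (Suc n)" "kills n t N M \<eta>0 x0" "\<eta>0 \<in> nonzero_vecs N"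
    using \<eta>0 by (auto simp: cone_def)
  obtain i where i: "i \<in> index V" "ray x0 \<in> chart V i" using chart_cover[OF x0(1)] by auto
  obtain \<xi>0 where \<xi>0: "\<xi>0 \<in> nonzero_vecs r" "\<eta>0 = row i (ray x0) \<xi>0" using cone_pt[OF x0(3,1,2) i] by auto
  have e0: "emb_inv (ray \<eta>0) = pb_pt V i (ray x0) \<xi>0" using emb_inv_row[OF i \<xi>0(1)] \<xi>0(2) by simp
  have "pb_quot W \<phi> i (ray x0) \<xi>0" using \<phi> W i \<xi>0(1) unfolding regular_PV_iff e0 by blast
  then obtain U d A B where U: "Op U" "ray x0 \<in> U" "U \<subseteq> chart V i" and AB: "A \<in> form_over (R U) r d"
    "B \<in> form_over (R U) r d" "B (ray x0) \<xi>0 \<noteq> 0" "pb_basic V i U B \<subseteq> W"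
    "\<forall>q\<in>U. \<forall>\<eta>\<in>nonzero_vecs r. B q \<eta> \<noteq> 0 \<longrightarrow> \<phi> (pb_pt V i q \<eta>) = A q \<eta> / B q \<eta>"
    unfolding pb_quot_def by (elim exE conjE) (rule that)
  obtain p \<Xi> d' G where G: "form N d' G" "G \<eta>0 \<noteq> 0"
    and p: "\<And>\<eta>. \<eta> \<in> cone \<Longrightarrow> G \<eta> \<noteq> 0 \<Longrightarrow> p \<eta> \<in> U \<and> \<Xi> \<eta> \<in> nonzero_vecs r \<and> emb_inv (ray \<eta>) = pb_pt V i (p \<eta>) (\<Xi> \<eta>)"
    and lq: "\<And>B d'. B \<in> form_over (R U) r d' \<Longrightarrow> local_quot \<eta>0 d' (\<lambda>\<eta>. B (p \<eta>) (\<Xi> \<eta>))"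
    using emb_inv_local[OF \<eta>0 x0(1,2) i(1) U] by blast
  obtain a FA GA where A: "form N (a + d) FA" "form N a GA" "GA \<eta>0 \<noteq> 0"
    "\<And>\<eta>. \<eta> \<in> cone \<Longrightarrow> GA \<eta> \<noteq> 0 \<Longrightarrow> A (p \<eta>) (\<Xi> \<eta>) = FA \<eta> / GA \<eta>"
    using lq[OF AB(1)] unfolding local_quot_def by blast
  obtain b FB GB where B: "form N (b + d) FB" "form N b GB" "GB \<eta>0 \<noteq> 0"
    "\<And>\<eta>. \<eta> \<in> cone \<Longrightarrow> GB \<eta> \<noteq> 0 \<Longrightarrow> B (p \<eta>) (\<Xi> \<eta>) = FB \<eta> / GB \<eta>"
    using lq[OF AB(2)] unfolding local_quot_def by blast
  have "pb_pt V i (p \<eta>0) (\<Xi> \<eta>0) \<in> pb_basic V i U B"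
    using pb_basicI[of "ray x0" U \<xi>0 B i] U \<xi>0 AB(3) e0 p[OF \<eta>0 G(2)] by simp
  then have "B (p \<eta>0) (\<Xi> \<eta>0) \<noteq> 0"
    using pb_basic_iff[OF i(1) U(3) _ _ AB(2)] p[OF \<eta>0 G(2)] by blast
  then have FB: "FB \<eta>0 \<noteq> 0" using B(4)[OF \<eta>0 B(3)] by auto
  \<comment> \<open>The ratio is \<open>(FA * GB) / (GA * FB)\<close>. The common factor
    \<open>GB * G\<close> ensures that the formulas for \<open>B\<close> and for the inverse hold
    wherever \<open>G'\<close> is nonzero.\<close>
  define G' where "G' y = (GA y * FB y) * (GB y * G y)" for y
  define F' where "F' y = (FA y * GB y) * (GB y * G y)" for y
  have "form N ((a + (b + d)) + (b + d')) G'" unfolding G'_def[abs_def] by (intro form_mult A B G)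
  moreover have "form N (((a + d) + b) + (b + d')) F'" unfolding F'_def[abs_def] by (intro form_mult A B G)
  then have "form N ((a + (b + d)) + (b + d')) F'" by (simp add: ac_simps)
  moreover have "G' \<eta>0 \<noteq> 0" using A(3) FB B(3) G(2) by (simp add: G'_def)
  moreover have "emb_inv (ray \<eta>) \<in> W \<and> \<phi> (emb_inv (ray \<eta>)) = F' \<eta> / G' \<eta>" if \<eta>: "\<eta> \<in> cone" "G' \<eta> \<noteq> 0" for \<eta>
  proof -
    have nz: "GA \<eta> \<noteq> 0" "FB \<eta> \<noteq> 0" "GB \<eta> \<noteq> 0" "G \<eta> \<noteq> 0" using \<eta>(2) by (auto simp: G'_def)
    note * = p[OF \<eta>(1) nz(4)] A(4)[OF \<eta>(1) nz(1)] B(4)[OF \<eta>(1) nz(3)]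
    have "B (p \<eta>) (\<Xi> \<eta>) \<noteq> 0" using * nz by simp
    then have "pb_pt V i (p \<eta>) (\<Xi> \<eta>) \<in> W \<and> \<phi> (pb_pt V i (p \<eta>) (\<Xi> \<eta>)) = A (p \<eta>) (\<Xi> \<eta>) / B (p \<eta>) (\<Xi> \<eta>)"
      using AB(4,5) pb_basicI[of "p \<eta>" U "\<Xi> \<eta>" B i] * by blast
    then show ?thesis using * nz by (simp add: F'_def G'_def)
  qed
  ultimately show ?thesis by blast
qed

text \<open>Applied to this function, \<open>emb_inv_quot\<close> still yields a neighbourhood that
  \<open>emb_inv\<close> maps into \<open>W\<close>: continuity of the inverse comes from the same
  lemma as regularity.\<close>

lemma one_regular_PV:
  assumes "openin (topol PV) W"
  shows "(\<lambda>_. 1) \<in> regular PV W"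
proof (rule regular_PVI)
  fix i p \<xi> assume *: "i \<in> index V" "p \<in> chart V i" "\<xi> \<in> nonzero_vecs r" "pb_pt V i p \<xi> \<in> W"
  obtain U d B where U: "Op U" "p \<in> U" "U \<subseteq> chart V i" "B \<in> form_over (R U) r d" "B p \<xi> \<noteq> 0" "pb_basic V i U B \<subseteq> W"
    using openin_PVD[OF assms *(4,1-3)] by (elim exE conjE) (rule that)
  then show "pb_quot W (\<lambda>_. 1) i p \<xi>"
    using pb_basicI[of _ U _ B i] by (intro pb_quotI[OF U(1-4,4,5)]) auto
qed

lemma morphism_emb_inv: "morphism (induced (proj_space m) locus) PV emb_inv"
  unfolding morphism_def
proof (intro conjI allI impI)
  have nz: "proj_basic m G \<inter> locus = {ray \<eta> |\<eta>. \<eta> \<in> cone \<and> G \<eta> \<noteq> 0}" if "form N d G" for d G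
  proof -
    have "ray y \<in> proj_basic m G \<longleftrightarrow> G y \<noteq> 0" if "y \<in> nonzero_vecs N" for y
      using proj_basic_iff[of m d G y] \<open>form N d G\<close> that unfolding N_eq by blast
    then show ?thesis by (auto simp: locus_def cone_def)
  qed
  have into: "emb_inv z \<in> topspace (topol PV)" if "z \<in> locus" for z
    unfolding emb_inv_def using that emb_image by (intro inv_into_into) simp
  show "continuous_map (topol (induced (proj_space m) locus)) (topol PV) emb_inv"
    unfolding continuous_map_def induced_topspace
  proof (intro conjI allI impI)
    show "emb_inv \<in> locus \<rightarrow> topspace (topol PV)" using into by auto
    fix W assume W: "openin (topol PV) W"
    show "openin (topol (induced (proj_space m) locus)) {z \<in> locus. emb_inv z \<in> W}"
    proof (subst openin_subopen, intro ballI)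
      fix z assume z: "z \<in> {z \<in> locus. emb_inv z \<in> W}"
      then obtain \<eta>0 where \<eta>0: "\<eta>0 \<in> cone" "z = ray \<eta>0" by (auto simp: locus_def)
      obtain d F G where G: "form N d G" "G \<eta>0 \<noteq> 0" "\<forall>\<eta>\<in>cone. G \<eta> \<noteq> 0 \<longrightarrow> emb_inv (ray \<eta>) \<in> W"
        using emb_inv_quot[OF one_regular_PV[OF W] \<eta>0(1)] z \<eta>0 by blast
      have "openin (topol (induced (proj_space m) locus)) (proj_basic m G \<inter> locus)"
        using openin_proj_basic[of m d G] G(1) unfolding N_eq
        by (auto simp: induced_def openin_subtopology)
      moreover have "z \<in> proj_basic m G \<inter> locus" using \<eta>0 G unfolding nz[OF G(1)] by blast
      moreover have "proj_basic m G \<inter> locus \<subseteq> {z \<in> locus. emb_inv z \<in> W}"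
        using G(3) unfolding nz[OF G(1)] by (auto simp: locus_def)
      ultimately show "\<exists>T. openin (topol (induced (proj_space m) locus)) T \<and> z \<in> T \<and> T \<subseteq> {z \<in> locus. emb_inv z \<in> W}"
        by blast
    qed
  qed
  fix W \<phi> assume \<phi>: "\<phi> \<in> regular PV W"
  show "\<phi> \<circ> emb_inv \<in> regular (induced (proj_space m) locus)
      {z \<in> topspace (topol (induced (proj_space m) locus)). emb_inv z \<in> W}"
    unfolding induced_topspace unfolding induced_def fspace.simps mem_Collect_eq
  proof (intro ballI)
    fix z assume z: "z \<in> {z \<in> locus. emb_inv z \<in> W}"
    then obtain \<eta>0 where \<eta>0: "\<eta>0 \<in> cone" "z = ray \<eta>0" by (auto simp: locus_def)
    obtain d F G where G: "form N d F" "form N d G" "G \<eta>0 \<noteq> 0"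
      "\<forall>\<eta>\<in>cone. G \<eta> \<noteq> 0 \<longrightarrow> emb_inv (ray \<eta>) \<in> W \<and> \<phi> (emb_inv (ray \<eta>)) = F \<eta> / G \<eta>"
      using emb_inv_quot[OF \<phi> \<eta>0(1)] z \<eta>0 by blast
    have 1: "openin (topol (proj_space m)) (proj_basic m G)"
      using openin_proj_basic[of m d G] G(2) unfolding N_eq by simp
    have 2: "z \<in> proj_basic m G" using nz[OF G(2)] \<eta>0 G by blast
    have 3: "proj_basic m G \<inter> locus \<subseteq> {z \<in> locus. emb_inv z \<in> W}"
      using G(4) unfolding nz[OF G(2)] by (auto simp: locus_def)
    \<comment> \<open>An induced regular function must extend locally to the ambient space; this
      quotient is the extension.\<close>
    have 4: "quot_fun F G \<in> regular (proj_space m) (proj_basic m G)"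
      using quot_fun_regular[of m d F G] G unfolding N_eq by simp
    have 5: "(\<phi> \<circ> emb_inv) w = quot_fun F G w" if w: "w \<in> proj_basic m G \<inter> locus" for w
    proof -
      obtain \<eta> where \<eta>: "\<eta> \<in> cone" "G \<eta> \<noteq> 0" "w = ray \<eta>" using w unfolding nz[OF G(2)] by blast
      have "\<eta> \<in> nonzero_vecs N" using \<eta>(1) unfolding cone_def by blast
      then have "\<eta> \<in> nonzero_vecs (Suc m)" by (simp only: N_eq)
      then have "quot_fun F G w = F \<eta> / G \<eta>" using quot_fun_ray[of m d F G \<eta>] G \<eta> unfolding N_eq by simp
      then show ?thesis using G(4) \<eta> by simp
    qed
    show "\<exists>W' \<psi>. openin (topol (proj_space m)) W' \<and> z \<in> W' \<and> W' \<inter> locus \<subseteq> {z \<in> locus. emb_inv z \<in> W} \<and>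
        \<psi> \<in> regular (proj_space m) W' \<and> (\<forall>w\<in>W' \<inter> locus. (\<phi> \<circ> emb_inv) w = \<psi> w)"
      using 1 2 3 4 5 by (intro exI[of _ "proj_basic m G"] exI[of _ "quot_fun F G"]) blast
  qed
qed

lemma closed_immersion_emb: "closed_immersion PV (proj_space m) emb"
  unfolding closed_immersion_def emb_image isomorphism_def
  using locus_closed morphism_emb morphism_emb_inv emb_inv_emb emb_emb_inv induced_topspace by auto

section \<open>Comparison with the pulled back hyperplane bundle\<close>

text \<open>The section of the universal quotient defined by the image of the \<open>a\<close>-th
  basis vector under \<open>q\<close>, in the chart \<open>(i, l)\<close>; the isomorphism matches
  it with the \<open>a\<close>-th coordinate of projective space.\<close>

definition iso_coeff :: "'i \<times> nat \<Rightarrow> nat \<Rightarrow> ('i \<times> pt \<times> complex vec) set \<Rightarrow> complex" where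
  "iso_coeff = (\<lambda>(i, l) a P. THE z. \<exists>p \<xi>. (i, p, \<xi>) \<in> P \<and> z = row i p \<xi> $ a / \<xi> $ l)"

lemma iso_coeff_pb_pt:
  assumes "k \<in> index V" "i \<in> index V" "p \<in> chart V k" "p \<in> chart V i" "\<xi> \<in> carrier_vec r" "l < r" "a < N"
  shows "iso_coeff (i, l) a (pb_pt V k p \<xi>) = row k p \<xi> $ a / tr k i p \<xi> $ l"
proof -
  let ?\<xi> = "tr k i p \<xi>"
  have P: "pb_pt V k p \<xi> = pb_pt V i p ?\<xi>" using pb_pt_change[OF assms(1-5)] by simp
  have "(THE z. \<exists>q \<eta>. (i, q, \<eta>) \<in> pb_pt V i p ?\<xi> \<and> z = row i q \<eta> $ a / \<eta> $ l) = row i p ?\<xi> $ a / ?\<xi> $ l"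
  proof (rule the_equality)
    show "\<exists>q \<eta>. (i, q, \<eta>) \<in> pb_pt V i p ?\<xi> \<and> row i p ?\<xi> $ a / ?\<xi> $ l = row i q \<eta> $ a / \<eta> $ l"
      using pb_pt_self[OF assms(2,4) tr_carrier] by blast
    fix z assume "\<exists>q \<eta>. (i, q, \<eta>) \<in> pb_pt V i p ?\<xi> \<and> z = row i q \<eta> $ a / \<eta> $ l"
    then obtain q \<eta> where z: "(i, q, \<eta>) \<in> pb_pt V i p ?\<xi>" "z = row i q \<eta> $ a / \<eta> $ l" by blast
    then obtain c where c: "q = p" "c \<noteq> 0" "\<eta> = c \<cdot>\<^sub>v ?\<xi>"
      using mem_pb_pt[OF assms(2,4) tr_carrier] tr_id[OF assms(2,4) tr_carrier] by auto
    then show "z = row i p ?\<xi> $ a / ?\<xi> $ l"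
      using z row_smult[OF tr_carrier, of i p c k i p \<xi>] row_carrier[of i p ?\<xi>] tr_carrier[of k i p \<xi>] assms(6,7) by simp
  qed
  then show ?thesis unfolding P iso_coeff_def using row_tr[OF assms(1-5)] by simp
qed

lemma very_ample_O1: "very_ample PV (tensor_power O1 1)"
proof -
  let ?L = "pullback PV emb (proj_O1 m)"
  have tp: "tensor_power O1 1 = O1" by (simp add: tensor_power_def)
  have lc: "pb_pt V k p \<xi> \<in> lchart ?L a \<longleftrightarrow> row k p \<xi> $ a \<noteq> 0"
    if "k \<in> index V" "p \<in> chart V k" "\<xi> \<in> nonzero_vecs r" "a < N" for k p \<xi> a
    using emb_proj_basic_iff[OF form_coord[OF that(4)] that(1-3)] that
    by (auto simp: pullback_def proj_O1_def topspace_PV)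
  have lt: "ltrans ?L a b (pb_pt V k p \<xi>) = row k p \<xi> $ b / row k p \<xi> $ a"
    if "k \<in> index V" "p \<in> chart V k" "\<xi> \<in> carrier_vec r" "a < N" "b < N" for k p \<xi> a b
    using proj_O1_trans[OF row_carrier that(4,5)] emb_pb_pt[OF that(1-3)] by (simp add: pullback_def)
  have "line_bundle_iso PV O1 ?L"
    unfolding line_bundle_iso_def
  proof (intro exI[of _ iso_coeff] conjI ballI)
    fix il a assume "il \<in> lindex O1" and "a \<in> lindex ?L"
    then obtain i l where il: "il = (i, l)" "i \<in> index V" "l < r" and a: "a < N"
      using N_eq by (auto simp: pb_O1_def pullback_def proj_O1_def)
    show "iso_coeff il a \<in> regular PV (lchart O1 il \<inter> lchart ?L a)"
    proof (rule regular_PVI)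
      fix k p \<xi> assume k: "k \<in> index V" "p \<in> chart V k" "\<xi> \<in> nonzero_vecs r"
        and P: "pb_pt V k p \<xi> \<in> lchart O1 il \<inter> lchart ?L a"
      have p: "p \<in> chart V i" "tr k i p \<xi> $ l \<noteq> 0" "row k p \<xi> $ a \<noteq> 0"
        using P k il a lchart_O1_iff lc by auto
      let ?U = "chart V k \<inter> chart V i"
      have U: "Op ?U" using chart_open k il by auto
      \<comment> \<open>Expanded by \<open>row k p \<xi> $ a\<close>, so that the denominator
        vanishes outside the chart of the pulled back bundle as well.\<close>
      let ?A = "\<lambda>p \<xi>. row k p \<xi> $ a * row k p \<xi> $ a" and ?B = "\<lambda>p \<xi>. tr k i p \<xi> $ l * row k p \<xi> $ a"
      have 1: "(\<lambda>p \<xi>. tr k i p \<xi> $ l) \<in> form_over (R ?U) r 1" "(\<lambda>p \<xi>. row k p \<xi> $ a) \<in> form_over (R ?U) r 1"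
        using tr_form_over[OF k(1) il(2) U _ _ il(3)] row_form_over[OF k(1) U _ a] by auto
      have "?A \<in> form_over (R ?U) r (1 + 1)" "?B \<in> form_over (R ?U) r (1 + 1)"
        by (intro form_over_mult fun_ring_R U 1)+
      moreover have "pb_pt V k q \<eta> \<in> lchart O1 il \<inter> lchart ?L a \<and>
          iso_coeff il a (pb_pt V k q \<eta>) = ?A q \<eta> / ?B q \<eta>"
        if "q \<in> ?U" "\<eta> \<in> nonzero_vecs r" "?B q \<eta> \<noteq> 0" for q \<eta>
        using that k il a iso_coeff_pb_pt[OF k(1) il(2) _ _ _ il(3) a, of q \<eta>] lchart_O1_iff lc
        by (auto simp: nonzero_vecs_def)
      ultimately show "pb_quot (lchart O1 il \<inter> lchart ?L a) (iso_coeff il a) k p \<xi>"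
        using U p k by (intro pb_quotI[of ?U p k ?A _ ?B]) auto
    qed
    fix P assume P: "P \<in> lchart O1 il \<inter> lchart ?L a"
    then obtain p \<xi> where \<xi>: "P = pb_pt V i p \<xi>" "p \<in> chart V i" "\<xi> \<in> nonzero_vecs r" "\<xi> $ l \<noteq> 0"
      unfolding il by (auto simp: pb_O1_def pb_basic_def)
    have \<xi>c: "\<xi> \<in> carrier_vec r" using \<xi> by (simp add: nonzero_vecs_def)
    have "row i p \<xi> $ a \<noteq> 0" using P \<xi> lc[OF il(2) \<xi>(2,3) a] by simp
    then show "iso_coeff il a P \<noteq> 0"
      unfolding il \<xi>(1) iso_coeff_pb_pt[OF il(2,2) \<xi>(2,2) \<xi>c il(3) a] tr_id[OF il(2) \<xi>(2) \<xi>c] using \<xi>(4) by simp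
  next
    fix il jm a b P assume "il \<in> lindex O1" "jm \<in> lindex O1" "a \<in> lindex ?L" "b \<in> lindex ?L"
      and P: "P \<in> lchart O1 il \<inter> lchart O1 jm \<inter> lchart ?L a \<inter> lchart ?L b"
    then obtain i l j l' where il: "il = (i, l)" "i \<in> index V" "l < r" and jm: "jm = (j, l')" "j \<in> index V" "l' < r"
      and ab: "a < N" "b < N" using N_eq by (auto simp: pb_O1_def pullback_def proj_O1_def)
    obtain p \<xi> where \<xi>: "P = pb_pt V i p \<xi>" "p \<in> chart V i" "\<xi> \<in> nonzero_vecs r" "\<xi> $ l \<noteq> 0"
      using P unfolding il by (auto simp: pb_O1_def pb_basic_def)
    have \<xi>c: "\<xi> \<in> carrier_vec r" using \<xi> by (simp add: nonzero_vecs_def)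
    have pj: "p \<in> chart V j" "tr i j p \<xi> $ l' \<noteq> 0"
      using P \<xi> lchart_O1_iff[OF jm(2,3) il(2) \<xi>(2,3)] unfolding jm by auto
    have ra: "row i p \<xi> $ a \<noteq> 0" using P \<xi> lc[OF il(2) \<xi>(2,3) ab(1)] by simp
    show "iso_coeff il a P * ltrans ?L a b P = ltrans O1 il jm P * iso_coeff jm b P"
      unfolding il(1) jm(1) \<xi>(1) iso_coeff_pb_pt[OF il(2,2) \<xi>(2,2) \<xi>c il(3) ab(1)]
        iso_coeff_pb_pt[OF il(2) jm(2) \<xi>(2) pj(1) \<xi>c jm(3) ab(2)]
        lt[OF il(2) \<xi>(2) \<xi>c ab] ltrans_O1[OF il(2) jm(2) \<xi>(2) pj(1) \<xi>c jm(3) il(3)] tr_id[OF il(2) \<xi>(2) \<xi>c]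
      using ra pj by simp
  qed
  then show ?thesis unfolding very_ample_def tp using closed_immersion_emb by blast
qed

lemma ample_V: "ample (proj_space n) V"
  unfolding ample_def ample_line_bundle_def
  using vector_bundle line_bundle_O1 very_ample_O1 by (intro conjI exI[of _ 1]) auto

end

section \<open>Existence of presentations\<close>

lemma sum_split_block:
  fixes f :: "nat \<Rightarrow> 'a::comm_monoid_add"
  shows "(\<Sum>u<r + t. f u) = (\<Sum>u<t. f u) + (\<Sum>k<r. f (t + k))"
  by (induction r) (simp_all add: add.assoc add.commute[of t])

text \<open>The index \<open>i\<close> encodes the list of the positions of the entries 1 in the unit columns
  that complement \<open>M(x)\<close>.\<close>

definition frame_mat :: "nat \<Rightarrow> nat \<Rightarrow> nat \<Rightarrow> complex mat" where
  "frame_mat N r i = mat N r (\<lambda>(s, k). if s = list_decode i ! k then 1 else 0)"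

definition frame :: "nat \<Rightarrow> nat \<Rightarrow> nat \<Rightarrow> (nat \<Rightarrow> complex mat) \<Rightarrow> nat \<Rightarrow> complex vec \<Rightarrow> complex mat" where
  "frame n t r M i x = mat (r + t) (r + t) (\<lambda>(s, u). if u < t then (\<Sum>l\<le>n. x $ l * M l $$ (s, u))
     else if s = list_decode i ! (u - t) then 1 else 0)"

text \<open>The last \<open>r\<close> rows of the inverse of the frame. Both adjugate entries and
  determinant are forms of degree \<open>t\<close>, so the quotients are functions on projective
  space.\<close>

definition frame_quot :: "nat \<Rightarrow> nat \<Rightarrow> nat \<Rightarrow> (nat \<Rightarrow> complex mat) \<Rightarrow> nat \<Rightarrow> pt \<Rightarrow> complex mat" where
  "frame_quot n t r M i P = mat r (r + t) (\<lambda>(k, s).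
     quot_fun (\<lambda>x. adj_mat (frame n t r M i x) $$ (t + k, s)) (\<lambda>x. det (frame n t r M i x)) P)"

text \<open>The cokernel of \<open>M\<close>, trivialised on chart \<open>i\<close> by the unit
  columns of the frame; the transition matrix expresses the unit columns of \<open>j\<close> by
  those of \<open>i\<close>. A code whose determinant vanishes identically gives an empty
  chart.\<close>

definition frame_bundle :: "nat \<Rightarrow> nat \<Rightarrow> nat \<Rightarrow> (nat \<Rightarrow> complex mat) \<Rightarrow> (nat, pt) vbundle" where
  "frame_bundle n t r M = \<lparr>rank = r, index = UNIV,
     chart = (\<lambda>i. proj_basic n (\<lambda>x. det (frame n t r M i x))),
     trans = (\<lambda>i j P. frame_quot n t r M i P * frame_mat (r + t) r j)\<rparr>"

lemma frame_carrier: "frame n t r M i x \<in> carrier_mat (r + t) (r + t)"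
  by (simp add: frame_def)

lemma frame_entry_form:
  assumes "s < r + t" "u < r + t"
  shows "form (Suc n) (if u < t then 1 else 0) (\<lambda>x. frame n t r M i x $$ (s, u))"
proof (cases "u < t")
  case True
  have "form (Suc n) 1 (\<lambda>x. \<Sum>l\<le>n. M l $$ (s, u) * x $ l)"
    by (intro form_sum form_smult form_coord) auto
  then show ?thesis using assms True by (simp add: frame_def mult.commute)
next
  case False
  then show ?thesis using assms form_const[of "Suc n"] by (simp add: frame_def)
qed

lemma frame_det_form: "form (Suc n) t (\<lambda>x. det (frame n t r M i x))"
proof -
  have "form (Suc n) (\<Sum>u<r + t. if u < t then 1 else 0) (\<lambda>x. det (frame n t r M i x))"
    by (rule form_det[OF zero_less_Suc frame_carrier frame_entry_form])
  then show ?thesis by (simp add: sum_split_block)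
qed

text \<open>The cofactor omits the column \<open>t + k\<close>, a constant one, so no degree is
  lost.\<close>

lemma frame_adj_form:
  assumes "k < r" "s < r + t"
  shows "form (Suc n) t (\<lambda>x. adj_mat (frame n t r M i x) $$ (t + k, s))"
proof -
  have "(\<Sum>u\<in>{..<r + t} - {t + k}. if u < t then 1 else 0) = (\<Sum>u<r + t. if u < t then 1 else (0 :: nat))"
    using assms by (intro sum.mono_neutral_left) auto
  also have "\<dots> = t" by (simp add: sum_split_block)
  finally have *: "(\<Sum>u\<in>{..<r + t} - {t + k}. if u < t then 1 else 0) = t" .
  have "form (Suc n) (\<Sum>u\<in>{..<r + t} - {t + k}. if u < t then 1 else 0)
      (\<lambda>x. adj_mat (frame n t r M i x) $$ (t + k, s))"
    by (rule form_adj[OF zero_less_Suc frame_carrier frame_entry_form]) (use assms in auto)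
  then show ?thesis unfolding * .
qed

text \<open>Where the frame \<open>(M(x) | E\<^sub>i)\<close> is invertible, the last rows of its inverse are a projection
  onto the span of \<open>E\<^sub>i\<close> along the image of \<open>M(x)\<close>.\<close>

lemma frame_quot_props:
  assumes x: "x \<in> nonzero_vecs (Suc n)" and d: "det (frame n t r M i x) \<noteq> 0"
  defines "Q \<equiv> frame_quot n t r M i (ray x)" and "H \<equiv> hom_at n t (r + t) M x" and "E \<equiv> frame_mat (r + t) r i"
  shows "Q \<in> carrier_mat r (r + t)" "Q * H = 0\<^sub>m r t" "Q * E = 1\<^sub>m r"
    "\<exists>P\<in>carrier_mat t (r + t). H * P + E * Q = 1\<^sub>m (r + t)"
proof -
  let ?N = "r + t" and ?C = "frame n t r M i x" and ?A = "adj_mat (frame n t r M i x)"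
  note C = frame_carrier[of n t r M i x]
  note A = adj_mat[OF C]
  have Qe: "Q $$ (k, s) = ?A $$ (t + k, s) / det ?C" if "k < r" "s < ?N" for k s
    using that quot_fun_ray[OF frame_adj_form[OF that] frame_det_form x]
    by (simp add: Q_def frame_quot_def)
  show Q: "Q \<in> carrier_mat r ?N" by (simp add: Q_def frame_quot_def)
  have H: "H \<in> carrier_mat ?N t" by (simp add: H_def hom_at_carrier)
  have E: "E \<in> carrier_mat ?N r" by (simp add: E_def frame_mat_def)
  have CH: "?C $$ (s, u) = H $$ (s, u)" if "s < ?N" "u < t" for s u
    using that by (simp add: frame_def H_def hom_at_def)
  have CE: "?C $$ (s, t + k) = E $$ (s, k)" if "s < ?N" "k < r" for s k
    using that by (simp add: frame_def E_def frame_mat_def)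
  have AC: "(\<Sum>s<?N. ?A $$ (v, s) * ?C $$ (s, u)) = (if v = u then det ?C else 0)" if "v < ?N" "u < ?N" for u v
  proof -
    have 1: "(?A * ?C) $$ (v, u) = (\<Sum>s<?N. ?A $$ (v, s) * ?C $$ (s, u))"
      using that A(1) C by (simp add: scalar_prod_def lessThan_atLeast0)
    have 2: "(?A * ?C) $$ (v, u) = (if v = u then det ?C else 0)"
      unfolding A(3) using that by simp
    show ?thesis by (rule trans[OF sym[OF 1] 2])
  qed
  have CA: "(\<Sum>u<?N. ?C $$ (v, u) * ?A $$ (u, s)) = (if v = s then det ?C else 0)" if "v < ?N" "s < ?N" for v s
  proof -
    have 1: "(?C * ?A) $$ (v, s) = (\<Sum>u<?N. ?C $$ (v, u) * ?A $$ (u, s))"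
      using that A(1) C by (simp add: scalar_prod_def lessThan_atLeast0)
    have 2: "(?C * ?A) $$ (v, s) = (if v = s then det ?C else 0)"
      unfolding A(2) using that by simp
    show ?thesis by (rule trans[OF sym[OF 1] 2])
  qed
  have QC: "(\<Sum>s<?N. Q $$ (k, s) * ?C $$ (s, u)) = (if t + k = u then 1 else 0)" if "k < r" "u < ?N" for k u
  proof -
    have "(\<Sum>s<?N. Q $$ (k, s) * ?C $$ (s, u)) = (\<Sum>s<?N. ?A $$ (t + k, s) * ?C $$ (s, u)) / det ?C"
      unfolding sum_divide_distrib using that by (intro sum.cong refl) (simp add: Qe)
    then show ?thesis using AC[of "t + k" u] that d by simp
  qed
  show "Q * H = 0\<^sub>m r t"
  proof (rule eq_matI)
    fix k u assume "k < dim_row (0\<^sub>m r t)" "u < dim_col (0\<^sub>m r t)"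
    then have ku: "k < r" "u < t" by auto
    have "(Q * H) $$ (k, u) = (\<Sum>s<?N. Q $$ (k, s) * H $$ (s, u))"
      using ku Q H by (simp add: scalar_prod_def lessThan_atLeast0)
    also have "\<dots> = (\<Sum>s<?N. Q $$ (k, s) * ?C $$ (s, u))" using ku by (intro sum.cong refl) (simp add: CH)
    finally show "(Q * H) $$ (k, u) = 0\<^sub>m r t $$ (k, u)" using ku QC[of k u] by simp
  qed (use Q H in auto)
  show "Q * E = 1\<^sub>m r"
  proof (rule eq_matI)
    fix k u assume "k < dim_row (1\<^sub>m r)" "u < dim_col (1\<^sub>m r)"
    then have ku: "k < r" "u < r" by auto
    have "(Q * E) $$ (k, u) = (\<Sum>s<?N. Q $$ (k, s) * E $$ (s, u))"
      using ku Q E by (simp add: scalar_prod_def lessThan_atLeast0)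
    also have "\<dots> = (\<Sum>s<?N. Q $$ (k, s) * ?C $$ (s, t + u))" using ku by (intro sum.cong refl) (simp add: CE)
    finally show "(Q * E) $$ (k, u) = 1\<^sub>m r $$ (k, u)" using ku QC[of k "t + u"] by simp
  qed (use Q E in auto)
  define P where "P = mat t ?N (\<lambda>(u, s). ?A $$ (u, s) / det ?C)"
  have P: "P \<in> carrier_mat t ?N" by (simp add: P_def)
  have "H * P + E * Q = 1\<^sub>m ?N"
  proof (rule eq_matI)
    fix v s assume "v < dim_row (1\<^sub>m ?N)" "s < dim_col (1\<^sub>m ?N)"
    then have vs: "v < ?N" "s < ?N" by auto
    have "(H * P + E * Q) $$ (v, s) = (\<Sum>u<t. H $$ (v, u) * P $$ (u, s)) + (\<Sum>k<r. E $$ (v, k) * Q $$ (k, s))"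
      using vs H P E Q by (simp add: scalar_prod_def lessThan_atLeast0)
    also have "\<dots> = ((\<Sum>u<t. ?C $$ (v, u) * ?A $$ (u, s)) + (\<Sum>k<r. ?C $$ (v, t + k) * ?A $$ (t + k, s))) / det ?C"
      using vs by (simp add: P_def Qe CH CE add_divide_distrib sum_divide_distrib)
    also have "\<dots> = (\<Sum>u<?N. ?C $$ (v, u) * ?A $$ (u, s)) / det ?C" by (simp add: sum_split_block)
    finally show "(H * P + E * Q) $$ (v, s) = 1\<^sub>m ?N $$ (v, s)" using CA[OF vs] vs d by simp
  qed (use H P E Q in auto)
  then show "\<exists>P\<in>carrier_mat t ?N. H * P + E * Q = 1\<^sub>m ?N" using P by blast
qed

lemma frame_mat_carrier: "frame_mat N r i \<in> carrier_mat N r"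
  by (simp add: frame_mat_def)

text \<open>In the frame \<open>j\<close> the identity splits as \<open>H * P + E * Q\<close>. The
  quotient of the frame \<open>i\<close> annihilates the image of \<open>H\<close>, so only the
  second summand survives. Both the cocycle condition and the compatibility of the quotient maps
  with the transitions follow.\<close>

lemma frame_quot_change:
  assumes x: "x \<in> nonzero_vecs (Suc n)" and "det (frame n t r M i x) \<noteq> 0" "det (frame n t r M j x) \<noteq> 0"
  shows "frame_quot n t r M i (ray x) * frame_mat (r + t) r j * frame_quot n t r M j (ray x)
    = frame_quot n t r M i (ray x)"
proof -
  let ?Qi = "frame_quot n t r M i (ray x)" and ?Qj = "frame_quot n t r M j (ray x)"
    and ?E = "frame_mat (r + t) r j" and ?H = "hom_at n t (r + t) M x"
  note i = frame_quot_props[OF x assms(2)] and j = frame_quot_props[OF x assms(3)]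
  note E = frame_mat_carrier[of "r + t" r j] and H = hom_at_carrier[of n t "r + t" M x]
  obtain P where P: "P \<in> carrier_mat t (r + t)" "?H * P + ?E * ?Qj = 1\<^sub>m (r + t)" using j(4) by blast
  have "?Qi * (?H * P + ?E * ?Qj) = ?Qi * (?H * P) + ?Qi * (?E * ?Qj)"
    using i(1) H P(1) E j(1) by (intro mult_add_distrib_mat) auto
  also have "?Qi * (?H * P) = ?Qi * ?H * P" by (rule assoc_mult_mat[OF i(1) H P(1), symmetric])
  also have "\<dots> = 0\<^sub>m r (r + t)" unfolding i(2) using P(1) by simp
  also have "?Qi * (?E * ?Qj) = ?Qi * ?E * ?Qj" by (rule assoc_mult_mat[OF i(1) E j(1), symmetric])
  finally have "?Qi = 0\<^sub>m r (r + t) + ?Qi * ?E * ?Qj" unfolding P(2) using i(1) by simp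
  moreover have "?Qi * ?E * ?Qj \<in> carrier_mat r (r + t)" using i(1) E j(1) by auto
  ultimately show ?thesis by simp
qed

lemma frame_quot_regular:
  assumes "k < r" "s < r + t"
  shows "(\<lambda>P. frame_quot n t r M i P $$ (k, s)) \<in> regular (proj_space n) (proj_basic n (\<lambda>x. det (frame n t r M i x)))"
proof -
  have "quot_fun (\<lambda>x. adj_mat (frame n t r M i x) $$ (t + k, s)) (\<lambda>x. det (frame n t r M i x))
      \<in> regular (proj_space n) (proj_basic n (\<lambda>x. det (frame n t r M i x)))"
    by (rule quot_fun_regular[OF frame_adj_form[OF assms] frame_det_form])
  then show ?thesis using assms by (simp add: frame_quot_def)
qed

lemma frame_exists:
  assumes "inj_on (\<lambda>c. hom_at n t (r + t) M x *\<^sub>v c) (carrier_vec t)"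
  shows "\<exists>i. det (frame n t r M i x) \<noteq> 0"
proof -
  obtain f where f: "det (mat (r + t) (r + t) (\<lambda>(s, u). if u < t then hom_at n t (r + t) M x $$ (s, u)
      else if s = f (u - t) then 1 else 0)) \<noteq> (0 :: complex)"
    using complement_by_unit_columns[OF hom_at_carrier assms] by blast
  have "mat (r + t) (r + t) (\<lambda>(s, u). if u < t then hom_at n t (r + t) M x $$ (s, u)
      else if s = f (u - t) then 1 else 0) = frame n t r M (list_encode (map f [0..<r])) x"
    by (intro eq_matI) (auto simp: frame_def hom_at_def)
  then show ?thesis using f by metis
qed

text \<open>Exactness is read off from the block identities of the frame: \<open>Q * H = 0\<close>
  and \<open>H * P + E * Q = 1\<close> identify the kernel of \<open>Q\<close> with the image of
  \<open>H\<close>, and \<open>Q * E = 1\<close> gives surjectivity.\<close>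

lemma presentation_exists:
  assumes M: "M \<in> hom_space n t (r + t)"
    and inj: "\<And>x. x \<in> nonzero_vecs (Suc n) \<Longrightarrow> inj_on (\<lambda>c. hom_at n t (r + t) M x *\<^sub>v c) (carrier_vec t)"
  shows "presentation n t (r + t) M (frame_bundle n t r M) (frame_quot n t r M)"
proof -
  let ?N = "r + t" and ?V = "frame_bundle n t r M" and ?Q = "frame_quot n t r M"
  have rank_V: "rank ?V = r" by (simp add: frame_bundle_def)
  let ?D = "\<lambda>i. proj_basic n (\<lambda>x. det (frame n t r M i x))"
  have D: "\<exists>x\<in>nonzero_vecs (Suc n). p = ray x \<and> det (frame n t r M i x) \<noteq> 0" if "p \<in> ?D i" for p i
    using that by (auto simp: proj_basic_def)
  have Dray: "ray x \<in> ?D i \<longleftrightarrow> det (frame n t r M i x) \<noteq> 0" if "x \<in> nonzero_vecs (Suc n)" for x i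
    by (rule proj_basic_iff[OF frame_det_form that])
  have op: "openin (topol (proj_space n)) (?D i)" for i by (rule openin_proj_basic[OF frame_det_form])
  have Qc: "?Q i p \<in> carrier_mat r ?N" for i p by (simp add: frame_quot_def)
  note Ec = frame_mat_carrier[of ?N r]
  have change: "?Q i p * frame_mat ?N r j * ?Q j p = ?Q i p" if p: "p \<in> ?D i" "p \<in> ?D j" for i j p
  proof -
    obtain x where x: "x \<in> nonzero_vecs (Suc n)" "p = ray x" using D[OF p(1)] by blast
    have "det (frame n t r M i x) \<noteq> 0" "det (frame n t r M j x) \<noteq> 0"
      using p Dray[OF x(1)] unfolding x(2) by blast+
    then show ?thesis unfolding x(2) by (rule frame_quot_change[OF x(1)])
  qed
  have unit: "?Q i p * frame_mat ?N r i = 1\<^sub>m r" if p: "p \<in> ?D i" for i p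
    using D[OF p] frame_quot_props(3) by blast
  have vb: "vector_bundle (proj_space n) ?V"
    unfolding vector_bundle_def
  proof (intro conjI ballI)
    show "openin (topol (proj_space n)) (chart ?V i)" for i using op by (simp add: frame_bundle_def)
    show "(\<Union>i\<in>index ?V. chart ?V i) = topspace (topol (proj_space n))"
    proof
      show "(\<Union>i\<in>index ?V. chart ?V i) \<subseteq> topspace (topol (proj_space n))"
        using openin_subset[OF op] by (auto simp: frame_bundle_def)
      show "topspace (topol (proj_space n)) \<subseteq> (\<Union>i\<in>index ?V. chart ?V i)"
        using frame_exists[OF inj] Dray by (fastforce simp: topspace_proj frame_bundle_def)
    qed
    show "trans ?V i i p = 1\<^sub>m (rank ?V)" if "p \<in> chart ?V i" for i p
      using that unit by (simp add: frame_bundle_def)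
    show "trans ?V i j p * trans ?V j k p = trans ?V i k p" if "p \<in> chart ?V i \<inter> chart ?V j \<inter> chart ?V k" for i j k p
    proof -
      have p: "p \<in> ?D i" "p \<in> ?D j" using that by (auto simp: frame_bundle_def)
      have "?Q i p * frame_mat ?N r j * (?Q j p * frame_mat ?N r k)
          = ?Q i p * frame_mat ?N r j * ?Q j p * frame_mat ?N r k"
        by (rule assoc_mult_mat[OF mult_carrier_mat[OF Qc Ec] Qc Ec, symmetric])
      then show ?thesis using change[OF p] by (simp add: frame_bundle_def)
    qed
    fix i j
    show "regular_mat (proj_space n) (chart ?V i \<inter> chart ?V j) (rank ?V) (rank ?V) (trans ?V i j)"
      unfolding regular_mat_def
    proof (intro conjI ballI allI impI)
      show "trans ?V i j p \<in> carrier_mat (rank ?V) (rank ?V)" for p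
        using mult_carrier_mat[OF Qc Ec] by (simp add: frame_bundle_def)
      fix k l assume "k < rank ?V" "l < rank ?V"
      then have kl: "k < r" "l < r" by (auto simp: frame_bundle_def)
      have W: "openin (topol (proj_space n)) (?D i \<inter> ?D j)" using op by auto
      note ring = fun_ring_regular_proj[OF W]
      have "(\<lambda>p. ?Q i p $$ (k, s)) \<in> regular (proj_space n) (?D i \<inter> ?D j)" if "s < ?N" for s
        by (rule regular_proj_restrict[OF frame_quot_regular[OF kl(1) that] W]) simp
      then have "(\<lambda>p. \<Sum>s<?N. ?Q i p $$ (k, s) * frame_mat ?N r j $$ (s, l)) \<in> regular (proj_space n) (?D i \<inter> ?D j)"
        by (intro fun_ring_sum[OF ring] fun_ringD(3)[OF ring] fun_ringD(1)[OF ring]) auto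
      moreover have "(?Q i p * frame_mat ?N r j) $$ (k, l) = (\<Sum>s<?N. ?Q i p $$ (k, s) * frame_mat ?N r j $$ (s, l))" for p
        using kl Qc[of i p] Ec[of j] by (simp add: scalar_prod_def lessThan_atLeast0)
      ultimately show "(\<lambda>p. trans ?V i j p $$ (k, l)) \<in> regular (proj_space n) (chart ?V i \<inter> chart ?V j)"
        by (simp add: frame_bundle_def)
    qed
  qed
  have rm: "regular_mat (proj_space n) (chart ?V i) (rank ?V) ?N (?Q i)" for i
    using frame_quot_regular[of _ r _ t n M i] Qc by (simp add: regular_mat_def frame_bundle_def)
  have qt: "?Q i p = trans ?V i j p * ?Q j p" if "p \<in> chart ?V i \<inter> chart ?V j" for i j p
    using that change[of p i j] by (simp add: frame_bundle_def)
  have ex: "(\<lambda>c. hom_at n t ?N M x *\<^sub>v c) ` carrier_vec t = mat_kernel (?Q i (ray x)) \<and>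
        (\<lambda>v. ?Q i (ray x) *\<^sub>v v) ` carrier_vec ?N = carrier_vec (rank ?V)"
    if x: "x \<in> nonzero_vecs (Suc n)" and i: "ray x \<in> chart ?V i" for i x
  proof -
    let ?H = "hom_at n t ?N M x" and ?q = "?Q i (ray x)" and ?E = "frame_mat ?N r i"
    have "det (frame n t r M i x) \<noteq> 0" using i Dray[OF x] by (simp add: frame_bundle_def)
    note * = frame_quot_props[OF x this]
    note H = hom_at_carrier[of n t ?N M x] and E = Ec[of i] and q = Qc[of i "ray x"]
    obtain P where P: "P \<in> carrier_mat t ?N" "?H * P + ?E * ?q = 1\<^sub>m ?N" using *(4) by blast
    have "?H *\<^sub>v c \<in> mat_kernel ?q" if c: "c \<in> carrier_vec t" for c
    proof (rule mat_kernelI[OF q])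
      show "?H *\<^sub>v c \<in> carrier_vec ?N" by (rule mult_mat_vec_carrier[OF H c])
      have "?q *\<^sub>v (?H *\<^sub>v c) = (?q * ?H) *\<^sub>v c" by (rule assoc_mult_mat_vec[OF q H c, symmetric])
      then show "?q *\<^sub>v (?H *\<^sub>v c) = 0\<^sub>v r" unfolding *(2) using c by (auto intro!: eq_vecI)
    qed
    moreover have "v \<in> (\<lambda>c. ?H *\<^sub>v c) ` carrier_vec t" if v: "v \<in> mat_kernel ?q" for v
    proof -
      note v = mat_kernelD[OF q v]
      have Pv: "P *\<^sub>v v \<in> carrier_vec t" by (rule mult_mat_vec_carrier[OF P(1) v(1)])
      have "v = (?H * P + ?E * ?q) *\<^sub>v v" unfolding P(2) using v(1) by simp
      also have "\<dots> = (?H * P) *\<^sub>v v + (?E * ?q) *\<^sub>v v"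
        using H P(1) E q v(1) by (intro add_mult_distrib_mat_vec) auto
      also have "(?H * P) *\<^sub>v v = ?H *\<^sub>v (P *\<^sub>v v)" by (rule assoc_mult_mat_vec[OF H P(1) v(1)])
      also have "(?E * ?q) *\<^sub>v v = ?E *\<^sub>v (?q *\<^sub>v v)" by (rule assoc_mult_mat_vec[OF E q v(1)])
      also have "\<dots> = 0\<^sub>v ?N" unfolding v(2) using E by (auto intro!: eq_vecI)
      finally have "v = ?H *\<^sub>v (P *\<^sub>v v)" using mult_mat_vec_carrier[OF H Pv] by simp
      then show ?thesis using Pv by blast
    qed
    moreover have "w \<in> (\<lambda>v. ?q *\<^sub>v v) ` carrier_vec ?N" if w: "w \<in> carrier_vec r" for w
    proof (rule image_eqI)
      show "?E *\<^sub>v w \<in> carrier_vec ?N" by (rule mult_mat_vec_carrier[OF E w])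
      show "w = ?q *\<^sub>v (?E *\<^sub>v w)" using assoc_mult_mat_vec[OF q E w] w unfolding *(3) by simp
    qed
    moreover have "?q *\<^sub>v v \<in> carrier_vec r" if "v \<in> carrier_vec ?N" for v
      by (rule mult_mat_vec_carrier[OF q that])
    ultimately show ?thesis by (auto simp: rank_V image_subset_iff)
  qed
  show ?thesis unfolding presentation_def
    by (intro conjI ballI impI M vb rm qt inj conjunct1[OF ex] conjunct2[OF ex])
qed

lemma ample_if_separating:
  assumes "presentation n t (Suc m) M V q" "separating n t (Suc m) M"
  shows "ample (proj_space n) V"
proof -
  have "vector_bundle (proj_space n) V" using assms(1) unfolding presentation_def by blast
  then interpret presented n V t m "Suc m" M q
    by unfold_locales (rule assms refl | assumption)+
  show ?thesis by (rule ample_V)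
qed

text \<open>Where \<open>nat\<close> truncates the bound to 0 it holds trivially. Charts indexed by
  natural numbers are no restriction, projective space being quasi-compact. The second half also
  asserts that every \<open>M\<close> in \<open>U\<close> does present a bundle.\<close>

theorem proposition6p1:
  fixes n t r :: nat
  assumes "n \<ge> 1" and "t > 0" and "r \<ge> n"
  shows "(\<exists>S. closedin (hom_zariski n t (r + t)) S \<and>
            codim (hom_zariski n t (r + t)) S \<ge> enat (nat (int t - int r - 2 * int n + 3)) \<and>
            (\<forall>M \<in> hom_space n t (r + t) - S. \<forall>(V :: (nat, pt) vbundle) q.
               presentation n t (r + t) M V q \<longrightarrow> ample (proj_space n) V)) \<and>
         (int t - int r > 2 * int n - 3 \<longrightarrow>
           (\<exists>U. openin (hom_zariski n t (r + t)) U \<and> U \<noteq> {} \<and>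
             (\<forall>M \<in> U. (\<exists>(V :: (nat, pt) vbundle) q. presentation n t (r + t) M V q) \<and>
               (\<forall>(V :: (nat, pt) vbundle) q.
                  presentation n t (r + t) M V q \<longrightarrow> ample (proj_space n) V))))"
proof (intro conjI impI)
  have N: "r + t = Suc (r + t - 1)" using assms by simp
  have amp: "ample (proj_space n) V"
    if "separating n t (r + t) M" "presentation n t (r + t) M V q" for M and V :: "(nat, pt) vbundle" and q
    using ample_if_separating[of n t "r + t - 1" M V q] that N by simp
  show "\<exists>S. closedin (hom_zariski n t (r + t)) S \<and>
            codim (hom_zariski n t (r + t)) S \<ge> enat (nat (int t - int r - 2 * int n + 3)) \<and>
            (\<forall>M \<in> hom_space n t (r + t) - S. \<forall>(V :: (nat, pt) vbundle) q.
               presentation n t (r + t) M V q \<longrightarrow> ample (proj_space n) V)"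
    using hom_codim[OF assms(1,2) refl, of r] amp by blast
  assume "int t - int r > 2 * int n - 3"
  from hom_generic[OF assms(1,2) refl assms(3) this] obtain U where U: "openin (hom_zariski n t (r + t)) U" "U \<noteq> {}"
    "\<And>M. M \<in> U \<Longrightarrow> M \<in> hom_space n t (r + t) \<and> separating n t (r + t) M \<and>
      (\<forall>x\<in>nonzero_vecs (Suc n). inj_on (\<lambda>c. hom_at n t (r + t) M x *\<^sub>v c) (carrier_vec t))" by blast
  have "\<exists>(V :: (nat, pt) vbundle) q. presentation n t (r + t) M V q" if "M \<in> U" for M
    using presentation_exists[of M n t r] U(3)[OF that] by blast
  moreover have "ample (proj_space n) V" if "M \<in> U" "presentation n t (r + t) M V q"
    for M and V :: "(nat, pt) vbundle" and q
    using amp[OF _ that(2)] U(3)[OF that(1)] by simp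
  ultimately show "\<exists>U. openin (hom_zariski n t (r + t)) U \<and> U \<noteq> {} \<and>
             (\<forall>M \<in> U. (\<exists>(V :: (nat, pt) vbundle) q. presentation n t (r + t) M V q) \<and>
               (\<forall>(V :: (nat, pt) vbundle) q.
                  presentation n t (r + t) M V q \<longrightarrow> ample (proj_space n) V))"
    using U(1,2) by (intro exI[of _ U]) simp
qed

end
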